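(* Let $d\ge1$, $\alpha\ge1$, $t_{\mathrm{fin}}\in(0,\infty)$. Let $(\chi_N)_{N\ge1}$ be any sequence of positive numbers with $\chi_N\to0$ and fix $a,b>0$. Let $\eta^N_\bullet$ be the rescaled zero-range process with parameter $\alpha$ and initial data $\eta^N_0\sim\Pi^N_a$. Then there exist a constant $\beta>0$ and a strict Young function $\Phi$, depending only on the sequence $(\chi_N)_{N\ge1}$, such that $$\limsup_{N\to\infty}\frac{\chi_N}{N^d}\log\mathbb{E}_{\Pi^N_a}\left[\exp\left(\frac{\beta N^d}{\chi_N}\int_0^{t_{\mathrm{fin}}}\|(\eta^N_s)^\alpha\|_{\ell_\Phi}\,1(\eta^N_s\in X_{N,b})\,ds\right)\right]<\infty.$$
   Context: **Process.** $\mathbb{T}^d_N=\{0,\frac1N,\dots,\frac{N-1}N\}^d$ is the discrete torus. The state space is $X_N=(\chi_N\mathbb{N})^{\mathbb{T}^d_N}$ with $\mathbb N=\{0,1,2,\dots\}$. The rescaled zero-range process with parameter $\alpha$ is the continuous-time Markov process on $X_N$ with generator $N^2\mathcal{L}_N$, $$\mathcal{L}_NF(\eta^N)=\frac12\sum_{x\sim y}\frac{(\eta^N(x))^\alpha}{\chi_N}\left(F(\eta^{N,x,y})-F(\eta^N)\right),$$ where the sum runs over all directed nearest-neighbour edges $(x,y)$, $y=x\pm e_i/N$, of $\mathbb{T}^d_N$ ($2d$ per site $x$), and $\eta^{N,x,y}=\eta^N+\chi_N1_y-\chi_N1_x$. The dimension $d$ and parameter $\alpha$ are regarded as fixed throughout.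 **Equilibrium measure.** For $a>0$, $\Pi^N_a$ is the product probability measure on $X_N$ $$\Pi^N_a(\eta^N)=\prod_{x\in\mathbb{T}^d_N}\frac{(a/\chi_N)^{\alpha\eta^N(x)/\chi_N}}{((\eta^N(x)/\chi_N)!)^\alpha\,Z_\alpha(a/\chi_N)},$$ with $Z_\alpha$ the normalisation constant; it is reversible for the process. $\mathbb{E}_{\Pi^N_a}$ is the expectation for the process started from $\eta^N_0\sim\Pi^N_a$. **Mass bound.** $X_{N,b}=\{\eta^N\in X_N:\ N^{-d}\sum_{x\in\mathbb{T}^d_N}\eta^N(x)\le b\}$. **Orlicz norms.** A Young function is a map $\Phi:\mathbb{R}\to[0,\infty]$ which is convex, even, lower semicontinuous and neither the zero function nor the convex dual of the zero function. It is strict if $\Phi(u)<\infty$ for all $u\in\mathbb{R}$ and $\Phi(u)/u\to\infty$ as $u\to\infty$; all Young functions are taken with $\Phi(0)=0$. For $h:\mathbb{T}^d_N\to\mathbb{R}$, $$\|h\|_{\ell_\Phi}=\inf\Big\{t\ge0:\ \frac1{N^d}\sum_{x\in\mathbb{T}^d_N}\Phi\Big(\frac{h(x)}t\Big)\le1\Big\}.$$ *)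

theory Defs
  imports "HOL-Probability.Probability"
begin

section \<open>Continuous-time Markov processes on a countable state space\<close>

definition cadlag :: "(real \<Rightarrow> 'b::topological_space) \<Rightarrow> bool" where
  "cadlag f \<longleftrightarrow>
     (\<forall>t\<ge>0. continuous (at_right t) f) \<and>
     (\<forall>t>0. \<exists>l. (f \<longlongrightarrow> l) (at_left t))"

definition bdd_fun_on :: "'s set \<Rightarrow> ('s \<Rightarrow> real) \<Rightarrow> bool" where
  "bdd_fun_on S F \<longleftrightarrow> (\<exists>B. \<forall>x\<in>S. \<bar>F x\<bar> \<le> B)"

text \<open>\<open>K t x\<close> is the law at time \<open>t\<close> started from \<open>x\<close>. The generator is the pointwise
  right derivative at time 0 of the transition semigroup, tested on all bounded functions.\<close>

definition transition_kernel ::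
  "'s set \<Rightarrow> (('s \<Rightarrow> real) \<Rightarrow> 's \<Rightarrow> real) \<Rightarrow> (real \<Rightarrow> 's \<Rightarrow> 's pmf) \<Rightarrow> bool" where
  "transition_kernel S G K \<longleftrightarrow>
     (\<forall>x\<in>S. K 0 x = return_pmf x) \<and>
     (\<forall>x\<in>S. \<forall>t\<ge>0. set_pmf (K t x) \<subseteq> S) \<and>
     (\<forall>x\<in>S. \<forall>s\<ge>0. \<forall>t\<ge>0. K (s + t) x = bind_pmf (K s x) (K t)) \<and>
     (\<forall>F. bdd_fun_on S F \<longrightarrow> (\<forall>x\<in>S.
        ((\<lambda>h. (measure_pmf.expectation (K h x) F - F x) / h) \<longlongrightarrow> G F x) (at_right 0)))"

definition past_sigma :: "'w measure \<Rightarrow> 's set \<Rightarrow> (real \<Rightarrow> 'w \<Rightarrow> 's) \<Rightarrow> real \<Rightarrow> 'w measure" where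
  "past_sigma M S X s =
     sigma (space M) {X u -` A \<inter> space M | u A. 0 \<le> u \<and> u \<le> s \<and> A \<subseteq> S}"

text \<open>The state space \<open>S\<close> carries the discrete sigma-algebra; the topology of the ambient type
  enters only through the regularity of the sample paths.\<close>

definition markov_process ::
  "'w measure \<Rightarrow> 's::topological_space set \<Rightarrow> (('s \<Rightarrow> real) \<Rightarrow> 's \<Rightarrow> real)
     \<Rightarrow> (real \<Rightarrow> 'w \<Rightarrow> 's) \<Rightarrow> bool" where
  "markov_process M S G X \<longleftrightarrow>
     prob_space M \<and>
     (\<forall>t\<ge>0. X t \<in> measurable M (count_space S)) \<and>
     (\<forall>\<omega>\<in>space M. cadlag (\<lambda>t. X t \<omega>)) \<and>
     (\<exists>K. transition_kernel S G K \<and>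
        (\<forall>s\<ge>0. \<forall>t\<ge>0. \<forall>F. bdd_fun_on S F \<longrightarrow>
           (AE \<omega> in M. real_cond_exp M (past_sigma M S X s) (\<lambda>\<omega>. F (X (s + t) \<omega>)) \<omega>
              = measure_pmf.expectation (K t (X s \<omega>)) F)))"

section \<open>The rescaled zero-range process\<close>

text \<open>The dimension is \<open>d = CARD('d)\<close>. A site \<open>x/N\<close> of the discrete torus is represented by its
  integer coordinates \<open>x\<close>, and a function on the torus by a function on \<^typ>\<open>'d \<Rightarrow> nat\<close> whose
  values off the torus play no role. Configurations are normalised to vanish there, so that each
  one has a unique representative.\<close>

definition torus :: "nat \<Rightarrow> ('d::finite \<Rightarrow> nat) set" where
  "torus N = {x. \<forall>i. x i < N}"

definition next_site :: "nat \<Rightarrow> 'd::finite \<Rightarrow> ('d \<Rightarrow> nat) \<Rightarrow> ('d \<Rightarrow> nat)" where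
  "next_site N i x = x(i := (x i + 1) mod N)"

definition prev_site :: "nat \<Rightarrow> 'd::finite \<Rightarrow> ('d \<Rightarrow> nat) \<Rightarrow> ('d \<Rightarrow> nat)" where
  "prev_site N i x = x(i := (x i + N - 1) mod N)"

definition configs :: "real \<Rightarrow> nat \<Rightarrow> (('d::finite \<Rightarrow> nat) \<Rightarrow> real) set" where
  "configs c N = {\<eta>. (\<forall>x\<in>torus N. \<exists>k::nat. \<eta> x = c * real k) \<and> (\<forall>x. x \<notin> torus N \<longrightarrow> \<eta> x = 0)}"

definition configs_mass_le :: "real \<Rightarrow> nat \<Rightarrow> real \<Rightarrow> (('d::finite \<Rightarrow> nat) \<Rightarrow> real) set" where
  "configs_mass_le c N b =
     {\<eta> \<in> configs c N. (\<Sum>x\<in>torus N. \<eta> x) / real N ^ CARD('d) \<le> b}"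

definition move :: "real \<Rightarrow> (('d::finite \<Rightarrow> nat) \<Rightarrow> real) \<Rightarrow> ('d \<Rightarrow> nat) \<Rightarrow> ('d \<Rightarrow> nat)
    \<Rightarrow> (('d \<Rightarrow> nat) \<Rightarrow> real)" where
  "move c \<eta> x y = (\<lambda>z. \<eta> z + c * of_bool (z = y) - c * of_bool (z = x))"

text \<open>Summing over directions rather than over pairs of sites counts \<open>2d\<close> directed edges per site
  also when the two neighbours in one direction coincide (\<open>N \<le> 2\<close>).\<close>

definition zr_generator :: "real \<Rightarrow> real \<Rightarrow> nat
    \<Rightarrow> ((('d::finite \<Rightarrow> nat) \<Rightarrow> real) \<Rightarrow> real) \<Rightarrow> (('d \<Rightarrow> nat) \<Rightarrow> real) \<Rightarrow> real" where
  "zr_generator \<alpha> c N F \<eta> =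
     1 / 2 * (\<Sum>x\<in>torus N. \<Sum>i\<in>UNIV. \<Sum>y\<leftarrow>[next_site N i x, prev_site N i x].
        (\<eta> x powr \<alpha>) / c * (F (move c \<eta> x y) - F \<eta>))"

definition zr_partition :: "real \<Rightarrow> real \<Rightarrow> real" where
  "zr_partition \<alpha> \<phi> = (\<Sum>k. \<phi> powr (\<alpha> * real k) / (fact k) powr \<alpha>)"

definition zr_equilibrium :: "real \<Rightarrow> real \<Rightarrow> nat \<Rightarrow> real \<Rightarrow> (('d::finite \<Rightarrow> nat) \<Rightarrow> real) measure" where
  "zr_equilibrium \<alpha> c N a = density (count_space (configs c N))
     (\<lambda>\<eta>. ennreal (\<Prod>x\<in>torus N.
        (a / c) powr (\<alpha> * \<eta> x / c) / ((fact (nat \<lfloor>\<eta> x / c\<rfloor>)) powr \<alpha> * zr_partition \<alpha> (a / c))))"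

definition zero_range_process :: "real \<Rightarrow> real \<Rightarrow> nat \<Rightarrow> 'w measure
    \<Rightarrow> (real \<Rightarrow> 'w \<Rightarrow> (('d::finite \<Rightarrow> nat) \<Rightarrow> real)) \<Rightarrow> bool" where
  "zero_range_process \<alpha> c N M \<eta> \<longleftrightarrow>
     markov_process M (configs c N) (\<lambda>F \<zeta>. (real N)\<^sup>2 * zr_generator \<alpha> c N F \<zeta>) \<eta>"

section \<open>Young functions and Orlicz norms\<close>

definition convex_dual :: "(real \<Rightarrow> ereal) \<Rightarrow> real \<Rightarrow> ereal" where
  "convex_dual f v = (SUP u. ereal (u * v) - f u)"

definition young_function :: "(real \<Rightarrow> ennreal) \<Rightarrow> bool" where
  "young_function \<Phi> \<longleftrightarrow>
     (\<forall>x y. \<forall>s\<in>{0..1}. \<Phi> (s * x + (1 - s) * y) \<le> ennreal s * \<Phi> x + ennreal (1 - s) * \<Phi> y) \<and>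
     (\<forall>u. \<Phi> (- u) = \<Phi> u) \<and>
     (\<forall>u. \<Phi> u \<le> Liminf (at u) \<Phi>) \<and>
     \<Phi> \<noteq> (\<lambda>_. 0) \<and>
     (\<lambda>u. enn2ereal (\<Phi> u)) \<noteq> convex_dual (\<lambda>_. 0) \<and>
     \<Phi> 0 = 0"

definition strict_young_function :: "(real \<Rightarrow> ennreal) \<Rightarrow> bool" where
  "strict_young_function \<Phi> \<longleftrightarrow>
     young_function \<Phi> \<and> (\<forall>u. \<Phi> u < \<infinity>) \<and> ((\<lambda>u. \<Phi> u / ennreal u) \<longlongrightarrow> \<infinity>) at_top"

text \<open>The value \<open>t = 0\<close> is left out because HOL has \<open>h x / 0 = 0\<close>, which would put 0 into the set
  for every \<open>h\<close>. With the intended reading of \<open>\<Phi> (h x / 0)\<close> as the limit for \<open>t\<close> tending to 0 from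
  above, the infimum is the same.\<close>

definition orlicz_norm :: "nat \<Rightarrow> (real \<Rightarrow> ennreal) \<Rightarrow> (('d::finite \<Rightarrow> nat) \<Rightarrow> real) \<Rightarrow> real" where
  "orlicz_norm N \<Phi> h =
     Inf {t. t > 0 \<and> ennreal (1 / real N ^ CARD('d)) * (\<Sum>x\<in>torus N. \<Phi> (h x / t)) \<le> 1}"

section \<open>Logarithm of extended nonnegative reals\<close>

definition ln_ennreal :: "ennreal \<Rightarrow> ereal" where
  "ln_ennreal x = (if x = 0 then - \<infinity> else if x = \<infinity> then \<infinity> else ereal (ln (enn2real x)))"

end

(* With h = eta^(alpha/2), the supersolution 1/sqrt(Pi) would bound the Dirichlet form of the nearest-neighbour dynamics
   below by the discrete H^1 norm of h, but with an error of order N^2 chi_N. Comparing first, by the moving particle lemma,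
   with jumps over macroscopic distances of order 2^-j leaves an error that vanishes with chi_N for each level j, which is
   harmless for the finitely many levels j allowed at a given N, their number growing with N at a speed dictated by chi. Control of h(x+z) - h(x) at the
   levels j and the mass bound give tightness of h^2 = eta^alpha above thresholds of order 2^(j d alpha), hence the Orlicz
   norm for a Young function with sparse kinks. The resulting bound for the top of the spectrum of N^2 L + V on the finite
   invariant set X_{N,b} turns into the exponential moment by the Feynman-Kac formula. *)
theory Submission
  imports Defs
begin

section \<open>Functions on the discrete torus\<close>

text \<open>A jump comparison is off by the increment of \<open>s powr (\<alpha> / 2)\<close> when
  one particle is added, which is small only relative to \<open>1 + s powr (\<alpha> / 2)\<close>.
  The error at level j is therefore a small multiple e_j of N^d plus twice the sum of h^2, with no
  factor N^2 in front: the N^2 of the time scale is spent on the comparison, since a path of l unit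
  steps costs l^2 and l is at most d N / 2^j. This cost decays like 4^-j, so all levels can be added
  with weight one, and with e_j of order 2^-j the errors add up as well. The remaining sum of h^2 is
  controlled by the oscillation at level 0 and absorbed; hence level 0 must always be admissible.
  Neither a nor b may enter \<beta> and \<Phi>. The factor a^\<alpha> stands in front of both the
  Dirichlet form and its jump comparison and cancels; b is taken up by adding b^\<alpha> to the
  value at which the Orlicz norm is tested.\<close>

definition torus_shift :: "nat \<Rightarrow> ('d \<Rightarrow> nat) \<Rightarrow> ('d \<Rightarrow> nat) \<Rightarrow> 'd \<Rightarrow> nat" where
  "torus_shift N z x = (\<lambda>i. (x i + z i) mod N)"

lemma torus_eq_PiE: "torus N = (\<Pi>\<^sub>E i\<in>UNIV. {..<N})"
  by (auto simp: torus_def)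

lemma finite_torus [simp]: "finite (torus N)"
  by (simp add: torus_eq_PiE finite_PiE)

lemma card_torus [simp]: "card (torus N :: ('d::finite \<Rightarrow> nat) set) = N ^ CARD('d)"
  by (simp add: torus_eq_PiE card_PiE)

lemma mod_add_right_inj:
  fixes x y z N :: nat
  assumes "x < N" "y < N" "(x + z) mod N = (y + z) mod N"
  shows "x = y"
proof -
  have "int N dvd int x - int y"
    using assms(3) by (metis add_diff_cancel_right mod_eq_dvd_iff of_nat_add zmod_int)
  then show ?thesis
    using assms(1,2) zdvd_imp_le[of "int N" "int x - int y"] zdvd_imp_le[of "int N" "int y - int x"]
    by (cases x y rule: linorder_cases) (auto simp: dvd_diff_commute)
qed

lemma shift_in_torus [simp]: "0 < N \<Longrightarrow> torus_shift N z x \<in> torus N"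
  by (simp add: torus_def torus_shift_def)

lemma bij_betw_shift:
  fixes z :: "'d::finite \<Rightarrow> nat"
  assumes "0 < N"
  shows "bij_betw (torus_shift N z) (torus N) (torus N)"
proof -
  have "inj_on (torus_shift N z) (torus N)"
  proof (rule inj_onI, rule ext)
    fix x y i assume "x \<in> torus N" "y \<in> torus N" "torus_shift N z x = torus_shift N z y"
    then show "x i = y i"
      using mod_add_right_inj[of "x i" N "y i" "z i"] by (simp add: torus_def torus_shift_def fun_eq_iff)
  qed
  moreover have "torus_shift N z ` torus N \<subseteq> torus N"
    using assms by auto
  ultimately show ?thesis
    by (simp add: bij_betw_def endo_inj_surj)
qed

text \<open>A box of side at most \<open>N\<close> does not wrap around onto itself, so the sites
  seen from \<open>x\<close> through the box are distinct. For a nonnegative function the mass in a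
  box is then at most the total mass.\<close>

lemma inj_on_shift_left:
  fixes x :: "'d::finite \<Rightarrow> nat"
  assumes "n \<le> N"
  shows "inj_on (\<lambda>z. torus_shift N z x) (torus n)"
proof (rule inj_onI, rule ext)
  fix y z i assume "y \<in> torus n" "z \<in> torus n" "torus_shift N y x = torus_shift N z x"
  then show "y i = z i"
    using mod_add_right_inj[of "y i" N "z i" "x i"] assms
    by (auto simp: torus_def torus_shift_def fun_eq_iff add.commute intro: less_le_trans)
qed

lemma next_site_eq_shift:
  assumes "x \<in> torus N"
  shows "next_site N i x = torus_shift N (\<lambda>k. of_bool (k = i)) x"
  using assms by (auto simp: next_site_def torus_shift_def torus_def)

lemma bij_betw_next_site:
  fixes i :: "'d::finite"
  assumes "0 < N"
  shows "bij_betw (next_site N i) (torus N) (torus N)"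
  using bij_betw_shift[OF assms] by (subst bij_betw_cong[OF next_site_eq_shift]) auto

lemma next_site_in_torus [simp]: "x \<in> torus N \<Longrightarrow> next_site N i x \<in> torus N"
  by (auto simp: torus_def next_site_def) (metis mod_less_divisor gr_zeroI not_less_zero)

lemma prev_site_in_torus [simp]: "x \<in> torus N \<Longrightarrow> prev_site N i x \<in> torus N"
  by (auto simp: torus_def prev_site_def) (metis mod_less_divisor gr_zeroI not_less_zero)

lemma prev_next_site [simp]:
  assumes "x \<in> torus N"
  shows "prev_site N i (next_site N i x) = x"
proof -
  have "x i < N" using assms by (simp add: torus_def)
  then have "((x i + 1) mod N + N - 1) mod N = x i"
    by (cases "x i + 1 = N") auto
  then show ?thesis
    by (auto simp: prev_site_def next_site_def)
qed

section \<open>Energy of a torus function and its oscillation over boxes\<close>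

definition torus_energy :: "nat \<Rightarrow> (('d::finite \<Rightarrow> nat) \<Rightarrow> real) \<Rightarrow> real" where
  "torus_energy N v = (\<Sum>x\<in>torus N. \<Sum>i\<in>UNIV. (v (next_site N i x) - v x)\<^sup>2)"

lemma torus_energy_nonneg: "0 \<le> torus_energy N v"
  by (simp add: torus_energy_def sum_nonneg)

text \<open>This is the moving particle estimate: \<open>x\<close> and its shift are joined by
  \<open>l\<close> unit steps, the increments along the path are added by Minkowski's inequality,
  and translation invariance lets every step be measured by the same energy. The induction peels off
  one unit step in a direction with \<open>0 < z i\<close>.\<close>

lemma L2_shift_le:
  fixes v :: "('d::finite \<Rightarrow> nat) \<Rightarrow> real"
  assumes "0 < N" "(\<Sum>i\<in>UNIV. z i) = l"
  shows "L2_set (\<lambda>x. v (torus_shift N z x) - v x) (torus N) \<le> real l * sqrt (torus_energy N v)"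
  using assms(2)
proof (induction l arbitrary: z)
  case 0
  then have "z = (\<lambda>_. 0)" by auto
  then have "torus_shift N z x = x" if "x \<in> torus N" for x
    using that by (auto simp: torus_shift_def torus_def)
  then have "L2_set (\<lambda>x. v (torus_shift N z x) - v x) (torus N) = L2_set (\<lambda>x. 0) (torus N)"
    unfolding L2_set_def by (intro arg_cong[where f = sqrt] sum.cong) auto
  then show ?case by (simp add: L2_set_def)
next
  case (Suc l)
  then have "\<exists>i. 0 < z i"
    by (metis gr_zeroI nat.distinct(1) sum.neutral)
  then obtain i where i: "0 < z i" by blast
  define z' where "z' = z(i := z i - 1)"
  have sum_z: "(\<Sum>k\<in>UNIV. z k) = z i + (\<Sum>k\<in>UNIV - {i}. z k)" for z :: "'d \<Rightarrow> nat"
    by (simp add: sum.remove[of UNIV i])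
  have "(\<Sum>k\<in>UNIV. z' k) = l"
    using Suc.prems i unfolding sum_z[of z] sum_z[of z'] by (simp add: z'_def)
  note IH = Suc.IH[OF this]
  have step: "torus_shift N z x = next_site N i (torus_shift N z' x)" for x
    using i by (auto simp: torus_shift_def next_site_def z'_def fun_eq_iff mod_simps)
  have "L2_set (\<lambda>x. v (torus_shift N z x) - v x) (torus N)
      = L2_set (\<lambda>x. (v (next_site N i (torus_shift N z' x)) - v (torus_shift N z' x)) + (v (torus_shift N z' x) - v x)) (torus N)"
    by (simp add: step)
  also have "\<dots> \<le> L2_set (\<lambda>x. v (next_site N i (torus_shift N z' x)) - v (torus_shift N z' x)) (torus N)
      + L2_set (\<lambda>x. v (torus_shift N z' x) - v x) (torus N)"
    by (rule L2_set_triangle_ineq)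
  also have "L2_set (\<lambda>x. v (next_site N i (torus_shift N z' x)) - v (torus_shift N z' x)) (torus N)
      = L2_set (\<lambda>x. v (next_site N i x) - v x) (torus N)"
    unfolding L2_set_def
    by (subst sum.reindex_bij_betw[OF bij_betw_shift[OF assms(1), of z'], symmetric]) simp
  also have "\<dots> \<le> sqrt (torus_energy N v)"
    unfolding L2_set_def torus_energy_def
    by (intro real_sqrt_le_mono sum_mono member_le_sum) auto
  finally show ?case using IH by (simp add: algebra_simps)
qed

text \<open>\<open>mean_osc N n v\<close> is the squared \<open>\<ell>\<^sup>2\<close>-modulus of continuity of \<open>v\<close>, averaged over the shifts in a box of side
  \<open>n\<close>; the sum over sites is not normalised.\<close>

definition mean_osc :: "nat \<Rightarrow> nat \<Rightarrow> (('d::finite \<Rightarrow> nat) \<Rightarrow> real) \<Rightarrow> real" where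
  "mean_osc N n v =
     (\<Sum>z\<in>torus n. \<Sum>x\<in>torus N. (v (torus_shift N z x) - v x)\<^sup>2) / real n ^ CARD('d)"

lemma mean_osc_nonneg: "0 \<le> mean_osc N n v"
  by (simp add: mean_osc_def sum_nonneg)

text \<open>A shift in a box of side \<open>n\<close> takes at most \<open>CARD('d) * n\<close> unit
  steps; the square of this number bounds the cost of each shift, hence of their average.\<close>

lemma mean_osc_le_energy:
  fixes v :: "('d::finite \<Rightarrow> nat) \<Rightarrow> real"
  assumes "0 < n" "n \<le> N"
  shows "mean_osc N n v \<le> (real CARD('d) * real n)\<^sup>2 * torus_energy N v"
proof -
  have "(\<Sum>x\<in>torus N. (v (torus_shift N z x) - v x)\<^sup>2) \<le> (real CARD('d) * real n)\<^sup>2 * torus_energy N v"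
    if z: "z \<in> torus n" for z
  proof -
    have l: "(\<Sum>i\<in>UNIV. z i) \<le> CARD('d) * n"
      using z sum_bounded_above[of UNIV z n] by (auto simp: torus_def less_imp_le)
    have "L2_set (\<lambda>x. v (torus_shift N z x) - v x) (torus N) \<le> real (\<Sum>i\<in>UNIV. z i) * sqrt (torus_energy N v)"
      using assms by (intro L2_shift_le) auto
    also have "\<dots> \<le> (real CARD('d) * real n) * sqrt (torus_energy N v)"
      by (intro mult_right_mono) (use l in \<open>simp_all add: torus_energy_nonneg flip: of_nat_mult of_nat_sum\<close>)
    finally have "(L2_set (\<lambda>x. v (torus_shift N z x) - v x) (torus N))\<^sup>2
        \<le> ((real CARD('d) * real n) * sqrt (torus_energy N v))\<^sup>2"
      by (intro power_mono) (auto simp: L2_set_nonneg)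
    then show ?thesis
      by (simp add: L2_set_def power_mult_distrib torus_energy_nonneg sum_nonneg)
  qed
  then have "(\<Sum>z\<in>torus n. \<Sum>x\<in>torus N. (v (torus_shift N z x) - v x)\<^sup>2)
      \<le> of_nat (card (torus n :: ('d \<Rightarrow> nat) set)) * ((real CARD('d) * real n)\<^sup>2 * torus_energy N v)"
    by (intro sum_bounded_above) auto
  then show ?thesis
    using assms by (simp add: mean_osc_def divide_simps mult_ac)
qed

text \<open>A box of side \<open>N div 2 ^ j\<close> carries at most the total mass, so \<open>g\<close> is moderate on half of it. Where \<open>g\<close> is
  much larger, its oscillation over the box is therefore comparable to \<open>g\<close> itself.\<close>

lemma block_tail_le_mean_osc:
  fixes g :: "('d::finite \<Rightarrow> nat) \<Rightarrow> real"
  assumes N: "2 ^ j \<le> N" and \<alpha>: "0 < \<alpha>" and b: "0 < b"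
    and g: "\<And>x. x \<in> torus N \<Longrightarrow> 0 \<le> g x"
    and mass: "(\<Sum>x\<in>torus N. g x) \<le> b * real N ^ CARD('d)"
  shows "(\<Sum>x\<in>torus N. if 4 * (2 * b * (2 ^ (j + 1)) ^ CARD('d)) powr \<alpha> < g x powr \<alpha> then g x powr \<alpha> else 0)
     \<le> 8 * mean_osc N (N div 2 ^ j) (\<lambda>x. g x powr (\<alpha> / 2))"
proof -
  define n where "n = N div 2 ^ j"
  \<comment> \<open>Rounding in \<open>N div 2 ^ j\<close> loses at most a factor 2, hence the
    exponent \<open>j + 1\<close>: the density \<open>m\<close> over the box still accounts for the
    whole mass allowed on the torus.\<close>
  define m where "m = b * (2 ^ (j + 1)) ^ CARD('d)"
  define h where "h = (\<lambda>x. g x powr (\<alpha> / 2))"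
  have m: "0 < m" using b by (simp add: m_def)
  have n: "0 < n" "n \<le> N"
    using N by (auto simp: n_def div_greater_zero_iff)
  have "N < (n + 1) * 2 ^ j"
    unfolding n_def using dividend_less_div_times[of "2 ^ j" N] by simp
  also have "\<dots> \<le> 2 * n * 2 ^ j" using n by (intro mult_right_mono) auto
  finally have "N \<le> 2 ^ (j + 1) * n" by (simp add: mult_ac)
  then have "real N \<le> real (2 ^ (j + 1) * n)"
    by (rule of_nat_mono)
  then have "real N \<le> 2 ^ (j + 1) * real n"
    by simp
  then have "real N ^ CARD('d) \<le> (2 ^ (j + 1) * real n) ^ CARD('d)"
    by (intro power_mono) auto
  then have Nn: "b * real N ^ CARD('d) \<le> m * real n ^ CARD('d)"
    using b by (simp add: m_def power_mult_distrib mult.assoc)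
  have local_bound: "(if 4 * (2 * m) powr \<alpha> < g x powr \<alpha> then g x powr \<alpha> else 0)
      \<le> 8 * ((\<Sum>z\<in>torus n. (h (torus_shift N z x) - h x)\<^sup>2) / real n ^ CARD('d))"
    if x: "x \<in> torus N" for x
  proof (cases "4 * (2 * m) powr \<alpha> < g x powr \<alpha>")
    case False
    then show ?thesis by (simp add: sum_nonneg)
  next
    case True
    have hx: "h x ^ 2 = g x powr \<alpha>"
      by (simp add: h_def power2_eq_square flip: powr_add)
    define B where "B = {z \<in> torus n. 2 * m < g (torus_shift N z x)}"
    \<comment> \<open>Markov's inequality: \<open>g\<close> exceeds \<open>2 * m\<close> on at most
      half of the box.\<close>
    have "real (card B) * (2 * m) \<le> (\<Sum>z\<in>B. g (torus_shift N z x))"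
      by (intro sum_bounded_below) (auto simp: B_def)
    also have "\<dots> \<le> (\<Sum>z\<in>torus n. g (torus_shift N z x))"
      using n g by (intro sum_mono2) (auto simp: B_def)
    also have "\<dots> = (\<Sum>y\<in>(\<lambda>z. torus_shift N z x) ` torus n. g y)"
      using inj_on_shift_left[OF n(2)] by (subst sum.reindex) auto
    also have "\<dots> \<le> (\<Sum>y\<in>torus N. g y)"
      using n g by (intro sum_mono2) auto
    also have "\<dots> \<le> m * real n ^ CARD('d)" using mass Nn by linarith
    finally have "m * (2 * real (card B)) \<le> m * real n ^ CARD('d)" by (simp add: mult_ac)
    then have cB: "2 * real (card B) \<le> real n ^ CARD('d)"
      using m by (rule mult_left_le_imp_le)
    have cG: "real (card (torus n - B)) = real n ^ CARD('d) - real (card B)"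
      using card_mono[of "torus n" B] by (subst card_Diff_subset) (auto simp: B_def of_nat_diff)
    \<comment> \<open>The factor 4 in the threshold becomes 2 for the square root \<open>h\<close>,
      so \<open>h\<close> at least halves on the good half of the box. Half of the sites times a
      quarter of the square gives the constant 8.\<close>
    have osc: "(h x)\<^sup>2 / 4 \<le> (h (torus_shift N z x) - h x)\<^sup>2" if z: "z \<in> torus n - B" for z
    proof -
      have "g (torus_shift N z x) powr \<alpha> \<le> (2 * m) powr \<alpha>"
        using z n g \<alpha> by (intro powr_mono2) (auto simp: B_def)
      then have "(h (torus_shift N z x))\<^sup>2 \<le> (h x / 2)\<^sup>2"
        using True hx by (simp add: h_def power2_eq_square flip: powr_add)
      then have "h (torus_shift N z x) \<le> h x / 2"
        by (rule power2_le_imp_le) (simp add: h_def)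
      then have "(h x / 2)\<^sup>2 \<le> (h x - h (torus_shift N z x))\<^sup>2"
        by (intro power_mono) (auto simp: h_def)
      then show ?thesis by (simp add: power2_commute power_divide)
    qed
    have "real n ^ CARD('d) / 2 * ((h x)\<^sup>2 / 4) \<le> real (card (torus n - B)) * ((h x)\<^sup>2 / 4)"
      using cB cG by (intro mult_right_mono) auto
    also have "\<dots> \<le> (\<Sum>z\<in>torus n - B. (h (torus_shift N z x) - h x)\<^sup>2)"
      using osc by (intro sum_bounded_below) auto
    also have "\<dots> \<le> (\<Sum>z\<in>torus n. (h (torus_shift N z x) - h x)\<^sup>2)"
      by (intro sum_mono2) auto
    finally have "(h x)\<^sup>2 \<le> 8 * ((\<Sum>z\<in>torus n. (h (torus_shift N z x) - h x)\<^sup>2) / real n ^ CARD('d))"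
      using n by (simp add: field_simps)
    then show ?thesis using True hx by simp
  qed
  have "(\<Sum>x\<in>torus N. if 4 * (2 * m) powr \<alpha> < g x powr \<alpha> then g x powr \<alpha> else 0)
      \<le> (\<Sum>x\<in>torus N. 8 * ((\<Sum>z\<in>torus n. (h (torus_shift N z x) - h x)\<^sup>2) / real n ^ CARD('d)))"
    by (rule sum_mono) (rule local_bound)
  also have "\<dots> = 8 * mean_osc N n h"
    unfolding mean_osc_def by (subst sum.swap) (simp add: sum_distrib_left sum_divide_distrib)
  finally show ?thesis by (simp add: m_def n_def h_def mult.assoc)
qed

text \<open>If \<open>c\<close> is small against \<open>s\<close>, the increment is small relative
  to the power; otherwise \<open>s + c\<close> itself is of order \<open>c\<close> and its power is
  below \<epsilon>. Allowing both kinds of error makes the bound uniform in \<open>s\<close> for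
  every positive exponent.\<close>

lemma powr_increment_small:
  fixes p \<epsilon> :: real
  assumes p: "0 < p" and \<epsilon>: "0 < \<epsilon>"
  obtains c0 where "0 < c0"
    "\<And>c s. 0 < c \<Longrightarrow> c \<le> c0 \<Longrightarrow> 0 \<le> s \<Longrightarrow> (s + c) powr p \<le> s powr p + \<epsilon> * (1 + s powr p)"
proof -
  define \<delta> where "\<delta> = (1 + \<epsilon>) powr (1 / p) - 1"
  have "1 < (1 + \<epsilon>) powr (1 / p)" using assms by (intro gr_one_powr) auto
  then have \<delta>: "0 < \<delta>" by (simp add: \<delta>_def)
  have \<delta>p: "(1 + \<delta>) powr p = 1 + \<epsilon>" using assms by (simp add: \<delta>_def powr_powr)
  define c0 where "c0 = \<epsilon> powr (1 / p) / (1 + 1 / \<delta>)"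
  have c0: "0 < c0" using \<delta> \<epsilon> by (simp add: c0_def add_pos_pos)
  show ?thesis
  proof (rule that[OF c0])
    fix c s :: real assume c: "0 < c" "c \<le> c0" and s: "0 \<le> s"
    show "(s + c) powr p \<le> s powr p + \<epsilon> * (1 + s powr p)"
    proof (cases "c \<le> \<delta> * s")
      case True
      then have "(s + c) powr p \<le> ((1 + \<delta>) * s) powr p"
        using c s p by (intro powr_mono2) (auto simp: algebra_simps)
      also have "\<dots> = (1 + \<epsilon>) * s powr p" using s \<delta> by (simp add: powr_mult \<delta>p)
      finally show ?thesis using \<epsilon> by (simp add: algebra_simps)
    next
      case False
      then have "s + c \<le> c * (1 + 1 / \<delta>)" using \<delta> by (simp add: field_simps)
      also have "\<dots> \<le> c0 * (1 + 1 / \<delta>)" using c \<delta> by (intro mult_right_mono) (auto simp: add_nonneg_nonneg)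
      also have "\<dots> = \<epsilon> powr (1 / p)"
      proof -
        have "1 + 1 / \<delta> \<noteq> 0" using \<delta> by (metis add_pos_pos less_irrefl zero_less_divide_1_iff zero_less_one)
        then show ?thesis by (simp add: c0_def)
      qed
      finally have "(s + c) powr p \<le> (\<epsilon> powr (1 / p)) powr p"
        using c s p by (intro powr_mono2) auto
      also have "\<dots> = \<epsilon>" using p \<epsilon> by (simp add: powr_powr)
      finally have "(s + c) powr p \<le> \<epsilon>" .
      moreover have "0 \<le> s powr p + \<epsilon> * s powr p" using \<epsilon> by simp
      ultimately show ?thesis by (simp add: distrib_left)
    qed
  qed
qed

section \<open>Young functions with prescribed kinks\<close>

text \<open>The slope at \<open>u\<close> is the number of kinks below \<open>\<bar>u\<bar>\<close>.
  Kinks tending to infinity therefore give a finite and superlinear function however sparse they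
  are, and averages of it reduce to sums of tails, one for each kink.\<close>

definition hinge_young :: "(nat \<Rightarrow> real) \<Rightarrow> real \<Rightarrow> ennreal" where
  "hinge_young \<theta> u = (\<Sum>j. ennreal (max 0 (\<bar>u\<bar> - \<theta> j)))"

lemma hinge_young_eq_sum:
  assumes "\<And>j. j \<ge> m \<Longrightarrow> \<bar>u\<bar> \<le> \<theta> j"
  shows "hinge_young \<theta> u = (\<Sum>j<m. ennreal (max 0 (\<bar>u\<bar> - \<theta> j)))"
  unfolding hinge_young_def using assms by (intro suminf_finite) (auto simp: max_def ennreal_eq_0_iff)

lemma strict_young_function_hinge_young:
  assumes pos: "\<And>j. 0 \<le> \<theta> j" and lim: "filterlim \<theta> at_top sequentially"
  shows "strict_young_function (hinge_young \<theta>)"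
proof -
  have large: "\<exists>m. \<forall>j\<ge>m. R \<le> \<theta> j" for R
    using lim by (auto simp: filterlim_at_top eventually_sequentially)
  have fin: "hinge_young \<theta> u < \<infinity>" for u
  proof -
    obtain m where "\<forall>j\<ge>m. \<bar>u\<bar> \<le> \<theta> j" using large by blast
    then show ?thesis by (subst hinge_young_eq_sum[of m]) auto
  qed
  have convex: "hinge_young \<theta> (s * x + (1 - s) * y)
      \<le> ennreal s * hinge_young \<theta> x + ennreal (1 - s) * hinge_young \<theta> y" if s: "s \<in> {0..1}" for x y s
  proof -
    have "ennreal (max 0 (\<bar>s * x + (1 - s) * y\<bar> - t))
        \<le> ennreal s * ennreal (max 0 (\<bar>x\<bar> - t)) + ennreal (1 - s) * ennreal (max 0 (\<bar>y\<bar> - t))" for t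
    proof -
      have "\<bar>s * x + (1 - s) * y\<bar> \<le> s * \<bar>x\<bar> + (1 - s) * \<bar>y\<bar>"
        using s abs_triangle_ineq[of "s * x" "(1 - s) * y"] by (simp add: abs_mult)
      also have "\<dots> = s * (\<bar>x\<bar> - t) + (1 - s) * (\<bar>y\<bar> - t) + t" by (simp add: algebra_simps)
      also have "\<dots> \<le> s * max 0 (\<bar>x\<bar> - t) + (1 - s) * max 0 (\<bar>y\<bar> - t) + t"
        using s by (intro add_mono mult_left_mono) auto
      finally have "max 0 (\<bar>s * x + (1 - s) * y\<bar> - t) \<le> s * max 0 (\<bar>x\<bar> - t) + (1 - s) * max 0 (\<bar>y\<bar> - t)"
        using s by auto
      then show ?thesis
        using s by (subst (1 2) ennreal_mult[symmetric], auto simp: ennreal_leI simp del: max_def simp flip: ennreal_plus)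
    qed
    then have "hinge_young \<theta> (s * x + (1 - s) * y)
        \<le> (\<Sum>j. ennreal s * ennreal (max 0 (\<bar>x\<bar> - \<theta> j)) + ennreal (1 - s) * ennreal (max 0 (\<bar>y\<bar> - \<theta> j)))"
      unfolding hinge_young_def by (intro suminf_le) auto
    also have "\<dots> = ennreal s * hinge_young \<theta> x + ennreal (1 - s) * hinge_young \<theta> y"
      unfolding hinge_young_def by (simp add: suminf_add[symmetric])
    finally show ?thesis .
  qed
  have lsc: "hinge_young \<theta> u \<le> Liminf (at u) (hinge_young \<theta>)" for u
  proof -
    \<comment> \<open>The margin 1 lets one finite sum represent the series on the whole unit ball
      around \<open>u\<close>, where that sum is continuous.\<close>
    obtain m where m: "\<forall>j\<ge>m. \<bar>u\<bar> + 1 \<le> \<theta> j" using large by blast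
    have "((\<lambda>v. \<Sum>j<m. ennreal (max 0 (\<bar>v\<bar> - \<theta> j))) \<longlongrightarrow> (\<Sum>j<m. ennreal (max 0 (\<bar>u\<bar> - \<theta> j)))) (at u)"
      by (intro tendsto_sum tendsto_ennrealI tendsto_intros)
    moreover have "eventually (\<lambda>v. (\<Sum>j<m. ennreal (max 0 (\<bar>v\<bar> - \<theta> j))) = hinge_young \<theta> v) (at u)"
      unfolding eventually_at
    proof (intro exI[of _ 1] conjI ballI impI)
      fix v assume v: "v \<noteq> u \<and> dist v u < 1"
      have "\<bar>v\<bar> \<le> \<theta> j" if "j \<ge> m" for j
        using m that v by (auto simp: dist_real_def dest!: spec[of _ j])
      then show "(\<Sum>j<m. ennreal (max 0 (\<bar>v\<bar> - \<theta> j))) = hinge_young \<theta> v"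
        by (rule hinge_young_eq_sum[symmetric])
    qed auto
    moreover have "hinge_young \<theta> u = (\<Sum>j<m. ennreal (max 0 (\<bar>u\<bar> - \<theta> j)))"
      using m by (intro hinge_young_eq_sum) (auto dest!: spec)
    ultimately have "(hinge_young \<theta> \<longlongrightarrow> hinge_young \<theta> u) (at u)"
      by (simp add: tendsto_cong)
    then show ?thesis by (simp add: lim_imp_Liminf)
  qed
  have lower: "\<exists>R>0. \<forall>u\<ge>R. ennreal (real m * (u / 2)) \<le> hinge_young \<theta> u" for m
  proof (intro exI conjI allI impI)
    \<comment> \<open>All of the first \<open>m\<close> kinks lie below \<open>?R / 2\<close>, so
      each of these hinges is at least \<open>u / 2\<close>.\<close>
    let ?R = "1 + 2 * (\<Sum>j<m. \<theta> j)"
    show "0 < ?R" using pos by (simp add: add_pos_nonneg sum_nonneg)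
    fix u assume u: "?R \<le> u"
    have "u / 2 \<le> max 0 (\<bar>u\<bar> - \<theta> j)" if "j < m" for j
      using member_le_sum[of j "{..<m}" \<theta>] that pos[of j] pos u by auto
    then have "real m * (u / 2) \<le> (\<Sum>j<m. max 0 (\<bar>u\<bar> - \<theta> j))"
      using sum_bounded_below[of "{..<m}" "u / 2"] by simp
    then have "ennreal (real m * (u / 2)) \<le> (\<Sum>j<m. ennreal (max 0 (\<bar>u\<bar> - \<theta> j)))"
      by (subst sum_ennreal) (auto intro: ennreal_leI)
    also have "\<dots> \<le> hinge_young \<theta> u"
      unfolding hinge_young_def by (rule sum_le_suminf) auto
    finally show "ennreal (real m * (u / 2)) \<le> hinge_young \<theta> u" .
  qed
  have nonzero: "hinge_young \<theta> \<noteq> (\<lambda>_. 0)"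
  proof
    assume zero: "hinge_young \<theta> = (\<lambda>_. 0)"
    obtain R where "R > 0" "ennreal (real 1 * (R / 2)) \<le> hinge_young \<theta> R"
      using lower[of 1] by blast
    then show False by (simp add: zero)
  qed
  have not_dual: "(\<lambda>u. enn2ereal (hinge_young \<theta> u)) \<noteq> convex_dual (\<lambda>_. 0)"
  proof
    assume "(\<lambda>u. enn2ereal (hinge_young \<theta> u)) = convex_dual (\<lambda>_. 0)"
    then have "enn2ereal (hinge_young \<theta> 1) = (SUP u. ereal u)"
      by (simp add: convex_dual_def fun_eq_iff)
    also have "\<dots> = \<infinity>"
      by (rule SUP_eqI) (auto, metis ereal_less_eq(1) ereal_top less_eq_ereal_def order_refl)
    finally show False using fin[of 1] by (metis enn2ereal_eq_top_iff infinity_ennreal_def less_irrefl top_ereal_def)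
  qed
  have superlinear: "((\<lambda>u. hinge_young \<theta> u / ennreal u) \<longlongrightarrow> \<infinity>) at_top"
    unfolding infinity_ennreal_def tendsto_top_iff_ennreal
  proof (intro allI impI)
    fix l :: real
    obtain m :: nat where m: "2 * (\<bar>l\<bar> + 1) < real m" using reals_Archimedean2 by blast
    obtain R where R: "R > 0" "\<forall>u\<ge>R. ennreal (real m * (u / 2)) \<le> hinge_young \<theta> u"
      using lower[of m] by blast
    show "eventually (\<lambda>u. ennreal l < hinge_young \<theta> u / ennreal u) at_top"
      using eventually_ge_at_top[of R]
    proof eventually_elim
      fix u assume u: "R \<le> u"
      have "ennreal l < ennreal (real m / 2)" using m by (intro ennreal_lessI) auto
      also have "\<dots> = ennreal (real m * (u / 2)) / ennreal u"
        using u R(1) by (subst divide_ennreal) auto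
      also have "\<dots> \<le> hinge_young \<theta> u / ennreal u"
        using R(2) u by (intro divide_right_mono_ennreal) auto
      finally show "ennreal l < hinge_young \<theta> u / ennreal u" .
    qed
  qed
  have zero: "hinge_young \<theta> 0 = 0"
    using pos by (subst hinge_young_eq_sum[of 0]) auto
  have even: "hinge_young \<theta> (- u) = hinge_young \<theta> u" for u
    by (simp add: hinge_young_def)
  show ?thesis
    unfolding strict_young_function_def young_function_def
    using convex lsc fin nonzero not_dual superlinear zero even by blast
qed

section \<open>Feynman--Kac bound for finite invariant sets\<close>

text \<open>The hypothesis on \<open>G\<close> makes the probability of leaving \<open>A\<close>
  within time \<open>h\<close> of order o(h), uniformly over the starting point because
  \<open>A\<close> is finite. Cutting \<open>[0, t]\<close> into short steps and adding the escape
  probabilities bounds the total escape by \<open>t * \<epsilon>\<close> for every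
  \<epsilon>.\<close>

lemma kernel_stays_in_finite:
  assumes K: "transition_kernel S G K" and A: "finite A" "A \<subseteq> S"
    and inv: "\<And>x. x \<in> A \<Longrightarrow> G (indicator A) x = 0" and t: "0 \<le> t" and x: "x \<in> A"
  shows "set_pmf (K t x) \<subseteq> A"
proof (cases "t = 0")
  case True
  then show ?thesis using K A x by (auto simp: transition_kernel_def)
next
  case False
  with t have t: "0 < t" by simp
  have small: "emeasure (K t x) (- A) \<le> ennreal (t * \<epsilon>)" if \<epsilon>: "0 < \<epsilon>" for \<epsilon>
  proof -
    have "eventually (\<lambda>h. \<forall>y\<in>A. emeasure (K h y) (- A) \<le> ennreal (h * \<epsilon>)) (at_right 0)"
    proof (intro eventually_ball_finite A(1) ballI)
      fix y assume y: "y \<in> A"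
      have "bdd_fun_on S (indicator A)"
        unfolding bdd_fun_on_def by (intro exI[of _ 1]) (auto simp: indicator_def)
      then have "((\<lambda>h. (measure_pmf.prob (K h y) A - 1) / h) \<longlongrightarrow> 0) (at_right 0)"
        using K y A(2) inv[OF y] unfolding transition_kernel_def
        by (fastforce simp: subset_iff)
      then have "eventually (\<lambda>h. - \<epsilon> < (measure_pmf.prob (K h y) A - 1) / h) (at_right 0)"
        using \<epsilon> by (intro order_tendstoD) auto
      then show "eventually (\<lambda>h. emeasure (K h y) (- A) \<le> ennreal (h * \<epsilon>)) (at_right 0)"
        using eventually_at_right_less[of 0]
      proof eventually_elim
        fix h :: real assume h: "- \<epsilon> < (measure_pmf.prob (K h y) A - 1) / h" "0 < h"
        have "measure_pmf.prob (K h y) (- A) = 1 - measure_pmf.prob (K h y) A"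
          using measure_pmf.prob_compl[of A "K h y"] by (simp add: Compl_eq_Diff_UNIV)
        also have "\<dots> \<le> h * \<epsilon>" using h by (simp add: field_simps)
        finally show "emeasure (K h y) (- A) \<le> ennreal (h * \<epsilon>)"
          by (simp add: measure_pmf.emeasure_eq_measure ennreal_leI)
      qed
    qed
    then obtain b where b: "b > 0" "\<And>h y. 0 < h \<Longrightarrow> h < b \<Longrightarrow> y \<in> A \<Longrightarrow> emeasure (K h y) (- A) \<le> ennreal (h * \<epsilon>)"
      unfolding eventually_at_right by (auto simp: eventually_at_right_field)
    obtain n :: nat where n: "t / b < real n" using reals_Archimedean2 by blast
    define h where "h = t / real n"
    have "0 < t / b" using t b by simp
    with n have n0: "0 < real n" by linarith
    then have h: "0 < h" "h < b" "t = real n * h"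
      using n t b by (auto simp: h_def field_simps)
    have "emeasure (K (real m * h) x) (- A) \<le> ennreal (real m * h * \<epsilon>)" for m :: nat
    proof (induction m)
      case 0
      then show ?case using K x A(2) by (auto simp: transition_kernel_def emeasure_return_pmf indicator_def subset_iff)
    next
      case (Suc m)
      have "real (Suc m) * h = real m * h + h" "0 \<le> real m * h" "0 \<le> h" "x \<in> S"
        using h(1) x A(2) by (auto simp: algebra_simps)
      then have "K (real (Suc m) * h) x = bind_pmf (K (real m * h) x) (K h)"
        using K unfolding transition_kernel_def by simp
      then have "emeasure (K (real (Suc m) * h) x) (- A)
          = (\<integral>\<^sup>+ y. emeasure (K h y) (- A) \<partial>K (real m * h) x)" by simp
      \<comment> \<open>A step that starts outside \<open>A\<close> is bounded by 1, which charges
        it to the escape that has already happened; a step that starts in \<open>A\<close> adds at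
        most \<open>h * \<epsilon>\<close>.\<close>
      also have "\<dots> \<le> (\<integral>\<^sup>+ y. indicator (- A) y + ennreal (h * \<epsilon>) \<partial>K (real m * h) x)"
      proof (rule nn_integral_mono)
        fix y show "emeasure (K h y) (- A) \<le> indicator (- A) y + ennreal (h * \<epsilon>)"
          using b(2)[OF h(1,2), of y] measure_pmf.emeasure_le_1[of "K h y" "- A"]
          by (cases "y \<in> A") (auto intro: add_increasing2)
      qed
      also have "\<dots> = emeasure (K (real m * h) x) (- A) + ennreal (h * \<epsilon>)"
        by (subst nn_integral_add) auto
      also have "\<dots> \<le> ennreal (real m * h * \<epsilon>) + ennreal (h * \<epsilon>)"
        using Suc.IH by (rule add_right_mono)
      also have "\<dots> = ennreal (real (Suc m) * h * \<epsilon>)"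
        using h \<epsilon> by (subst ennreal_plus[symmetric]) (auto simp: algebra_simps)
      finally show ?case .
    qed
    from this[of n] show ?thesis using h(3) by simp
  qed
  have "measure_pmf.prob (K t x) (- A) \<le> 0"
  proof (rule field_le_epsilon)
    fix e :: real assume e: "0 < e"
    show "measure_pmf.prob (K t x) (- A) \<le> 0 + e"
      using small[of "e / t"] e t by (simp add: measure_pmf.emeasure_eq_measure)
  qed
  then have "measure_pmf.prob (K t x) (- A) = 0"
    by (simp add: order_antisym)
  then show ?thesis by (auto simp: measure_pmf_zero_iff)
qed

text \<open>One step is the identity plus \<open>h\<close> times a matrix converging to
  \<open>m\<close>. Expanding the weighted norm gives \<open>1 + 2 * lam * h\<close> from
  \<open>form\<close> and remainders of order o(h). On a finite set entrywise convergence makes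
  these uniform in \<open>u\<close>, and the surplus \<open>2 * h\<close> in the conclusion absorbs
  them.\<close>

lemma eventually_finite_operator_bound:
  fixes B :: "real \<Rightarrow> 's \<Rightarrow> 's \<Rightarrow> real"
  assumes fin: "finite A" and w: "\<And>x. x \<in> A \<Longrightarrow> 0 < w x"
    and B: "\<And>x y. x \<in> A \<Longrightarrow> y \<in> A \<Longrightarrow> ((\<lambda>h. (B h x y - of_bool (x = y)) / h) \<longlongrightarrow> m x y) (at_right 0)"
    and form: "\<And>u. (\<Sum>x\<in>A. w x * u x * (\<Sum>y\<in>A. m x y * u y)) \<le> lam * (\<Sum>x\<in>A. w x * (u x)\<^sup>2)"
  shows "eventually (\<lambda>h. \<forall>u. (\<Sum>x\<in>A. w x * (\<Sum>y\<in>A. B h x y * u y)\<^sup>2)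
           \<le> (1 + 2 * (lam + 1) * h) * (\<Sum>x\<in>A. w x * (u x)\<^sup>2)) (at_right 0)"
proof -
  define \<beta> where "\<beta> = (\<lambda>h x y. (B h x y - of_bool (x = y)) / h)"
  \<comment> \<open>The first sum is the cost of replacing \<open>\<beta> h\<close> by
    \<open>m\<close> in the cross term, the second that of the term quadratic in \<open>h\<close>.
    Their limit is 0, and \<open>\<rho> h < 2\<close> is all that the surplus 1 in
    \<open>lam + 1\<close> asks for.\<close>
  define \<rho> where "\<rho> = (\<lambda>h. 2 * (\<Sum>x\<in>A. sqrt (w x) * (\<Sum>y\<in>A. \<bar>\<beta> h x y - m x y\<bar> / sqrt (w y)))
      + h * (\<Sum>x\<in>A. w x * (\<Sum>y\<in>A. \<bar>\<beta> h x y\<bar> / sqrt (w y))\<^sup>2))"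
  have \<beta>: "((\<lambda>h. \<beta> h x y) \<longlongrightarrow> m x y) (at_right 0)" if "x \<in> A" "y \<in> A" for x y
    unfolding \<beta>_def by (rule B[OF that])
  have w_nz: "sqrt (w x) \<noteq> 0" if "x \<in> A" for x using w[OF that] by simp
  have "(\<rho> \<longlongrightarrow> 2 * (\<Sum>x\<in>A. sqrt (w x) * (\<Sum>y\<in>A. \<bar>m x y - m x y\<bar> / sqrt (w y)))
      + 0 * (\<Sum>x\<in>A. w x * (\<Sum>y\<in>A. \<bar>m x y\<bar> / sqrt (w y))\<^sup>2)) (at_right 0)"
    unfolding \<rho>_def using w_nz
    by (intro tendsto_add tendsto_mult tendsto_const tendsto_sum tendsto_divide tendsto_rabs tendsto_diff
        tendsto_power tendsto_ident_at \<beta>) auto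
  then have "eventually (\<lambda>h. \<rho> h < 2) (at_right 0)"
    by (intro order_tendstoD) auto
  then show ?thesis
    using eventually_at_right_less[of 0]
  proof eventually_elim
    fix h :: real assume \<rho>: "\<rho> h < 2" and h: "0 < h"
    show "\<forall>u. (\<Sum>x\<in>A. w x * (\<Sum>y\<in>A. B h x y * u y)\<^sup>2) \<le> (1 + 2 * (lam + 1) * h) * (\<Sum>x\<in>A. w x * (u x)\<^sup>2)"
    proof
      fix u
      define U where "U = (\<Sum>x\<in>A. w x * (u x)\<^sup>2)"
      have U: "0 \<le> U" unfolding U_def using w by (intro sum_nonneg mult_nonneg_nonneg) (auto simp: less_imp_le)
      \<comment> \<open>A coordinate is controlled by the weighted norm, which turns bounds on
        single matrix entries into bounds linear in the norm of \<open>u\<close>.\<close>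
      have u_le: "\<bar>u y\<bar> \<le> sqrt U / sqrt (w y)" if y: "y \<in> A" for y
      proof -
        have "w y * (u y)\<^sup>2 \<le> U"
          unfolding U_def using y fin w by (intro member_le_sum mult_nonneg_nonneg) (auto simp: less_imp_le)
        then have "sqrt ((u y)\<^sup>2) \<le> sqrt (U / w y)"
          using w[OF y] by (intro real_sqrt_le_mono) (simp add: pos_le_divide_eq mult.commute)
        then show ?thesis by (simp add: real_sqrt_divide)
      qed
      have row: "\<bar>\<Sum>y\<in>A. c y * u y\<bar> \<le> sqrt U * (\<Sum>y\<in>A. \<bar>c y\<bar> / sqrt (w y))" for c
      proof -
        have "\<bar>\<Sum>y\<in>A. c y * u y\<bar> \<le> (\<Sum>y\<in>A. \<bar>c y * u y\<bar>)" by (rule sum_abs)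
        also have "\<dots> \<le> (\<Sum>y\<in>A. \<bar>c y\<bar> * (sqrt U / sqrt (w y)))"
          unfolding abs_mult by (intro sum_mono mult_left_mono u_le) auto
        finally show ?thesis by (simp add: sum_distrib_left mult_ac)
      qed
      have expand: "(\<Sum>y\<in>A. B h x y * u y) = u x + h * (\<Sum>y\<in>A. \<beta> h x y * u y)" if x: "x \<in> A" for x
      proof -
        have "B h x y * u y = (if x = y then u y else 0) + h * (\<beta> h x y * u y)" for y
          using h by (auto simp: \<beta>_def field_simps)
        then have "(\<Sum>y\<in>A. B h x y * u y) = (\<Sum>y\<in>A. if x = y then u y else 0) + h * (\<Sum>y\<in>A. \<beta> h x y * u y)"
          by (simp only: sum.distrib sum_distrib_left)
        then show ?thesis using x fin by simp
      qed
      have first: "(\<Sum>x\<in>A. w x * u x * (\<Sum>y\<in>A. \<beta> h x y * u y))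
          \<le> lam * U + U * (\<Sum>x\<in>A. sqrt (w x) * (\<Sum>y\<in>A. \<bar>\<beta> h x y - m x y\<bar> / sqrt (w y)))"
      proof -
        have "w x * u x * (\<Sum>y\<in>A. (\<beta> h x y - m x y) * u y)
            \<le> U * (sqrt (w x) * (\<Sum>y\<in>A. \<bar>\<beta> h x y - m x y\<bar> / sqrt (w y)))" if x: "x \<in> A" for x
        proof -
          have "w x * u x * (\<Sum>y\<in>A. (\<beta> h x y - m x y) * u y)
              \<le> w x * (\<bar>u x\<bar> * \<bar>\<Sum>y\<in>A. (\<beta> h x y - m x y) * u y\<bar>)"
            using w[OF x] unfolding mult.assoc abs_mult[symmetric] by (intro mult_left_mono abs_ge_self) simp
          also have "\<dots> \<le> w x * ((sqrt U / sqrt (w x)) * (sqrt U * (\<Sum>y\<in>A. \<bar>\<beta> h x y - m x y\<bar> / sqrt (w y))))"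
            using w[OF x] U by (intro mult_left_mono mult_mono u_le x row) auto
          also have "\<dots> = U * (sqrt (w x) * (\<Sum>y\<in>A. \<bar>\<beta> h x y - m x y\<bar> / sqrt (w y)))"
            using w[OF x] U by (simp add: field_simps)
          finally show ?thesis .
        qed
        then have "(\<Sum>x\<in>A. w x * u x * (\<Sum>y\<in>A. (\<beta> h x y - m x y) * u y))
            \<le> U * (\<Sum>x\<in>A. sqrt (w x) * (\<Sum>y\<in>A. \<bar>\<beta> h x y - m x y\<bar> / sqrt (w y)))"
          unfolding sum_distrib_left[of U] by (rule sum_mono)
        with form[of u] show ?thesis
          by (simp add: left_diff_distrib right_diff_distrib sum_subtractf U_def)
      qed
      have second: "(\<Sum>x\<in>A. w x * (\<Sum>y\<in>A. \<beta> h x y * u y)\<^sup>2)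
          \<le> U * (\<Sum>x\<in>A. w x * (\<Sum>y\<in>A. \<bar>\<beta> h x y\<bar> / sqrt (w y))\<^sup>2)"
        unfolding sum_distrib_left[of U]
      proof (rule sum_mono)
        fix x assume x: "x \<in> A"
        have "(\<Sum>y\<in>A. \<beta> h x y * u y)\<^sup>2 \<le> (sqrt U * (\<Sum>y\<in>A. \<bar>\<beta> h x y\<bar> / sqrt (w y)))\<^sup>2"
          using power_mono[OF row[of "\<beta> h x"], of 2] by simp
        then have "w x * (\<Sum>y\<in>A. \<beta> h x y * u y)\<^sup>2 \<le> w x * (U * (\<Sum>y\<in>A. \<bar>\<beta> h x y\<bar> / sqrt (w y))\<^sup>2)"
          using w[OF x] U by (intro mult_left_mono) (auto simp: power_mult_distrib)
        then show "w x * (\<Sum>y\<in>A. \<beta> h x y * u y)\<^sup>2 \<le> U * (w x * (\<Sum>y\<in>A. \<bar>\<beta> h x y\<bar> / sqrt (w y))\<^sup>2)"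
          by (simp add: mult_ac)
      qed
      have "(\<Sum>x\<in>A. w x * (\<Sum>y\<in>A. B h x y * u y)\<^sup>2)
          = (\<Sum>x\<in>A. w x * (u x)\<^sup>2 + h * (2 * (w x * u x * (\<Sum>y\<in>A. \<beta> h x y * u y)) + h * (w x * (\<Sum>y\<in>A. \<beta> h x y * u y)\<^sup>2)))"
      proof (intro sum.cong refl)
        fix x assume x: "x \<in> A"
        show "w x * (\<Sum>y\<in>A. B h x y * u y)\<^sup>2
            = w x * (u x)\<^sup>2 + h * (2 * (w x * u x * (\<Sum>y\<in>A. \<beta> h x y * u y)) + h * (w x * (\<Sum>y\<in>A. \<beta> h x y * u y)\<^sup>2))"
          unfolding expand[OF x] by (simp add: power2_eq_square algebra_simps)
      qed
      also have "\<dots> = U + h * (2 * (\<Sum>x\<in>A. w x * u x * (\<Sum>y\<in>A. \<beta> h x y * u y)) + h * (\<Sum>x\<in>A. w x * (\<Sum>y\<in>A. \<beta> h x y * u y)\<^sup>2))"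
        by (simp only: sum.distrib sum_distrib_left[symmetric] U_def)
      also have "\<dots> \<le> U + h * (2 * (lam * U + U * (\<Sum>x\<in>A. sqrt (w x) * (\<Sum>y\<in>A. \<bar>\<beta> h x y - m x y\<bar> / sqrt (w y))))
          + h * (U * (\<Sum>x\<in>A. w x * (\<Sum>y\<in>A. \<bar>\<beta> h x y\<bar> / sqrt (w y))\<^sup>2)))"
        using h by (intro add_left_mono mult_left_mono add_mono first second) auto
      also have "\<dots> = U + h * (2 * lam * U + U * \<rho> h)"
        by (simp add: \<rho>_def algebra_simps)
      also have "\<dots> \<le> U + h * (2 * lam * U + U * 2)"
        using h U \<rho> by (intro add_left_mono mult_left_mono) auto
      also have "\<dots> = (1 + 2 * (lam + 1) * h) * U" by (simp add: algebra_simps)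
      finally show "(\<Sum>x\<in>A. w x * (\<Sum>y\<in>A. B h x y * u y)\<^sup>2) \<le> (1 + 2 * (lam + 1) * h) * (\<Sum>x\<in>A. w x * (u x)\<^sup>2)"
        by (simp add: U_def)
    qed
  qed
qed

text \<open>The sum is the integral of the step function that evaluates \<open>f\<close> at the next
  grid point after \<open>s\<close>. These points tend to \<open>s\<close> from the right, so
  right-continuity gives pointwise convergence and boundedness allows dominated convergence. Right
  endpoints also match the discrete Feynman-Kac products, where the weight is read after each step
  of the kernel.\<close>

lemma riemann_sums_right_continuous:
  fixes f :: "real \<Rightarrow> real"
  assumes t: "0 < t" and bdd: "\<And>s. \<bar>f s\<bar> \<le> c"
    and cont: "\<And>s. 0 \<le> s \<Longrightarrow> (f \<longlongrightarrow> f s) (at_right s)"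
  shows "(\<lambda>n. \<Sum>i<Suc n. t / real (Suc n) * f (real (Suc i) * (t / real (Suc n))))
           \<longlonglongrightarrow> (LINT s:{0..t}|lborel. f s)"
proof -
  define h where "h = (\<lambda>n. t / real (Suc n))"
  \<comment> \<open>The floor plus 1, unlike a ceiling, stays strictly to the right of
    \<open>s\<close> even when \<open>s\<close> is a grid point, as convergence in
    \<open>at_right s\<close> requires.\<close>
  define p where "p = (\<lambda>n s. (of_int \<lfloor>s / h n\<rfloor> + 1) * h n)"
  have h: "0 < h n" for n using t by (simp add: h_def)
  have h_lim: "h \<longlonglongrightarrow> 0"
    unfolding h_def using LIMSEQ_Suc[OF lim_const_over_n[of t]] by simp
  have p: "s < p n s" "p n s \<le> s + h n" for n s
  proof -
    have "s / h n < of_int \<lfloor>s / h n\<rfloor> + 1" "of_int \<lfloor>s / h n\<rfloor> \<le> s / h n" by linarith+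
    then have "s / h n * h n < (of_int \<lfloor>s / h n\<rfloor> + 1) * h n" "of_int \<lfloor>s / h n\<rfloor> * h n \<le> s / h n * h n"
      using h[of n] by (intro mult_strict_right_mono mult_right_mono; simp)+
    then show "s < p n s" "p n s \<le> s + h n"
      using h[of n] by (auto simp: p_def distrib_right)
  qed
  have p_lim: "filterlim (\<lambda>n. p n s) (at_right s) sequentially" for s
    unfolding filterlim_at
  proof
    have "(\<lambda>n. s + h n) \<longlonglongrightarrow> s + 0" by (intro tendsto_intros h_lim)
    then show "(\<lambda>n. p n s) \<longlonglongrightarrow> s"
      using p by (intro real_tendsto_sandwich[of "\<lambda>_. s" "\<lambda>n. p n s" sequentially "\<lambda>n. s + h n"]) (auto simp: less_imp_le)
    show "eventually (\<lambda>n. p n s \<in> {s<..} \<and> p n s \<noteq> s) sequentially"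
      using p(1) by (intro always_eventually) (auto simp: less_imp_neq[symmetric] dest: less_imp_neq)
  qed
  define F where "F = (\<lambda>n s. indicator {0..<t} s * f (p n s))"
  have F_meas [measurable]: "F n \<in> borel_measurable lborel" for n
  proof -
    have "(\<lambda>s. (\<lambda>k::int. f ((of_int k + 1) * h n)) \<lfloor>s / h n\<rfloor>) \<in> borel_measurable borel"
      by (rule measurable_compose[of _ _ "count_space UNIV"]) simp_all
    then show ?thesis unfolding F_def p_def by simp
  qed
  have F_lim: "(\<lambda>n. F n s) \<longlonglongrightarrow> indicator {0..<t} s * f s" for s
  proof (cases "s \<in> {0..<t}")
    case True
    then show ?thesis unfolding F_def
      by (intro tendsto_mult tendsto_const filterlim_compose[OF cont p_lim]) auto
  qed (simp add: F_def)
  \<comment> \<open>Measurability of \<open>f\<close> on the interval is inherited from the step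
    functions that converge to it.\<close>
  have f_meas [measurable]: "(\<lambda>s. indicator {0..<t} s * f s) \<in> borel_measurable lborel"
    by (rule borel_measurable_LIMSEQ_real[OF F_lim F_meas])
  have c: "0 \<le> c" using bdd[of 0] by linarith
  have "(\<lambda>n. integral\<^sup>L lborel (F n)) \<longlonglongrightarrow> integral\<^sup>L lborel (\<lambda>s. indicator {0..<t} s * f s)"
  proof (rule integral_dominated_convergence)
    show "integrable lborel (\<lambda>s. c * indicator {0..<t} s)"
      using t by (intro integrable_mult_right integrable_real_indicator) auto
    show "AE s in lborel. norm (F n s) \<le> c * indicator {0..<t} s" for n
      unfolding F_def using bdd[of "p n _"] c by (intro AE_I2) (simp add: indicator_def)
  qed (use F_lim in auto)
  moreover have "integral\<^sup>L lborel (\<lambda>s. indicator {0..<t} s * f s) = (LINT s:{0..t}|lborel. f s)"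
    unfolding set_lebesgue_integral_def
  proof (rule integral_cong_AE)
    show "AE s in lborel. indicator {0..<t} s * f s = indicator {0..t} s *\<^sub>R f s"
      using AE_lborel_singleton[of t] by eventually_elim (auto simp: indicator_def)
    have "(\<lambda>s. indicator {0..t} s *\<^sub>R f s) = (\<lambda>s. indicator {0..<t} s * f s + f t * indicator {t} s)"
      using t by (auto simp: indicator_def fun_eq_iff)
    then show "(\<lambda>s. indicator {0..t} s *\<^sub>R f s) \<in> borel_measurable lborel" by simp
  qed simp
  moreover have "integral\<^sup>L lborel (F n) = (\<Sum>i<Suc n. h n * f (real (Suc i) * h n))" for n
  proof -
    have ind: "indicator {0..<real k * h n} s * f (p n s)
        = (\<Sum>i<k. f (real (Suc i) * h n) * indicator {real i * h n..<real (Suc i) * h n} s)" for k s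
    proof (induction k)
      case (Suc k)
      have "indicator {0..<real (Suc k) * h n} s * f (p n s)
          = indicator {0..<real k * h n} s * f (p n s)
          + indicator {real k * h n..<real (Suc k) * h n} s * f (p n s)"
      proof -
        have "0 \<le> s" if "real k * h n \<le> s"
          using h[of n] by (intro order_trans[OF _ that]) simp
        then show ?thesis using h[of n] by (auto simp: indicator_def distrib_right)
      qed
      also have "indicator {real k * h n..<real (Suc k) * h n} s * f (p n s)
          = f (real (Suc k) * h n) * indicator {real k * h n..<real (Suc k) * h n} s"
      proof (cases "s \<in> {real k * h n..<real (Suc k) * h n}")
        case True
        then have "\<lfloor>s / h n\<rfloor> = int k"
          using h[of n] by (intro floor_unique) (auto simp: pos_le_divide_eq pos_divide_less_eq distrib_right)
        then show ?thesis by (simp add: p_def add.commute)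
      qed simp
      finally show ?case using Suc.IH by simp
    qed simp
    have "F n = (\<lambda>s. \<Sum>i<Suc n. f (real (Suc i) * h n) * indicator {real i * h n..<real (Suc i) * h n} s)"
    proof
      fix s show "F n s = (\<Sum>i<Suc n. f (real (Suc i) * h n) * indicator {real i * h n..<real (Suc i) * h n} s)"
        unfolding ind[of "Suc n" s, symmetric] F_def by (simp add: h_def)
    qed
    then have "integral\<^sup>L lborel (F n)
        = integral\<^sup>L lborel (\<lambda>s. \<Sum>i<Suc n. f (real (Suc i) * h n) * indicator {real i * h n..<real (Suc i) * h n} s)"
      by (rule arg_cong)
    also have "\<dots> = (\<Sum>i<Suc n. f (real (Suc i) * h n) * measure lborel {real i * h n..<real (Suc i) * h n})"
      using h[of n] by (subst Bochner_Integration.integral_sum)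
        (auto intro!: integrable_mult_right integrable_real_indicator simp: emeasure_lborel_Ico distrib_right simp del: sum.lessThan_Suc measure_lborel_Ico)
    also have "\<dots> = (\<Sum>i<Suc n. h n * f (real (Suc i) * h n))"
      using h[of n] by (intro sum.cong refl) (simp add: algebra_simps)
    finally show ?thesis .
  qed
  ultimately show ?thesis by (simp only: h_def)
qed

section \<open>Markov property and the discrete Feynman-Kac formula\<close>

lemma measurable_past_sigma:
  assumes "X u \<in> measurable M (count_space S)" "0 \<le> u" "u \<le> s"
  shows "X u \<in> measurable (past_sigma M S X s) (count_space S)"
proof (rule measurableI)
  show "X u \<omega> \<in> space (count_space S)" if "\<omega> \<in> space (past_sigma M S X s)" for \<omega>
    using that assms(1) by (auto simp: past_sigma_def space_measure_of_conv dest: measurable_space)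
  show "X u -` A \<inter> space (past_sigma M S X s) \<in> sets (past_sigma M S X s)" if "A \<in> sets (count_space S)" for A
    using that assms unfolding past_sigma_def by (auto simp: sets_measure_of_conv space_measure_of_conv)
qed

lemma subalgebra_past_sigma:
  assumes "\<And>u. 0 \<le> u \<Longrightarrow> X u \<in> measurable M (count_space S)"
  shows "subalgebra M (past_sigma M S X s)"
proof -
  have "{X u -` A \<inter> space M |u A. 0 \<le> u \<and> u \<le> s \<and> A \<subseteq> S} \<subseteq> sets M"
    using assms by (auto intro!: measurable_sets[where A = "count_space S"])
  then have "sigma_sets (space M) {X u -` A \<inter> space M |u A. 0 \<le> u \<and> u \<le> s \<and> A \<subseteq> S} \<subseteq> sets M"
    by (rule sets.sigma_sets_subset)
  moreover have "{X u -` A \<inter> space M |u A. 0 \<le> u \<and> u \<le> s \<and> A \<subseteq> S} \<subseteq> Pow (space M)"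
    by auto
  ultimately show ?thesis
    by (simp add: subalgebra_def past_sigma_def space_measure_of_conv sets_measure_of)
qed

text \<open>One step of the discrete Feynman-Kac operator; the weight \<open>\<phi>\<close> is read
  at the arrival point.\<close>

definition weighted_step :: "('s \<Rightarrow> 's pmf) \<Rightarrow> ('s \<Rightarrow> real) \<Rightarrow> ('s \<Rightarrow> real) \<Rightarrow> 's \<Rightarrow> real" where
  "weighted_step k \<phi> u x = measure_pmf.expectation (k x) (\<lambda>y. \<phi> y * u y)"

lemma bdd_fun_on_times:
  assumes "bdd_fun_on S f" "bdd_fun_on S g"
  shows "bdd_fun_on S (\<lambda>x. f x * g x)"
proof -
  obtain b c where "\<forall>x\<in>S. \<bar>f x\<bar> \<le> b" "\<forall>x\<in>S. \<bar>g x\<bar> \<le> c"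
    using assms by (auto simp: bdd_fun_on_def)
  then have "\<forall>x\<in>S. \<bar>f x * g x\<bar> \<le> b * c"
    unfolding abs_mult by (auto intro!: mult_mono dest: order_trans[OF abs_ge_zero])
  then show ?thesis by (auto simp: bdd_fun_on_def)
qed

lemma bdd_fun_on_weighted_step:
  assumes "\<And>x. x \<in> S \<Longrightarrow> set_pmf (k x) \<subseteq> S" "bdd_fun_on S \<phi>" "bdd_fun_on S u"
  shows "bdd_fun_on S (weighted_step k \<phi> u)"
proof -
  obtain c where c: "\<And>x. x \<in> S \<Longrightarrow> \<bar>\<phi> x * u x\<bar> \<le> c"
    using bdd_fun_on_times[OF assms(2,3)] by (auto simp: bdd_fun_on_def)
  have "\<bar>weighted_step k \<phi> u x\<bar> \<le> c" if x: "x \<in> S" for x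
  proof -
    have ae: "AE y in k x. norm (\<phi> y * u y) \<le> c"
      using assms(1)[OF x] c by (auto simp: AE_measure_pmf_iff)
    have int: "integrable (k x) (\<lambda>y. \<phi> y * u y)"
      by (rule measure_pmf.integrable_const_bound[OF ae]) simp
    have "AE y in k x. \<phi> y * u y \<le> c" "AE y in k x. - c \<le> \<phi> y * u y"
      using ae by (eventually_elim, simp add: abs_le_iff)+
    then have "weighted_step k \<phi> u x \<le> c" "- c \<le> weighted_step k \<phi> u x"
      unfolding weighted_step_def
      by (blast intro: measure_pmf.integral_le_const[OF int] measure_pmf.integral_ge_const[OF int])+
    then show ?thesis by (simp add: abs_le_iff)
  qed
  then show ?thesis by (auto simp: bdd_fun_on_def)
qed

text \<open>Conditioning on the past at the last but one time replaces the last weight and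
  \<open>u\<close> by \<open>weighted_step\<close> of \<open>u\<close>, evaluated at that earlier
  time. As times are removed from the end, the induction has to run over all bounded
  \<open>u\<close>.\<close>

lemma markov_expectation_prod:
  fixes X :: "real \<Rightarrow> 'w \<Rightarrow> 's"
  assumes "prob_space M" and X: "\<And>t. 0 \<le> t \<Longrightarrow> X t \<in> measurable M (count_space S)"
    and markov: "\<And>s t F. 0 \<le> s \<Longrightarrow> 0 \<le> t \<Longrightarrow> bdd_fun_on S F \<Longrightarrow>
           (AE \<omega> in M. real_cond_exp M (past_sigma M S X s) (\<lambda>\<omega>. F (X (s + t) \<omega>)) \<omega>
              = measure_pmf.expectation (K t (X s \<omega>)) F)"
    and K: "\<And>x. x \<in> S \<Longrightarrow> set_pmf (K h x) \<subseteq> S" and h: "0 \<le> h"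
    and \<phi>: "bdd_fun_on S \<phi>" and u: "bdd_fun_on S u"
  shows "(\<integral>\<omega>. (\<Prod>i<n. \<phi> (X (real (Suc i) * h) \<omega>)) * u (X (real n * h) \<omega>) \<partial>M)
    = (\<integral>\<omega>. (weighted_step (K h) \<phi> ^^ n) u (X 0 \<omega>) \<partial>M)"
  using u
proof (induction n arbitrary: u)
  case 0
  then show ?case by simp
next
  case (Suc n)
  interpret prob_space M by fact
  let ?s = "real n * h"
  have s: "0 \<le> ?s" using h by simp
  interpret finite_measure_subalgebra M "past_sigma M S X ?s"
    by (intro finite_measure_subalgebra.intro finite_measure_subalgebra_axioms.intro
        subalgebra_past_sigma X) (unfold_locales)
  define f where "f = (\<lambda>\<omega>. \<Prod>i<n. \<phi> (X (real (Suc i) * h) \<omega>))"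
  define F where "F = (\<lambda>x. \<phi> x * u x)"
  have F: "bdd_fun_on S F" unfolding F_def by (rule bdd_fun_on_times[OF \<phi> Suc.prems])
  have meas: "(\<lambda>\<omega>. v (X t \<omega>)) \<in> borel_measurable M" if "0 \<le> t" for v :: "'s \<Rightarrow> real" and t
    by (rule measurable_compose[OF X[OF that]]) simp
  have meas_past: "(\<lambda>\<omega>. v (X t \<omega>)) \<in> borel_measurable (past_sigma M S X ?s)"
    if "0 \<le> t" "t \<le> ?s" for v :: "'s \<Rightarrow> real" and t
    by (rule measurable_compose[OF measurable_past_sigma[where X = X and M = M and S = S and s = ?s, OF X[OF that(1)] that]]) simp
  have f_meas: "f \<in> borel_measurable (past_sigma M S X ?s)"
    unfolding f_def using h by (intro borel_measurable_prod meas_past mult_right_mono) auto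
  have fM: "f \<in> borel_measurable M"
    unfolding f_def using h by (intro borel_measurable_prod meas) auto
  obtain c where c: "\<And>x. x \<in> S \<Longrightarrow> \<bar>\<phi> x\<bar> \<le> c" using \<phi> by (auto simp: bdd_fun_on_def)
  obtain c' where c': "\<And>x. x \<in> S \<Longrightarrow> \<bar>F x\<bar> \<le> c'" using F by (auto simp: bdd_fun_on_def)
  have XS: "X t \<omega> \<in> S" if "0 \<le> t" "\<omega> \<in> space M" for t \<omega>
    using measurable_space[OF X[OF that(1)] that(2)] by simp
  have f_bound: "\<bar>f \<omega>\<bar> \<le> c ^ n" if "\<omega> \<in> space M" for \<omega>
  proof -
    have "\<bar>f \<omega>\<bar> \<le> (\<Prod>i<n. c)"
      unfolding f_def abs_prod using that h by (intro prod_mono) (auto intro!: c XS)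
    then show ?thesis by simp
  qed
  have t: "?s + h = real (Suc n) * h" by (simp add: algebra_simps)
  have gM: "(\<lambda>\<omega>. F (X (?s + h) \<omega>)) \<in> borel_measurable M" using s h by (intro meas) auto
  have int: "integrable M (\<lambda>\<omega>. f \<omega> * F (X (?s + h) \<omega>))"
  proof (rule integrable_const_bound[where B = "c ^ n * c'"])
    show "AE \<omega> in M. norm (f \<omega> * F (X (?s + h) \<omega>)) \<le> c ^ n * c'"
      using f_bound c' XS s h
      by (intro AE_I2) (auto simp: abs_mult intro!: mult_mono dest: order_trans[OF abs_ge_zero])
    show "(\<lambda>\<omega>. f \<omega> * F (X (?s + h) \<omega>)) \<in> borel_measurable M"
      using fM gM by simp
  qed
  have "(\<integral>\<omega>. (\<Prod>i<Suc n. \<phi> (X (real (Suc i) * h) \<omega>)) * u (X (real (Suc n) * h) \<omega>) \<partial>M)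
      = (\<integral>\<omega>. f \<omega> * F (X (?s + h) \<omega>) \<partial>M)"
    unfolding t F_def f_def by (simp add: mult_ac)
  also have "\<dots> = (\<integral>\<omega>. f \<omega> * real_cond_exp M (past_sigma M S X ?s) (\<lambda>\<omega>. F (X (?s + h) \<omega>)) \<omega> \<partial>M)"
    by (rule real_cond_exp_intg(2)[OF int f_meas gM, symmetric])
  also have "\<dots> = (\<integral>\<omega>. f \<omega> * weighted_step (K h) \<phi> u (X ?s \<omega>) \<partial>M)"
  proof (rule integral_cong_AE)
    show "AE \<omega> in M. f \<omega> * real_cond_exp M (past_sigma M S X ?s) (\<lambda>\<omega>. F (X (?s + h) \<omega>)) \<omega>
        = f \<omega> * weighted_step (K h) \<phi> u (X ?s \<omega>)"
      using markov[OF s h F] by eventually_elim (simp add: weighted_step_def F_def)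
  qed (use fM meas[OF s] in auto)
  also have "\<dots> = (\<integral>\<omega>. (weighted_step (K h) \<phi> ^^ n) (weighted_step (K h) \<phi> u) (X 0 \<omega>) \<partial>M)"
    unfolding f_def by (intro Suc.IH bdd_fun_on_weighted_step K \<phi> Suc.prems)
  also have "(weighted_step (K h) \<phi> ^^ n) (weighted_step (K h) \<phi> u) = (weighted_step (K h) \<phi> ^^ Suc n) u"
    by (simp add: funpow_swap1)
  finally show ?case .
qed

text \<open>The spectral hypothesis concerns only the finite invariant set \<open>A\<close>. As no uniform bound on the jump rates off \<open>A\<close> is
  available, the Feynman-Kac formula is used for Riemann sums of \<open>V\<close> along the path, and the \<open>L\<^sup>2\<close>-norm of one step of
  length \<open>h\<close> is expanded to first order in \<open>h\<close>.\<close>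

lemma feynman_kac_bound:
  fixes X :: "real \<Rightarrow> 'w \<Rightarrow> 's::topological_space"
  assumes X: "markov_process M S G X"
    and jump: "\<And>\<omega> s. \<omega> \<in> space M \<Longrightarrow> 0 \<le> s \<Longrightarrow> eventually (\<lambda>r. X r \<omega> = X s \<omega>) (at_right s)"
    and A: "finite A" "A \<subseteq> S"
    and inv: "\<And>x. x \<in> A \<Longrightarrow> G (indicator A) x = 0"
    and outside: "\<And>x. x \<in> S - A \<Longrightarrow> \<exists>B. finite B \<and> B \<subseteq> S - A \<and> x \<in> B \<and> (\<forall>y\<in>B. G (indicator B) y = 0)"
    and V: "\<And>x. x \<notin> A \<Longrightarrow> V x = 0"
    and w: "\<And>x. x \<in> A \<Longrightarrow> 0 < w x" and C: "0 \<le> C"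
    and law: "\<And>x. x \<in> A \<Longrightarrow> measure M {\<omega> \<in> space M. X 0 \<omega> = x} = C * w x"
    and form: "\<And>u. (\<Sum>x\<in>A. w x * u x * (\<Sum>y\<in>A. G (indicator {y}) x * u y)) + (\<Sum>x\<in>A. w x * V x * (u x)\<^sup>2)
                  \<le> lam * (\<Sum>x\<in>A. w x * (u x)\<^sup>2)"
    and t: "0 < t"
  shows "(\<integral>\<^sup>+ \<omega>. ennreal (exp (LINT s:{0..t}|lborel. V (X s \<omega>))) \<partial>M) \<le> ennreal (1 + exp ((lam + 1) * t))"
proof -
  interpret prob_space M using X by (simp add: markov_process_def)
  have X_meas: "X t \<in> measurable M (count_space S)" if "0 \<le> t" for t
    using X that by (simp add: markov_process_def)
  obtain K where K: "transition_kernel S G K"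
    and markov: "\<And>s t F. 0 \<le> s \<Longrightarrow> 0 \<le> t \<Longrightarrow> bdd_fun_on S F \<Longrightarrow>
           (AE \<omega> in M. real_cond_exp M (past_sigma M S X s) (\<lambda>\<omega>. F (X (s + t) \<omega>)) \<omega>
              = measure_pmf.expectation (K t (X s \<omega>)) F)"
    using X by (auto simp: markov_process_def)
  have K_S: "set_pmf (K h x) \<subseteq> S" if "x \<in> S" "0 \<le> h" for h x
    using K that by (auto simp: transition_kernel_def)
  have K_A: "set_pmf (K h x) \<subseteq> A" if "x \<in> A" "0 \<le> h" for h x
    by (rule kernel_stays_in_finite[OF K A inv that(2,1)])
  \<comment> \<open>The finite invariant sets given by \<open>outside\<close> cover the complement
    of \<open>A\<close>, so no path enters \<open>A\<close> either.\<close>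
  have K_compl: "set_pmf (K h x) \<subseteq> S - A" if x: "x \<in> S - A" and h: "0 \<le> h" for h x
  proof -
    obtain B where B: "finite B" "B \<subseteq> S - A" "x \<in> B" "\<forall>y\<in>B. G (indicator B) y = 0"
      using outside[OF x] by blast
    then have "set_pmf (K h x) \<subseteq> B" using h by (intro kernel_stays_in_finite[OF K]) auto
    with B show ?thesis by blast
  qed
  define c where "c = (\<Sum>x\<in>A. \<bar>V x\<bar>)"
  have V_bound: "\<bar>V x\<bar> \<le> c" for x
    using member_le_sum[of x A "\<lambda>x. \<bar>V x\<bar>"] A V[of x] by (cases "x \<in> A") (auto simp: c_def sum_nonneg)
  define \<phi> where "\<phi> = (\<lambda>h x. exp (h * V x))"
  have \<phi>_bdd: "bdd_fun_on S (\<phi> h)" for h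
  proof -
    have "h * V x \<le> \<bar>h\<bar> * c" for x
      using abs_ge_self[of "h * V x"] mult_left_mono[OF V_bound[of x], of "\<bar>h\<bar>"] by (simp add: abs_mult)
    then show ?thesis unfolding bdd_fun_on_def \<phi>_def by (intro exI[of _ "exp (\<bar>h\<bar> * c)"]) auto
  qed
  define Q where "Q = (\<lambda>h. weighted_step (K h) (\<phi> h))"
  have Q_bdd: "bdd_fun_on S ((Q h ^^ n) (\<lambda>_. 1))" if "0 \<le> h" for h n
  proof (induction n)
    case 0
    show ?case by (auto simp: bdd_fun_on_def)
  next
    case (Suc n)
    then show ?case unfolding Q_def funpow.simps comp_def using K_S that
      by (intro bdd_fun_on_weighted_step \<phi>_bdd)
  qed
  \<comment> \<open>A path started outside \<open>A\<close> only meets \<open>V = 0\<close> and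
    keeps weight 1; such paths account for the summand 1 in the final bound.\<close>
  have Q_compl: "(Q h ^^ n) (\<lambda>_. 1) x = 1" if "x \<in> S - A" "0 \<le> h" for h n x
    using that(1)
  proof (induction n arbitrary: x)
    case (Suc n)
    have one: "\<phi> h y * (Q h ^^ n) (\<lambda>_. 1) y = 1" if "y \<in> set_pmf (K h x)" for y
      using Suc.IH[of y] K_compl[OF Suc.prems \<open>0 \<le> h\<close>] that V[of y] by (auto simp: \<phi>_def)
    have "weighted_step (K h) (\<phi> h) ((Q h ^^ n) (\<lambda>_. 1)) x = measure_pmf.expectation (K h x) (\<lambda>_. 1)"
      unfolding weighted_step_def by (rule integral_cong_AE) (auto simp: AE_measure_pmf_iff one)
    then show ?case by (simp add: Q_def)
  qed simp
  define B where "B = (\<lambda>h x y. pmf (K h x) y * \<phi> h y)"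
  have Q_A: "Q h u x = (\<Sum>y\<in>A. B h x y * u y)" if "x \<in> A" "0 \<le> h" for h u x
    unfolding Q_def weighted_step_def using K_A[OF that]
    by (subst integral_measure_pmf[of A]) (auto simp: A B_def mult_ac)
  \<comment> \<open>The product rule at \<open>h = 0\<close>: to first order the weighted kernel is
    the matrix of \<open>G\<close> plus \<open>V\<close> on the diagonal.\<close>
  have B_lim: "((\<lambda>h. (B h x y - of_bool (x = y)) / h) \<longlongrightarrow> G (indicator {y}) x + of_bool (x = y) * V y) (at_right 0)"
    if "x \<in> A" "y \<in> A" for x y
  proof -
    have "bdd_fun_on S (indicator {y})"
      unfolding bdd_fun_on_def by (intro exI[of _ 1]) (auto simp: indicator_def)
    then have "((\<lambda>h. (measure_pmf.expectation (K h x) (indicator {y}) - indicator {y} x) / h) \<longlongrightarrow> G (indicator {y}) x) (at_right 0)"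
      using K subsetD[OF A(2) that(1)] unfolding transition_kernel_def by blast
    then have 1: "((\<lambda>h. (pmf (K h x) y - of_bool (x = y)) / h) \<longlongrightarrow> G (indicator {y}) x) (at_right 0)"
      by (simp add: measure_pmf_single indicator_def of_bool_def)
    have 2: "((\<lambda>h. \<phi> h y) \<longlongrightarrow> \<phi> 0 y) (at_right 0)"
      unfolding \<phi>_def by (intro tendsto_intros)
    have "((\<lambda>h. \<phi> h y) has_real_derivative V y) (at 0)"
      unfolding \<phi>_def by (auto intro!: derivative_eq_intros)
    then have 3: "((\<lambda>h. (\<phi> h y - 1) / h) \<longlongrightarrow> V y) (at_right 0)"
      unfolding DERIV_def by (rule tendsto_within_subset[THEN tendsto_cong[THEN iffD1, rotated]]) (auto simp: \<phi>_def)
    have "((\<lambda>h. (pmf (K h x) y - of_bool (x = y)) / h * \<phi> h y + of_bool (x = y) * ((\<phi> h y - 1) / h))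
        \<longlongrightarrow> G (indicator {y}) x * \<phi> 0 y + of_bool (x = y) * V y) (at_right 0)"
      by (intro tendsto_intros 1 2 3)
    moreover have "(B h x y - of_bool (x = y)) / h
        = (pmf (K h x) y - of_bool (x = y)) / h * \<phi> h y + of_bool (x = y) * ((\<phi> h y - 1) / h)" for h
      by (auto simp: B_def divide_simps algebra_simps)
    ultimately show ?thesis by (simp add: \<phi>_def)
  qed
  have "eventually (\<lambda>h. \<forall>u. (\<Sum>x\<in>A. w x * (\<Sum>y\<in>A. B h x y * u y)\<^sup>2)
           \<le> (1 + 2 * (lam + 1) * h) * (\<Sum>x\<in>A. w x * (u x)\<^sup>2)) (at_right 0)"
  proof (rule eventually_finite_operator_bound[OF A(1) w B_lim])
    fix u
    have "(\<Sum>x\<in>A. w x * u x * (\<Sum>y\<in>A. (G (indicator {y}) x + of_bool (x = y) * V y) * u y))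
        = (\<Sum>x\<in>A. w x * u x * (\<Sum>y\<in>A. G (indicator {y}) x * u y) + w x * V x * (u x)\<^sup>2)"
    proof (intro sum.cong refl)
      fix x assume x: "x \<in> A"
      have "(\<Sum>y\<in>A. (G (indicator {y}) x + of_bool (x = y) * V y) * u y)
          = (\<Sum>y\<in>A. G (indicator {y}) x * u y + (if x = y then V y * u y else 0))"
        by (intro sum.cong refl) (simp add: algebra_simps)
      also have "\<dots> = (\<Sum>y\<in>A. G (indicator {y}) x * u y) + V x * u x"
        using x A by (simp add: sum.distrib)
      finally show "w x * u x * (\<Sum>y\<in>A. (G (indicator {y}) x + of_bool (x = y) * V y) * u y)
          = w x * u x * (\<Sum>y\<in>A. G (indicator {y}) x * u y) + w x * V x * (u x)\<^sup>2"
        by (simp add: power2_eq_square algebra_simps)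
    qed
    then show "(\<Sum>x\<in>A. w x * u x * (\<Sum>y\<in>A. (G (indicator {y}) x + of_bool (x = y) * V y) * u y))
        \<le> lam * (\<Sum>x\<in>A. w x * (u x)\<^sup>2)"
      using form[of u] by (simp add: sum.distrib)
  qed auto
  then obtain h0 where h0: "0 < h0" and norm_B: "\<And>h u. 0 < h \<Longrightarrow> h < h0 \<Longrightarrow>
      (\<Sum>x\<in>A. w x * (\<Sum>y\<in>A. B h x y * u y)\<^sup>2) \<le> (1 + 2 * (lam + 1) * h) * (\<Sum>x\<in>A. w x * (u x)\<^sup>2)"
    unfolding eventually_at_right_field by blast
  \<comment> \<open>The weight \<open>w\<close> is not normalised; \<open>C * w\<close> is the
    initial law restricted to \<open>A\<close>, so its mass is at most 1.\<close>
  have sum_law: "C * (\<Sum>x\<in>A. w x) \<le> 1"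
  proof -
    have "C * (\<Sum>x\<in>A. w x) = (\<Sum>x\<in>A. measure M {\<omega> \<in> space M. X 0 \<omega> = x})"
      by (simp add: law sum_distrib_left)
    also have "\<dots> = measure M (\<Union>x\<in>A. {\<omega> \<in> space M. X 0 \<omega> = x})"
    proof (rule finite_measure_finite_Union[symmetric])
      show "(\<lambda>x. {\<omega> \<in> space M. X 0 \<omega> = x}) ` A \<subseteq> events"
        using measurable_sets[OF X_meas[of 0], of "{_}"] A
        by (auto simp: vimage_def Int_def conj_commute subset_iff)
    qed (auto simp: A disjoint_family_on_def)
    finally show ?thesis by simp
  qed
  define \<theta> where "\<theta> = exp ((lam + 1) * t)"
  have riemann: "(\<integral>\<^sup>+ \<omega>. ennreal (exp (\<Sum>i<Suc n. h * V (X (real (Suc i) * h) \<omega>))) \<partial>M) \<le> ennreal (1 + \<theta>)"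
    if h_def: "h = t / real (Suc n)" and "h < h0" for n h
  proof -
    have h: "0 < h" "0 \<le> h" using t by (auto simp: h_def)
    define g where "g = (Q h ^^ Suc n) (\<lambda>_. 1)"
    have g_norm: "(\<Sum>x\<in>A. w x * ((Q h ^^ k) (\<lambda>_. 1) x)\<^sup>2) \<le> exp (2 * (lam + 1) * h * real k) * (\<Sum>x\<in>A. w x)" for k
    proof (induction k)
      case (Suc k)
      have "(\<Sum>x\<in>A. w x * ((Q h ^^ Suc k) (\<lambda>_. 1) x)\<^sup>2)
          = (\<Sum>x\<in>A. w x * (\<Sum>y\<in>A. B h x y * (Q h ^^ k) (\<lambda>_. 1) y)\<^sup>2)"
        by (intro sum.cong refl) (simp add: Q_A h)
      also have "\<dots> \<le> (1 + 2 * (lam + 1) * h) * (\<Sum>x\<in>A. w x * ((Q h ^^ k) (\<lambda>_. 1) x)\<^sup>2)"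
        by (rule norm_B[OF h(1) that(2)])
      also have "\<dots> \<le> exp (2 * (lam + 1) * h) * (\<Sum>x\<in>A. w x * ((Q h ^^ k) (\<lambda>_. 1) x)\<^sup>2)"
        using w by (intro mult_right_mono exp_ge_add_one_self sum_nonneg) (auto simp: less_imp_le)
      also have "\<dots> \<le> exp (2 * (lam + 1) * h) * (exp (2 * (lam + 1) * h * real k) * (\<Sum>x\<in>A. w x))"
        by (intro mult_left_mono Suc.IH) auto
      also have "\<dots> = exp (2 * (lam + 1) * h * real (Suc k)) * (\<Sum>x\<in>A. w x)"
        by (simp add: algebra_simps flip: exp_add)
      finally show ?case .
    qed simp
    have "exp (2 * (lam + 1) * h * real (Suc n)) = \<theta>\<^sup>2"
      by (simp add: h_def \<theta>_def power2_eq_square flip: exp_add)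
    then have g2: "(\<Sum>x\<in>A. w x * (g x)\<^sup>2) \<le> \<theta>\<^sup>2 * (\<Sum>x\<in>A. w x)"
      using g_norm[of "Suc n"] by (simp only: g_def)
    have g1: "C * (\<Sum>x\<in>A. w x * g x) \<le> \<theta>"
    proof -
      have \<theta>: "0 < \<theta>" by (simp add: \<theta>_def)
      \<comment> \<open>Cauchy-Schwarz as a weighted arithmetic-geometric mean: the weight \<theta>
        makes the bounds for the two halves equal, and the mean of \<open>g\<close> is at most
        \<theta>.\<close>
      have "w x * g x \<le> \<theta> / 2 * w x + w x * (g x)\<^sup>2 / (2 * \<theta>)" if "x \<in> A" for x
      proof -
        have "2 * g x * \<theta> \<le> \<theta>\<^sup>2 + (g x)\<^sup>2" using sum_squares_bound[of "g x" \<theta>] by simp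
        then have "g x \<le> \<theta> / 2 + (g x)\<^sup>2 / (2 * \<theta>)" using \<theta> by (simp add: field_simps power2_eq_square)
        then have "w x * g x \<le> w x * (\<theta> / 2 + (g x)\<^sup>2 / (2 * \<theta>))" using w[OF that] by simp
        then show ?thesis by (simp add: algebra_simps)
      qed
      then have "(\<Sum>x\<in>A. w x * g x) \<le> \<theta> / 2 * (\<Sum>x\<in>A. w x) + (\<Sum>x\<in>A. w x * (g x)\<^sup>2) / (2 * \<theta>)"
        unfolding sum_distrib_left sum_divide_distrib sum.distrib[symmetric] by (rule sum_mono)
      also have "\<dots> \<le> \<theta> / 2 * (\<Sum>x\<in>A. w x) + \<theta>\<^sup>2 * (\<Sum>x\<in>A. w x) / (2 * \<theta>)"
        using \<theta> by (intro add_left_mono divide_right_mono g2) auto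
      also have "\<dots> = \<theta> * (\<Sum>x\<in>A. w x)" using \<theta> by (simp add: field_simps power2_eq_square)
      finally have "C * (\<Sum>x\<in>A. w x * g x) \<le> C * (\<theta> * (\<Sum>x\<in>A. w x))"
        using C by (rule mult_left_mono)
      also have "\<dots> = \<theta> * (C * (\<Sum>x\<in>A. w x))" by (simp add: mult_ac)
      also have "\<dots> \<le> \<theta> * 1" using \<theta> by (intro mult_left_mono sum_law) auto
      finally show ?thesis by simp
    qed
    define Y where "Y = (\<lambda>\<omega>. \<Prod>i<Suc n. \<phi> h (X (real (Suc i) * h) \<omega>))"
    have Y_exp: "exp (\<Sum>i<Suc n. h * V (X (real (Suc i) * h) \<omega>)) = Y \<omega>" for \<omega>
      unfolding Y_def \<phi>_def by (rule exp_sum) simp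
    have meas: "(\<lambda>\<omega>. v (X r \<omega>)) \<in> borel_measurable M" if "0 \<le> r" for v :: "'s \<Rightarrow> real" and r
      by (rule measurable_compose[OF X_meas[OF that]]) simp
    have Y_int: "integrable M Y"
    proof (rule integrable_const_bound)
      have "(\<Sum>i<Suc n. h * V (X (real (Suc i) * h) \<omega>)) \<le> (\<Sum>i<Suc n. h * c)" for \<omega>
        using h by (intro sum_mono mult_left_mono abs_le_D1[OF V_bound])
      then show "AE \<omega> in M. norm (Y \<omega>) \<le> exp (\<Sum>i<Suc n. h * c)"
        unfolding Y_exp[symmetric] by (simp del: sum.lessThan_Suc)
      show "Y \<in> borel_measurable M"
        unfolding Y_def using h by (intro borel_measurable_prod meas) auto
    qed
    have "(\<integral>\<omega>. Y \<omega> \<partial>M) = (\<integral>\<omega>. (\<Prod>i<Suc n. \<phi> h (X (real (Suc i) * h) \<omega>)) * (\<lambda>_. 1) (X (real (Suc n) * h) \<omega>) \<partial>M)"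
      by (simp add: Y_def)
    also have "\<dots> = (\<integral>\<omega>. g (X 0 \<omega>) \<partial>M)"
      unfolding g_def Q_def
      by (rule markov_expectation_prod[OF prob_space_axioms X_meas markov K_S _ \<phi>_bdd])
        (use h in \<open>auto simp: bdd_fun_on_def\<close>)
    also have "\<dots> \<le> (\<integral>\<omega>. 1 + (\<Sum>x\<in>A. g x * indicator {\<omega> \<in> space M. X 0 \<omega> = x} \<omega>) \<partial>M)"
    proof (rule integral_mono)
      obtain cg where cg: "\<forall>x\<in>S. \<bar>g x\<bar> \<le> cg"
        using Q_bdd[OF h(2)] unfolding g_def bdd_fun_on_def by blast
      show "integrable M (\<lambda>\<omega>. g (X 0 \<omega>))"
        using cg measurable_space[OF X_meas[of 0]]
        by (intro integrable_const_bound[where B = cg] meas AE_I2) auto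
      have "{\<omega> \<in> space M. X 0 \<omega> = x} \<in> events" if "x \<in> A" for x
        using measurable_sets[OF X_meas[of 0], of "{x}"] A that
        by (auto simp: vimage_def Int_def conj_commute subset_iff)
      then show "integrable M (\<lambda>\<omega>. 1 + (\<Sum>x\<in>A. g x * indicator {\<omega> \<in> space M. X 0 \<omega> = x} \<omega>))"
        by (intro Bochner_Integration.integrable_add Bochner_Integration.integrable_sum integrable_mult_right integrable_real_indicator)
          (auto simp: emeasure_eq_measure)
      fix \<omega> assume \<omega>: "\<omega> \<in> space M"
      have g_sum: "(\<Sum>x\<in>A. g x * indicator {\<omega> \<in> space M. X 0 \<omega> = x} \<omega>) = (\<Sum>x\<in>A. if X 0 \<omega> = x then g x else 0)"
        using \<omega> by (intro sum.cong refl) (simp add: indicator_def)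
      have "X 0 \<omega> \<in> S" using measurable_space[OF X_meas \<omega>] by simp
      then have "g (X 0 \<omega>) = 1" if "X 0 \<omega> \<notin> A"
        using that h unfolding g_def by (intro Q_compl) auto
      then show "g (X 0 \<omega>) \<le> 1 + (\<Sum>x\<in>A. g x * indicator {\<omega> \<in> space M. X 0 \<omega> = x} \<omega>)"
        using A(1) unfolding g_sum by (cases "X 0 \<omega> \<in> A") auto
    qed
    also have "\<dots> = 1 + (\<Sum>x\<in>A. g x * (C * w x))"
    proof -
      have ev: "{\<omega> \<in> space M. X 0 \<omega> = x} \<in> events" if "x \<in> A" for x
        using measurable_sets[OF X_meas[of 0], of "{x}"] A that
        by (auto simp: vimage_def Int_def conj_commute subset_iff)
      have "(\<integral>\<omega>. 1 + (\<Sum>x\<in>A. g x * indicator {\<omega> \<in> space M. X 0 \<omega> = x} \<omega>) \<partial>M)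
          = 1 + (\<Sum>x\<in>A. g x * measure M {\<omega> \<in> space M. X 0 \<omega> = x})"
        using ev by (subst Bochner_Integration.integral_add)
          (auto intro!: Bochner_Integration.integrable_sum integrable_mult_right integrable_real_indicator
            simp: emeasure_eq_measure Bochner_Integration.integral_sum prob_space sets.Int_space_eq2)
      then show ?thesis using law by simp
    qed
    also have "\<dots> \<le> 1 + \<theta>" using g1 by (simp add: sum_distrib_left mult_ac)
    finally have "(\<integral>\<omega>. Y \<omega> \<partial>M) \<le> 1 + \<theta>" .
    moreover have "(\<integral>\<^sup>+ \<omega>. ennreal (Y \<omega>) \<partial>M) = ennreal (\<integral>\<omega>. Y \<omega> \<partial>M)"
      by (intro nn_integral_eq_integral Y_int AE_I2) (simp add: Y_exp[symmetric])
    ultimately show ?thesis unfolding Y_exp by (simp add: ennreal_leI)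
  qed
  define R where "R = (\<lambda>n \<omega>. \<Sum>i<Suc n. t / real (Suc n) * V (X (real (Suc i) * (t / real (Suc n))) \<omega>))"
  have R_meas: "(\<lambda>\<omega>. ennreal (exp (R n \<omega>))) \<in> borel_measurable M" for n
  proof -
    have "(\<lambda>\<omega>. V (X r \<omega>)) \<in> borel_measurable M" if "0 \<le> r" for r
      by (rule measurable_compose[OF X_meas[OF that]]) simp
    then have "R n \<in> borel_measurable M"
      unfolding R_def using t by (intro borel_measurable_sum borel_measurable_times) auto
    then show ?thesis by simp
  qed
  have R_lim: "(\<lambda>n. R n \<omega>) \<longlonglongrightarrow> (LINT s:{0..t}|lborel. V (X s \<omega>))" if "\<omega> \<in> space M" for \<omega>
    unfolding R_def
  proof (rule riemann_sums_right_continuous[OF t V_bound])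
    fix s :: real assume "0 \<le> s"
    from jump[OF that this] show "((\<lambda>s. V (X s \<omega>)) \<longlongrightarrow> V (X s \<omega>)) (at_right s)"
      by (intro tendsto_eventually) (auto elim: eventually_mono)
  qed
  have "(\<integral>\<^sup>+ \<omega>. ennreal (exp (LINT s:{0..t}|lborel. V (X s \<omega>))) \<partial>M)
      = (\<integral>\<^sup>+ \<omega>. liminf (\<lambda>n. ennreal (exp (R n \<omega>))) \<partial>M)"
  proof (rule nn_integral_cong)
    fix \<omega> assume "\<omega> \<in> space M"
    then have "(\<lambda>n. ennreal (exp (R n \<omega>))) \<longlonglongrightarrow> ennreal (exp (LINT s:{0..t}|lborel. V (X s \<omega>)))"
      by (intro tendsto_ennrealI tendsto_exp R_lim)
    then show "ennreal (exp (LINT s:{0..t}|lborel. V (X s \<omega>))) = liminf (\<lambda>n. ennreal (exp (R n \<omega>)))"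
      by (intro lim_imp_Liminf[symmetric] sequentially_bot)
  qed
  \<comment> \<open>Fatou's lemma passes from the Riemann sums, whose bound does not depend on
    \<open>n\<close> once the steps are short, to the time integral.\<close>
  also have "\<dots> \<le> liminf (\<lambda>n. \<integral>\<^sup>+ \<omega>. ennreal (exp (R n \<omega>)) \<partial>M)"
    by (rule nn_integral_liminf[OF R_meas])
  also have "\<dots> \<le> limsup (\<lambda>n. \<integral>\<^sup>+ \<omega>. ennreal (exp (R n \<omega>)) \<partial>M)"
    by (rule Liminf_le_Limsup) simp
  also have "\<dots> \<le> ennreal (1 + \<theta>)"
  proof (rule Limsup_bounded)
    have "(\<lambda>n. t / real (Suc n)) \<longlonglongrightarrow> 0" using LIMSEQ_Suc[OF lim_const_over_n[of t]] by simp
    then have "eventually (\<lambda>n. t / real (Suc n) < h0) sequentially"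
      using h0 by (rule order_tendstoD)
    then show "eventually (\<lambda>n. (\<integral>\<^sup>+ \<omega>. ennreal (exp (R n \<omega>)) \<partial>M) \<le> ennreal (1 + \<theta>)) sequentially"
      unfolding R_def by eventually_elim (rule riemann[OF refl])
  qed
  finally show ?thesis by (simp add: \<theta>_def)
qed

section \<open>The Dirichlet form of the zero-range process\<close>

text \<open>The equilibrium density without its normalising constant: the form inequalities are
  homogeneous in the weight, so the constant appears only as the factor \<open>C\<close> in the
  initial law of \<open>feynman_kac_bound\<close>.\<close>

definition zr_weight :: "real \<Rightarrow> real \<Rightarrow> nat \<Rightarrow> real \<Rightarrow> (('d::finite \<Rightarrow> nat) \<Rightarrow> real) \<Rightarrow> real" where
  "zr_weight \<alpha> c N a \<eta> =
     (\<Prod>x\<in>torus N. (a / c) powr (\<alpha> * \<eta> x / c) / (fact (nat \<lfloor>\<eta> x / c\<rfloor>)) powr \<alpha>)"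

text \<open>The bound is on the total mass instead of the density, because taking out one particle
  then simply lowers it from \<open>m\<close> to \<open>m - c\<close>.\<close>

definition configs_total_le :: "real \<Rightarrow> nat \<Rightarrow> real \<Rightarrow> (('d::finite \<Rightarrow> nat) \<Rightarrow> real) set" where
  "configs_total_le c N m = {\<eta> \<in> configs c N. (\<Sum>x\<in>torus N. \<eta> x) \<le> m}"

lemma zr_weight_pos: "0 < a \<Longrightarrow> 0 < c \<Longrightarrow> 0 < zr_weight \<alpha> c N a \<eta>"
  unfolding zr_weight_def by (intro prod_pos) auto

section \<open>Adding and removing one particle\<close>

text \<open>Detailed balance in one-particle form. Passing from \<open>k\<close> to
  \<open>k + 1\<close> particles multiplies the factor at \<open>x\<close> by
  \<open>(a / c) powr \<alpha> / (k + 1) powr \<alpha>\<close>, while the new value has power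
  \<open>c powr \<alpha> * (k + 1) powr \<alpha>\<close>. The product of the two does not depend on
  \<open>x\<close>, which is reversibility.\<close>

lemma zr_weight_add_particle:
  assumes c: "0 < c" and a: "0 < a" and \<xi>: "\<xi> \<in> configs c N" and x: "x \<in> torus N"
  shows "zr_weight \<alpha> c N a (\<xi>(x := \<xi> x + c)) * (\<xi> x + c) powr \<alpha> = a powr \<alpha> * zr_weight \<alpha> c N a \<xi>"
proof -
  obtain k :: nat where k: "\<xi> x = c * real k" using \<xi> x by (auto simp: configs_def)
  have "(c * real k + c) / c = real (Suc k)" using c by (simp add: field_simps)
  then have fl: "nat \<lfloor>(c * real k + c) / c\<rfloor> = Suc k" by (metis floor_of_nat nat_int)
  have e: "\<alpha> * (c * real k + c) / c = \<alpha> * real k + \<alpha>" using c by (simp add: field_simps)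
  have "c * real k + c = c * real (Suc k)" by (simp add: algebra_simps)
  then have s: "(c * real k + c) powr \<alpha> = c powr \<alpha> * real (Suc k) powr \<alpha>"
    using c by (simp only: powr_mult)
  have f: "(fact (Suc k) :: real) powr \<alpha> = real (Suc k) powr \<alpha> * fact k powr \<alpha>"
    by (simp only: fact_Suc) (simp add: powr_mult)
  have rest: "(\<Prod>y\<in>torus N - {x}. (a / c) powr (\<alpha> * (\<xi>(x := \<xi> x + c)) y / c) / (fact (nat \<lfloor>(\<xi>(x := \<xi> x + c)) y / c\<rfloor>)) powr \<alpha>)
      = (\<Prod>y\<in>torus N - {x}. (a / c) powr (\<alpha> * \<xi> y / c) / (fact (nat \<lfloor>\<xi> y / c\<rfloor>)) powr \<alpha>)"
    by (intro prod.cong) auto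
  have ac: "a powr \<alpha> = (a / c) powr \<alpha> * c powr \<alpha>"
    using a c by (simp add: powr_divide)
  show ?thesis
    unfolding zr_weight_def prod.remove[OF finite_torus x] rest
    using c by (simp add: k fl e s f ac powr_add del: fact_Suc of_nat_Suc)
qed

lemma configs_nonneg: "0 < c \<Longrightarrow> \<eta> \<in> configs c N \<Longrightarrow> 0 \<le> \<eta> x"
  by (cases "x \<in> torus N") (fastforce simp: configs_def)+

lemma sum_add_particle:
  assumes "x \<in> torus N"
  shows "(\<Sum>z\<in>torus N. (\<xi>(x := \<xi> x + c)) z) = (\<Sum>z\<in>torus N. \<xi> z) + (c :: real)"
proof -
  have "(\<Sum>z\<in>torus N - {x}. (\<xi>(x := \<xi> x + c)) z) = (\<Sum>z\<in>torus N - {x}. \<xi> z)"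
    by (intro sum.cong) auto
  then show ?thesis by (simp add: sum.remove[OF finite_torus assms])
qed

lemma add_particle_in_configs:
  assumes "\<xi> \<in> configs c N" "x \<in> torus N"
  shows "\<xi>(x := \<xi> x + c) \<in> configs c N"
proof -
  obtain k :: nat where "\<xi> x = c * real k" using assms by (auto simp: configs_def)
  then have "\<xi> x + c = c * real (Suc k)" by (simp add: algebra_simps)
  then have "\<exists>k::nat. \<xi> x + c = c * real k" by blast
  then show ?thesis using assms by (auto simp: configs_def)
qed

lemma remove_particle_in_configs:
  assumes "\<eta> \<in> configs c N" "x \<in> torus N" "\<eta> x \<noteq> 0"
  shows "\<eta>(x := \<eta> x - c) \<in> configs c N"
proof -
  obtain k :: nat where k: "\<eta> x = c * real k" using assms by (auto simp: configs_def)
  then have "\<eta> x - c = c * real (k - 1)" using assms(3) by (cases k) (auto simp: algebra_simps)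
  then have "\<exists>k::nat. \<eta> x - c = c * real k" by blast
  then show ?thesis using assms by (auto simp: configs_def)
qed

lemma add_particle_in_total:
  "\<xi> \<in> configs_total_le c N (m - c) \<Longrightarrow> x \<in> torus N \<Longrightarrow> \<xi>(x := \<xi> x + c) \<in> configs_total_le c N m"
  using sum_add_particle[of x N \<xi> c] by (simp add: configs_total_le_def add_particle_in_configs)

lemma remove_particle_in_total:
  assumes "\<eta> \<in> configs_total_le c N m" "x \<in> torus N" "\<eta> x \<noteq> 0"
  shows "\<eta>(x := \<eta> x - c) \<in> configs_total_le c N (m - c)"
  using assms sum_add_particle[of x N \<eta> "- c"]
  by (simp add: configs_total_le_def remove_particle_in_configs)

lemma move_eq: "move c \<eta> x y = (\<eta>(x := \<eta> x - c))(y := (\<eta>(x := \<eta> x - c)) y + c)"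
  by (rule ext) (simp add: move_def)

lemma move_add_particle: "move c (\<xi>(x := \<xi> x + c)) x y = \<xi>(y := \<xi> y + c)"
  by (simp add: move_eq)

lemma move_in_configs:
  assumes "\<eta> \<in> configs c N" "x \<in> torus N" "y \<in> torus N" "\<eta> x \<noteq> 0"
  shows "move c \<eta> x y \<in> configs c N"
  unfolding move_eq by (intro add_particle_in_configs remove_particle_in_configs assms)

lemma sum_move:
  assumes "x \<in> torus N" "y \<in> torus N"
  shows "(\<Sum>z\<in>torus N. move c \<eta> x y z) = (\<Sum>z\<in>torus N. \<eta> z)"
  unfolding move_eq sum_add_particle[OF assms(2)]
  using sum_add_particle[OF assms(1), of \<eta> "- c"] by simp

lemma finite_configs_total_le:
  assumes "0 < c"
  shows "finite (configs_total_le c N m :: (('d::finite \<Rightarrow> nat) \<Rightarrow> real) set)"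
proof (rule finite_subset)
  let ?B = "(\<lambda>k. c * real k) ` {..nat \<lfloor>m / c\<rfloor>}"
  show "finite {\<eta> :: ('d \<Rightarrow> nat) \<Rightarrow> real. \<forall>x. (x \<in> torus N \<longrightarrow> \<eta> x \<in> ?B) \<and> (x \<notin> torus N \<longrightarrow> \<eta> x = 0)}"
    by (rule finite_set_of_finite_funs) auto
  show "configs_total_le c N m \<subseteq> {\<eta> :: ('d \<Rightarrow> nat) \<Rightarrow> real. \<forall>x. (x \<in> torus N \<longrightarrow> \<eta> x \<in> ?B) \<and> (x \<notin> torus N \<longrightarrow> \<eta> x = 0)}"
  proof (clarsimp simp: configs_total_le_def, intro conjI impI)
    fix \<eta> :: "('d \<Rightarrow> nat) \<Rightarrow> real" and x
    assume \<eta>: "\<eta> \<in> configs c N" and m: "(\<Sum>x\<in>torus N. \<eta> x) \<le> m"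
    show "\<eta> x = 0" if "x \<notin> torus N" using \<eta> that by (simp add: configs_def)
    assume x: "x \<in> torus N"
    then obtain k :: nat where k: "\<eta> x = c * real k" using \<eta> by (auto simp: configs_def)
    have "\<eta> x \<le> (\<Sum>x\<in>torus N. \<eta> x)"
      using x configs_nonneg[OF assms \<eta>] by (intro member_le_sum) auto
    with m k have "real k \<le> m / c" using assms by (simp add: field_simps)
    then have "k \<le> nat \<lfloor>m / c\<rfloor>" by (simp add: le_nat_floor)
    then show "\<eta> x \<in> ?B" using k by auto
  qed
qed

lemma configs_mass_le_eq:
  "0 < N \<Longrightarrow> configs_mass_le c N b = (configs_total_le c N (b * real N ^ CARD('d)) :: (('d::finite \<Rightarrow> nat) \<Rightarrow> real) set)"
  by (simp add: configs_mass_le_def configs_total_le_def pos_divide_le_eq)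

text \<open>Detailed balance as a change of variables that takes one particle away from
  \<open>x\<close>. Configurations with no particle at \<open>x\<close> have rate 0 and drop out. On
  the right the weight no longer knows where the particle was.\<close>

lemma sum_configs_shift_particle:
  fixes x :: "'d::finite \<Rightarrow> nat"
  assumes c: "0 < c" and a: "0 < a" and x: "x \<in> torus N"
  shows "(\<Sum>\<eta>\<in>configs_total_le c N m. zr_weight \<alpha> c N a \<eta> * \<eta> x powr \<alpha> * F \<eta>)
     = a powr \<alpha> * (\<Sum>\<xi>\<in>configs_total_le c N (m - c). zr_weight \<alpha> c N a \<xi> * F (\<xi>(x := \<xi> x + c)))"
proof -
  let ?A = "{\<eta> \<in> configs_total_le c N m. \<eta> x \<noteq> 0}"
  have "(\<Sum>\<eta>\<in>configs_total_le c N m. zr_weight \<alpha> c N a \<eta> * \<eta> x powr \<alpha> * F \<eta>)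
      = (\<Sum>\<eta>\<in>?A. zr_weight \<alpha> c N a \<eta> * \<eta> x powr \<alpha> * F \<eta>)"
    by (intro sum.mono_neutral_right finite_configs_total_le c) auto
  also have "\<dots> = (\<Sum>\<xi>\<in>configs_total_le c N (m - c). a powr \<alpha> * (zr_weight \<alpha> c N a \<xi> * F (\<xi>(x := \<xi> x + c))))"
  proof (rule sum.reindex_bij_witness[where i = "\<lambda>\<xi>. \<xi>(x := \<xi> x + c)" and j = "\<lambda>\<eta>. \<eta>(x := \<eta> x - c)"])
    fix \<eta> assume \<eta>: "\<eta> \<in> ?A"
    then show j: "\<eta>(x := \<eta> x - c) \<in> configs_total_le c N (m - c)"
      using x by (intro remove_particle_in_total) auto
    then have "\<eta>(x := \<eta> x - c) \<in> configs c N" by (simp add: configs_total_le_def)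
    from zr_weight_add_particle[OF c a this x, of \<alpha>]
    show "a powr \<alpha> * (zr_weight \<alpha> c N a (\<eta>(x := \<eta> x - c)) * F ((\<eta>(x := \<eta> x - c))(x := (\<eta>(x := \<eta> x - c)) x + c)))
        = zr_weight \<alpha> c N a \<eta> * \<eta> x powr \<alpha> * F \<eta>" by simp
  next
    fix \<xi> :: "('d \<Rightarrow> nat) \<Rightarrow> real" assume \<xi>: "\<xi> \<in> configs_total_le c N (m - c)"
    then have "0 \<le> \<xi> x" using configs_nonneg[OF c] by (auto simp: configs_total_le_def)
    then show "\<xi>(x := \<xi> x + c) \<in> ?A" using add_particle_in_total[OF \<xi> x] c by auto
  qed auto
  finally show ?thesis by (simp add: sum_distrib_left)
qed

section \<open>The Dirichlet form and the matrix of the generator\<close>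

text \<open>The bijection \<open>next_site\<close> matches each backward increment with the forward
  increment across the same edge, and the two products add up to minus the squared
  increment.\<close>

lemma torus_summation_by_parts:
  fixes v :: "('d::finite \<Rightarrow> nat) \<Rightarrow> real"
  assumes "0 < N"
  shows "(\<Sum>x\<in>torus N. \<Sum>i\<in>UNIV. v x * (v (next_site N i x) - v x) + v x * (v (prev_site N i x) - v x))
     = - torus_energy N v"
proof -
  have "(\<Sum>x\<in>torus N. v x * (v (prev_site N i x) - v x))
      = (\<Sum>x\<in>torus N. v (next_site N i x) * (v x - v (next_site N i x)))" for i
    by (subst sum.reindex_bij_betw[OF bij_betw_next_site[OF assms, of i], symmetric]) simp
  then have "(\<Sum>i\<in>UNIV. \<Sum>x\<in>torus N. v x * (v (next_site N i x) - v x) + v x * (v (prev_site N i x) - v x))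
      = (\<Sum>i\<in>UNIV. \<Sum>x\<in>torus N. - (v (next_site N i x) - v x)\<^sup>2)"
    unfolding sum.distrib by (simp add: power2_eq_square algebra_simps flip: sum.distrib)
  then show ?thesis
    unfolding torus_energy_def by (subst (1 2) sum.swap) (simp add: sum_negf)
qed

lemma sum_rotate: "(\<Sum>a\<in>A. \<Sum>b\<in>B. \<Sum>c\<in>C. f a b c) = (\<Sum>b\<in>B. \<Sum>c\<in>C. \<Sum>a\<in>A. f a b c)"
  by (subst sum.swap, intro sum.cong refl, rule sum.swap)

lemma zr_generator_alt:
  "zr_generator \<alpha> c N u \<eta> = 1 / (2 * c) * (\<Sum>x\<in>torus N. \<Sum>i\<in>UNIV. \<eta> x powr \<alpha> *
     ((u (move c \<eta> x (next_site N i x)) - u \<eta>) + (u (move c \<eta> x (prev_site N i x)) - u \<eta>)))"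
  unfolding zr_generator_def sum_distrib_left
  by (intro sum.cong refl) (simp add: algebra_simps add_divide_distrib diff_divide_distrib)

text \<open>After \<open>sum_configs_shift_particle\<close> the moving particle is separated from a
  frozen environment \<xi>. In its position the dynamics is a simple random walk on the torus, so
  the form is an average over environments of torus energies. Moving particle comparisons thereby
  become statements about functions of one site.\<close>

lemma zr_dirichlet_form:
  assumes c: "0 < c" and a: "0 < a" and N: "0 < N"
  shows "(\<Sum>\<eta>\<in>configs_total_le c N m. zr_weight \<alpha> c N a \<eta> * u \<eta> * zr_generator \<alpha> c N u \<eta>)
     = - (a powr \<alpha> / (2 * c)) * (\<Sum>\<xi>\<in>configs_total_le c N (m - c).
          zr_weight \<alpha> c N a \<xi> * torus_energy N (\<lambda>x. u (\<xi>(x := \<xi> x + c))))"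
proof -
  let ?w = "zr_weight \<alpha> c N a" and ?A = "configs_total_le c N m" and ?A' = "configs_total_le c N (m - c)"
  define D where "D = (\<lambda>x i \<eta>. u \<eta> * (u (move c \<eta> x (next_site N i x)) - u \<eta>) + u \<eta> * (u (move c \<eta> x (prev_site N i x)) - u \<eta>))"
  have "(\<Sum>\<eta>\<in>?A. ?w \<eta> * u \<eta> * zr_generator \<alpha> c N u \<eta>)
      = (\<Sum>\<eta>\<in>?A. 1 / (2 * c) * (\<Sum>x\<in>torus N. \<Sum>i\<in>UNIV. ?w \<eta> * \<eta> x powr \<alpha> * D x i \<eta>))"
    unfolding zr_generator_alt D_def sum_distrib_left
    by (intro sum.cong refl) (simp add: algebra_simps)
  also have "\<dots> = 1 / (2 * c) * (\<Sum>x\<in>torus N. \<Sum>i\<in>UNIV. \<Sum>\<eta>\<in>?A. ?w \<eta> * \<eta> x powr \<alpha> * D x i \<eta>)"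
    by (subst sum_rotate[symmetric]) (simp only: sum_distrib_left)
  also have "\<dots> = 1 / (2 * c) * (\<Sum>x\<in>torus N. \<Sum>i\<in>UNIV. a powr \<alpha> * (\<Sum>\<xi>\<in>?A'. ?w \<xi> * D x i (\<xi>(x := \<xi> x + c))))"
    by (simp add: sum_configs_shift_particle[OF c a])
  also have "\<dots> = a powr \<alpha> / (2 * c) * (\<Sum>\<xi>\<in>?A'. ?w \<xi> * (\<Sum>x\<in>torus N. \<Sum>i\<in>UNIV. D x i (\<xi>(x := \<xi> x + c))))"
    unfolding sum_distrib_left by (subst sum_rotate[symmetric]) (simp add: mult_ac)
  also have "\<dots> = a powr \<alpha> / (2 * c) * (\<Sum>\<xi>\<in>?A'. ?w \<xi> * - torus_energy N (\<lambda>x. u (\<xi>(x := \<xi> x + c))))"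
  proof -
    have "(\<Sum>x\<in>torus N. \<Sum>i\<in>UNIV. D x i (\<xi>(x := \<xi> x + c))) = - torus_energy N (\<lambda>x. u (\<xi>(x := \<xi> x + c)))" for \<xi>
      unfolding D_def move_add_particle
      by (rule torus_summation_by_parts[OF N, of "\<lambda>x. u (\<xi>(x := \<xi> x + c))"])
    then show ?thesis by simp
  qed
  finally show ?thesis by (simp add: sum_negf)
qed

lemma zr_generator_indicator_eq_0:
  assumes "\<eta> \<in> B" "\<And>x y. x \<in> torus N \<Longrightarrow> y \<in> torus N \<Longrightarrow> \<eta> x \<noteq> 0 \<Longrightarrow> move c \<eta> x y \<in> B"
  shows "zr_generator \<alpha> c N (indicator B) \<eta> = 0"
proof -
  have van: "\<eta> x powr \<alpha> * ((indicator B (move c \<eta> x y) - indicator B \<eta>) + (indicator B (move c \<eta> x z) - indicator B \<eta>)) = (0 :: real)"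
    if "x \<in> torus N" "y \<in> torus N" "z \<in> torus N" for x y z
    using assms(1) assms(2)[of x y] assms(2)[of x z] that by (cases "\<eta> x = 0") auto
  show ?thesis
    unfolding zr_generator_alt by (subst sum.neutral, intro ballI sum.neutral van) auto
qed

text \<open>Matrix form of the generator on a set closed under the admissible moves. Moves from an
  empty site may leave the set, but their rate \<open>0 powr \<alpha>\<close> is 0.\<close>

lemma zr_generator_expand:
  assumes A: "finite A" "\<eta> \<in> A" "\<And>x y. x \<in> torus N \<Longrightarrow> y \<in> torus N \<Longrightarrow> \<eta> x \<noteq> 0 \<Longrightarrow> move c \<eta> x y \<in> A"
  shows "(\<Sum>\<zeta>\<in>A. zr_generator \<alpha> c N (indicator {\<zeta>}) \<eta> * u \<zeta>) = zr_generator \<alpha> c N u \<eta>"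
proof -
  have pick: "(\<Sum>\<zeta>\<in>A. indicator {\<zeta>} \<zeta>' * u \<zeta>) = u \<zeta>'" if "\<zeta>' \<in> A" for \<zeta>'
    using that A(1) by (simp add: indicator_def of_bool_def if_distrib[of "\<lambda>r. r * _"] cong: if_cong)
  have site: "(\<Sum>\<zeta>\<in>A. \<eta> x powr \<alpha> * ((indicator {\<zeta>} (move c \<eta> x y) - indicator {\<zeta>} \<eta>) + (indicator {\<zeta>} (move c \<eta> x z) - indicator {\<zeta>} \<eta>)) * u \<zeta>)
      = \<eta> x powr \<alpha> * ((u (move c \<eta> x y) - u \<eta>) + (u (move c \<eta> x z) - u \<eta>))"
    if "x \<in> torus N" "y \<in> torus N" "z \<in> torus N" for x y z
  proof (cases "\<eta> x = 0")
    case False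
    then have "move c \<eta> x y \<in> A" "move c \<eta> x z \<in> A" using that by (auto intro: A(3))
    then show ?thesis
      by (simp only: mult.assoc distrib_right left_diff_distrib sum_distrib_left[symmetric] sum.distrib sum_subtractf pick A(2))
  qed simp
  have "(\<Sum>\<zeta>\<in>A. zr_generator \<alpha> c N (indicator {\<zeta>}) \<eta> * u \<zeta>)
      = (\<Sum>\<zeta>\<in>A. 1 / (2 * c) * (\<Sum>x\<in>torus N. \<Sum>i\<in>UNIV. \<eta> x powr \<alpha> *
          ((indicator {\<zeta>} (move c \<eta> x (next_site N i x)) - indicator {\<zeta>} \<eta>)
         + (indicator {\<zeta>} (move c \<eta> x (prev_site N i x)) - indicator {\<zeta>} \<eta>)) * u \<zeta>))"
    unfolding zr_generator_alt by (simp only: sum_distrib_right mult.assoc)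
  also have "\<dots> = 1 / (2 * c) * (\<Sum>x\<in>torus N. \<Sum>i\<in>UNIV. \<Sum>\<zeta>\<in>A. \<eta> x powr \<alpha> *
          ((indicator {\<zeta>} (move c \<eta> x (next_site N i x)) - indicator {\<zeta>} \<eta>)
         + (indicator {\<zeta>} (move c \<eta> x (prev_site N i x)) - indicator {\<zeta>} \<eta>)) * u \<zeta>)"
    by (subst sum_rotate[symmetric]) (simp only: sum_distrib_left)
  also have "\<dots> = zr_generator \<alpha> c N u \<eta>"
    unfolding zr_generator_alt
    by (intro arg_cong[where f = "\<lambda>r. 1 / (2 * c) * r"] sum.cong refl site) auto
  finally show ?thesis .
qed

section \<open>Spectral bound and Orlicz norm\<close>

text \<open>This is the pointwise bound by the supersolution \<open>1 / sqrt zr_weight\<close> for the process that jumps directly between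
  \<open>x\<close> and \<open>y\<close>: Young's inequality is applied with the ratio of the values of that function at the two ends of a jump.\<close>

lemma pair_gradient_lower_bound:
  fixes x y :: "'d::finite \<Rightarrow> nat"
  assumes c: "0 < c" and a: "0 < a" and x: "x \<in> torus N" and y: "y \<in> torus N" and \<epsilon>: "0 \<le> \<epsilon>"
    and inc: "\<And>s. 0 \<le> s \<Longrightarrow> (s + c) powr (\<alpha> / 2) \<le> s powr (\<alpha> / 2) + \<epsilon> * (1 + s powr (\<alpha> / 2))"
  defines "h \<equiv> \<lambda>\<eta> z. \<eta> z powr (\<alpha> / 2)"
  shows "(\<Sum>\<eta>\<in>configs_total_le c N m. zr_weight \<alpha> c N a \<eta> * (u \<eta>)\<^sup>2 *
           ((h \<eta> y - h \<eta> x)\<^sup>2 - 2 * \<epsilon> * (1 + (h \<eta> x)\<^sup>2 + (h \<eta> y)\<^sup>2)))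
     \<le> a powr \<alpha> * (\<Sum>\<xi>\<in>configs_total_le c N (m - c).
          zr_weight \<alpha> c N a \<xi> * (u (\<xi>(y := \<xi> y + c)) - u (\<xi>(x := \<xi> x + c)))\<^sup>2)"
proof (cases "x = y")
  case True
  have "zr_weight \<alpha> c N a \<eta> * (u \<eta>)\<^sup>2 * ((h \<eta> y - h \<eta> x)\<^sup>2 - 2 * \<epsilon> * (1 + (h \<eta> x)\<^sup>2 + (h \<eta> y)\<^sup>2)) \<le> 0" for \<eta>
    using zr_weight_pos[OF a c, of \<alpha> N \<eta>] \<epsilon> True by (intro mult_nonneg_nonpos) auto
  then show ?thesis using True by (auto intro!: sum_nonpos)
next
  case False
  let ?w = "zr_weight \<alpha> c N a" and ?A = "configs_total_le c N m" and ?A' = "configs_total_le c N (m - c)"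
  define H where "H = (\<lambda>\<xi> z. ((\<xi> :: ('d \<Rightarrow> nat) \<Rightarrow> real) z + c) powr (\<alpha> / 2))"
  define r where "r = (\<lambda>x y \<eta>. (u \<eta>)\<^sup>2 * (1 - H \<eta> y / h \<eta> x))"
  \<comment> \<open>Here \<eta> is \<xi> with one more particle at \<open>x\<close>:
    \<open>H \<xi> x\<close> becomes \<open>h \<eta> x\<close>, while site \<open>y\<close> is
    untouched because \<open>x \<noteq> y\<close>. If \<open>h \<eta> x = 0\<close>, the quotient in
    \<open>r\<close> has the default value 0 and the rate vanishes too.\<close>
  have reindex: "(\<Sum>\<xi>\<in>?A'. ?w \<xi> * ((u (\<xi>(x := \<xi> x + c)))\<^sup>2 * (1 - H \<xi> y / H \<xi> x))) * a powr \<alpha>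
      = (\<Sum>\<eta>\<in>?A. ?w \<eta> * (u \<eta>)\<^sup>2 * ((h \<eta> x)\<^sup>2 - h \<eta> x * H \<eta> y))"
    if x: "x \<in> torus N" and "x \<noteq> y" for x y
  proof -
    have "(\<Sum>\<eta>\<in>?A. ?w \<eta> * (u \<eta>)\<^sup>2 * ((h \<eta> x)\<^sup>2 - h \<eta> x * H \<eta> y)) = (\<Sum>\<eta>\<in>?A. ?w \<eta> * \<eta> x powr \<alpha> * r x y \<eta>)"
    proof (intro sum.cong refl)
      fix \<eta> :: "('d \<Rightarrow> nat) \<Rightarrow> real"
      have "\<eta> x powr \<alpha> = h \<eta> x * h \<eta> x" by (simp add: h_def flip: powr_add)
      then show "?w \<eta> * (u \<eta>)\<^sup>2 * ((h \<eta> x)\<^sup>2 - h \<eta> x * H \<eta> y) = ?w \<eta> * \<eta> x powr \<alpha> * r x y \<eta>"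
        by (cases "h \<eta> x = 0") (auto simp: r_def power2_eq_square field_simps)
    qed
    also have "\<dots> = a powr \<alpha> * (\<Sum>\<xi>\<in>?A'. ?w \<xi> * r x y (\<xi>(x := \<xi> x + c)))"
      by (rule sum_configs_shift_particle[OF c a x])
    finally show ?thesis using \<open>x \<noteq> y\<close> by (simp add: r_def H_def h_def mult_ac)
  qed
  \<comment> \<open>By \<open>zr_weight_add_particle\<close>, \<open>1 / sqrt zr_weight\<close> at
    \<xi> with a particle added at \<open>x\<close> is proportional to \<open>H \<xi> x\<close>;
    hence the ratios. The two sides differ by the square
    \<open>(p * Y - q * X)\<^sup>2 / (X * Y)\<close>.\<close>
  have young: "(u (\<xi>(x := \<xi> x + c)))\<^sup>2 * (1 - H \<xi> y / H \<xi> x) + (u (\<xi>(y := \<xi> y + c)))\<^sup>2 * (1 - H \<xi> x / H \<xi> y)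
      \<le> (u (\<xi>(y := \<xi> y + c)) - u (\<xi>(x := \<xi> x + c)))\<^sup>2" if "\<xi> \<in> ?A'" for \<xi>
  proof -
    have "0 \<le> \<xi> x" "0 \<le> \<xi> y" using that configs_nonneg[OF c] by (auto simp: configs_total_le_def)
    then have pos: "0 < H \<xi> x" "0 < H \<xi> y" using c by (auto simp: H_def)
    define p q X Y where "p = u (\<xi>(x := \<xi> x + c))" and "q = u (\<xi>(y := \<xi> y + c))" and "X = H \<xi> x" and "Y = H \<xi> y"
    have "0 < X" "0 < Y" using pos by (auto simp: X_def Y_def)
    moreover have "0 \<le> (p * Y - q * X)\<^sup>2 / (X * Y)" using \<open>0 < X\<close> \<open>0 < Y\<close> by simp
    ultimately have "p\<^sup>2 * (1 - Y / X) + q\<^sup>2 * (1 - X / Y) \<le> (q - p)\<^sup>2"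
      by (simp add: field_simps power2_eq_square)
    then show ?thesis by (simp add: p_def q_def X_def Y_def)
  qed
  \<comment> \<open>With \<open>h\<close> in place of \<open>H\<close> the bracket on the right
    would be exactly the squared difference. \<open>H\<close> carries an extra particle, and
    \<open>inc\<close> prices it at \<open>\<epsilon> * (p + q + 2 * (p * q))\<close>.\<close>
  have "(\<Sum>\<eta>\<in>?A. ?w \<eta> * (u \<eta>)\<^sup>2 * ((h \<eta> y - h \<eta> x)\<^sup>2 - 2 * \<epsilon> * (1 + (h \<eta> x)\<^sup>2 + (h \<eta> y)\<^sup>2)))
      \<le> (\<Sum>\<eta>\<in>?A. ?w \<eta> * (u \<eta>)\<^sup>2 * (((h \<eta> x)\<^sup>2 - h \<eta> x * H \<eta> y) + ((h \<eta> y)\<^sup>2 - h \<eta> y * H \<eta> x)))"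
  proof (rule sum_mono)
    fix \<eta> :: "('d \<Rightarrow> nat) \<Rightarrow> real" assume "\<eta> \<in> ?A"
    then have nn: "0 \<le> \<eta> z" for z using configs_nonneg[OF c] by (auto simp: configs_total_le_def)
    define p q where "p = h \<eta> x" and "q = h \<eta> y"
    have p: "0 \<le> p" "0 \<le> q" by (auto simp: p_def q_def h_def)
    have "p * H \<eta> y \<le> p * (q + \<epsilon> * (1 + q))" "q * H \<eta> x \<le> q * (p + \<epsilon> * (1 + p))"
      using inc[OF nn] p by (auto simp: p_def q_def H_def h_def intro!: mult_left_mono)
    moreover have "\<epsilon> * (p + q + 2 * (p * q)) \<le> \<epsilon> * (2 * (1 + p\<^sup>2 + q\<^sup>2))"
    proof (intro mult_left_mono \<epsilon>)
      have "0 \<le> (p - 1)\<^sup>2" "0 \<le> (q - 1)\<^sup>2" "0 \<le> (p - q)\<^sup>2" by auto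
      then show "p + q + 2 * (p * q) \<le> 2 * (1 + p\<^sup>2 + q\<^sup>2)"
        using p by (simp add: power2_eq_square algebra_simps)
    qed
    ultimately have "(q - p)\<^sup>2 - 2 * \<epsilon> * (1 + p\<^sup>2 + q\<^sup>2) \<le> (p\<^sup>2 - p * H \<eta> y) + (q\<^sup>2 - q * H \<eta> x)"
      by (simp add: power2_eq_square algebra_simps)
    then show "?w \<eta> * (u \<eta>)\<^sup>2 * ((h \<eta> y - h \<eta> x)\<^sup>2 - 2 * \<epsilon> * (1 + (h \<eta> x)\<^sup>2 + (h \<eta> y)\<^sup>2))
        \<le> ?w \<eta> * (u \<eta>)\<^sup>2 * (((h \<eta> x)\<^sup>2 - h \<eta> x * H \<eta> y) + ((h \<eta> y)\<^sup>2 - h \<eta> y * H \<eta> x))"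
      using zr_weight_pos[OF a c, of \<alpha> N \<eta>] unfolding p_def q_def
      by (intro mult_left_mono) (auto simp: less_imp_le)
  qed
  also have "\<dots> = a powr \<alpha> * (\<Sum>\<xi>\<in>?A'. ?w \<xi> * ((u (\<xi>(x := \<xi> x + c)))\<^sup>2 * (1 - H \<xi> y / H \<xi> x)
      + (u (\<xi>(y := \<xi> y + c)))\<^sup>2 * (1 - H \<xi> x / H \<xi> y)))"
    unfolding distrib_left sum.distrib
    using reindex[OF x False] reindex[OF y False[symmetric]] by (simp only: mult.commute)
  also have "\<dots> \<le> a powr \<alpha> * (\<Sum>\<xi>\<in>?A'. ?w \<xi> * (u (\<xi>(y := \<xi> y + c)) - u (\<xi>(x := \<xi> x + c)))\<^sup>2)"
    using young by (intro mult_left_mono sum_mono) (auto intro: less_imp_le[OF zr_weight_pos[OF a c]])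
  finally show ?thesis .
qed

text \<open>The pair bound is averaged over all pairs of a site and its shift. Shifts permute the
  torus, so both end points contribute the same sum of squares, hence the inner factor 2.\<close>

lemma mean_osc_lower_bound:
  assumes c: "0 < c" and a: "0 < a" and n: "0 < n" "n \<le> N" and \<epsilon>: "0 \<le> \<epsilon>"
    and inc: "\<And>s. 0 \<le> s \<Longrightarrow> (s + c) powr (\<alpha> / 2) \<le> s powr (\<alpha> / 2) + \<epsilon> * (1 + s powr (\<alpha> / 2))"
  defines "h \<equiv> \<lambda>(\<eta> :: ('d::finite \<Rightarrow> nat) \<Rightarrow> real) z. \<eta> z powr (\<alpha> / 2)"
  shows "(\<Sum>\<eta>\<in>configs_total_le c N m. zr_weight \<alpha> c N a \<eta> * (u \<eta>)\<^sup>2 *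
           (mean_osc N n (h \<eta>) - 2 * \<epsilon> * (real N ^ CARD('d) + 2 * (\<Sum>x\<in>torus N. (h \<eta> x)\<^sup>2))))
     \<le> a powr \<alpha> * (\<Sum>\<xi>\<in>configs_total_le c N (m - c).
          zr_weight \<alpha> c N a \<xi> * mean_osc N n (\<lambda>x. u (\<xi>(x := \<xi> x + c))))"
proof -
  let ?w = "zr_weight \<alpha> c N a" and ?A = "configs_total_le c N m" and ?A' = "configs_total_le c N (m - c)"
  let ?\<tau> = "torus_shift N"
  define P where "P = (\<lambda>\<eta> x y. (h \<eta> y - h \<eta> x)\<^sup>2 - 2 * \<epsilon> * (1 + (h \<eta> x)\<^sup>2 + (h \<eta> y)\<^sup>2))"
  have N: "0 < N" using n by simp
  have nd: "0 < real n ^ CARD('d)" using n by simp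
  have osc: "mean_osc N n (h \<eta>) - 2 * \<epsilon> * (real N ^ CARD('d) + 2 * (\<Sum>x\<in>torus N. (h \<eta> x)\<^sup>2))
      = (\<Sum>z\<in>torus n. \<Sum>x\<in>torus N. P \<eta> x (?\<tau> z x)) / real n ^ CARD('d)" for \<eta>
  proof -
    have "(\<Sum>x\<in>torus N. (h \<eta> (?\<tau> z x))\<^sup>2) = (\<Sum>x\<in>torus N. (h \<eta> x)\<^sup>2)" for z
      by (rule sum.reindex_bij_betw[OF bij_betw_shift[OF N]])
    then have "(\<Sum>x\<in>torus N. P \<eta> x (?\<tau> z x))
        = (\<Sum>x\<in>torus N. (h \<eta> (?\<tau> z x) - h \<eta> x)\<^sup>2) - 2 * \<epsilon> * (real N ^ CARD('d) + 2 * (\<Sum>x\<in>torus N. (h \<eta> x)\<^sup>2))" for z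
      by (simp add: P_def sum_subtractf sum.distrib flip: sum_distrib_left)
    then show ?thesis
      using nd by (simp add: mean_osc_def sum_subtractf diff_divide_distrib)
  qed
  have pull: "(\<Sum>\<zeta>\<in>B. g \<zeta> * ((\<Sum>z\<in>torus n. \<Sum>x\<in>torus N. f \<zeta> z x) / real n ^ CARD('d)))
      = (\<Sum>z\<in>torus n. \<Sum>x\<in>torus N. \<Sum>\<zeta>\<in>B. g \<zeta> * f \<zeta> z x) / real n ^ CARD('d)"
    for B :: "(('d \<Rightarrow> nat) \<Rightarrow> real) set" and g :: "(('d \<Rightarrow> nat) \<Rightarrow> real) \<Rightarrow> real" and f
    by (subst sum_rotate[symmetric]) (simp add: sum_distrib_left sum_divide_distrib)
  have "(\<Sum>\<eta>\<in>?A. ?w \<eta> * (u \<eta>)\<^sup>2 *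
           (mean_osc N n (h \<eta>) - 2 * \<epsilon> * (real N ^ CARD('d) + 2 * (\<Sum>x\<in>torus N. (h \<eta> x)\<^sup>2))))
      = (\<Sum>z\<in>torus n. \<Sum>x\<in>torus N. \<Sum>\<eta>\<in>?A. ?w \<eta> * (u \<eta>)\<^sup>2 * P \<eta> x (?\<tau> z x)) / real n ^ CARD('d)"
    unfolding osc by (rule pull)
  also have "\<dots> \<le> (\<Sum>z\<in>torus n. \<Sum>x\<in>torus N. a powr \<alpha> * (\<Sum>\<xi>\<in>?A'. ?w \<xi> *
      (u (\<xi>(?\<tau> z x := \<xi> (?\<tau> z x) + c)) - u (\<xi>(x := \<xi> x + c)))\<^sup>2)) / real n ^ CARD('d)"
    unfolding P_def h_def using nd N
    by (intro divide_right_mono sum_mono pair_gradient_lower_bound c a \<epsilon> inc) auto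
  also have "\<dots> = a powr \<alpha> * (\<Sum>\<xi>\<in>?A'. ?w \<xi> * mean_osc N n (\<lambda>x. u (\<xi>(x := \<xi> x + c))))"
    unfolding mean_osc_def by (subst pull) (simp add: sum_distrib_left)
  finally show ?thesis .
qed

lemma sum_power_le_geometric:
  fixes r :: real
  assumes "0 \<le> r" "r < 1" "finite J"
  shows "(\<Sum>j\<in>J. r ^ j) \<le> 1 / (1 - r)"
  using sum_le_suminf[OF summable_geometric, of r J] assms by (simp add: suminf_geometric)

text \<open>On the energy side, level \<open>j\<close> costs at most the fraction
  \<open>(1 / 4) ^ j\<close> of the cost at full scale, and the geometric series is at most 2. On
  the other side the errors add up to at most \<open>1 / 32\<close> times \<open>N ^ d\<close> plus
  twice the sum of squares. That sum is at most a multiple of \<open>N ^ d\<close> plus 8 times the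
  oscillation, so half of the oscillation survives; this fixes the exponent
  \<open>j + 7\<close>.\<close>

lemma spectral_lower_bound:
  fixes u :: "(('d::finite \<Rightarrow> nat) \<Rightarrow> real) \<Rightarrow> real"
  assumes c: "0 < c" and a: "0 < a" and b: "0 < b" and \<alpha>: "0 < \<alpha>" and J: "finite J" "0 \<in> J"
    and JN: "\<And>j. j \<in> J \<Longrightarrow> 2 ^ j \<le> N"
    and inc: "\<And>j s. j \<in> J \<Longrightarrow> 0 \<le> s \<Longrightarrow> (s + c) powr (\<alpha> / 2) \<le> s powr (\<alpha> / 2) + 1 / 2 ^ (j + 7) * (1 + s powr (\<alpha> / 2))"
  defines "m \<equiv> b * real N ^ CARD('d)" and "T \<equiv> (1 + 8 * (2 * b * 2 ^ CARD('d)) powr \<alpha>) / 32"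
  shows "(\<Sum>\<eta>\<in>configs_total_le c N m. zr_weight \<alpha> c N a \<eta> * (u \<eta>)\<^sup>2 *
            ((\<Sum>j\<in>J. mean_osc N (N div 2 ^ j) (\<lambda>x. \<eta> x powr (\<alpha> / 2))) / 2 - real N ^ CARD('d) * T))
     \<le> 2 * (real CARD('d) * real N)\<^sup>2 * a powr \<alpha> * (\<Sum>\<xi>\<in>configs_total_le c N (m - c).
          zr_weight \<alpha> c N a \<xi> * torus_energy N (\<lambda>x. u (\<xi>(x := \<xi> x + c))))"
proof -
  let ?w = "zr_weight \<alpha> c N a" and ?A = "configs_total_le c N m :: (('d \<Rightarrow> nat) \<Rightarrow> real) set"
    and ?A' = "configs_total_le c N (m - c)"
  let ?n = "\<lambda>j. N div 2 ^ j"
  define h where "h = (\<lambda>(\<eta> :: ('d \<Rightarrow> nat) \<Rightarrow> real) z. \<eta> z powr (\<alpha> / 2))"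
  define Osc where "Osc = (\<lambda>\<eta>. \<Sum>j\<in>J. mean_osc N (?n j) (h \<eta>))"
  have n: "0 < ?n j" "?n j \<le> N" if "j \<in> J" for j
    using JN[OF that] by (auto simp: div_greater_zero_iff)
  have w: "0 \<le> ?w \<eta>" for \<eta> :: "('d \<Rightarrow> nat) \<Rightarrow> real" using zr_weight_pos[OF a c, of \<alpha> N \<eta>] by simp
  have lower: "Osc \<eta> / 2 - real N ^ CARD('d) * T
      \<le> (\<Sum>j\<in>J. mean_osc N (?n j) (h \<eta>) - 2 * (1 / 2 ^ (j + 7)) * (real N ^ CARD('d) + 2 * (\<Sum>x\<in>torus N. (h \<eta> x)\<^sup>2)))"
    if \<eta>: "\<eta> \<in> ?A" for \<eta>
  proof -
    define I where "I = (\<Sum>x\<in>torus N. (h \<eta> x)\<^sup>2)"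
    define T0 where "T0 = 4 * (2 * b * (2 ^ (0 + 1)) ^ CARD('d)) powr \<alpha>"
    have nn: "0 \<le> \<eta> x" for x using \<eta> configs_nonneg[OF c] by (auto simp: configs_total_le_def)
    have h2: "(h \<eta> x)\<^sup>2 = \<eta> x powr \<alpha>" for x by (simp add: h_def power2_eq_square flip: powr_add)
    \<comment> \<open>Sites below the level 0 threshold contribute at most \<open>T0\<close> each;
      for the others the tail bound is used with the whole torus as box.\<close>
    have "I \<le> (\<Sum>x\<in>torus N. T0 + (if T0 < \<eta> x powr \<alpha> then \<eta> x powr \<alpha> else 0))"
      unfolding I_def h2 by (intro sum_mono) (auto simp: T0_def)
    also have "\<dots> \<le> real N ^ CARD('d) * T0 + 8 * mean_osc N (?n 0) (h \<eta>)"
      unfolding T0_def h_def using block_tail_le_mean_osc[OF JN[OF J(2)] \<alpha> b, of \<eta>] nn \<eta>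
      by (simp add: sum.distrib configs_total_le_def m_def)
    also have "mean_osc N (?n 0) (h \<eta>) \<le> Osc \<eta>"
      unfolding Osc_def using J by (intro member_le_sum) (auto simp: mean_osc_nonneg)
    finally have I: "I \<le> real N ^ CARD('d) * T0 + 8 * Osc \<eta>" by simp
    have "(\<Sum>j\<in>J. (1 / 2 :: real) ^ j) \<le> 2" using sum_power_le_geometric[of "1 / 2" J] J by simp
    then have "(\<Sum>j\<in>J. (1 / 2 :: real) ^ j) * ((real N ^ CARD('d) + 2 * I) / 64) \<le> 2 * ((real N ^ CARD('d) + 2 * I) / 64)"
      by (intro mult_right_mono) (auto simp: I_def sum_nonneg)
    also have "\<dots> \<le> real N ^ CARD('d) * (1 + 2 * T0) / 32 + Osc \<eta> / 2"
    proof -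
      have "2 * ((z + 2 * i) / 64) \<le> z * (1 + 2 * r) / 32 + q / 2" if "i \<le> z * r + 8 * q" for z i r q :: real
        using that by (simp add: field_simps)
      then show ?thesis using I by blast
    qed
    also have "real N ^ CARD('d) * (1 + 2 * T0) / 32 = real N ^ CARD('d) * T"
      by (simp add: T_def T0_def mult_ac)
    finally have "(\<Sum>j\<in>J. (1 / 2 :: real) ^ j) * ((real N ^ CARD('d) + 2 * I) / 64) \<le> real N ^ CARD('d) * T + Osc \<eta> / 2" .
    moreover have "(\<Sum>j\<in>J. 2 * (1 / 2 ^ (j + 7)) * (real N ^ CARD('d) + 2 * I))
        = (\<Sum>j\<in>J. (1 / 2 :: real) ^ j) * ((real N ^ CARD('d) + 2 * I) / 64)"
      unfolding sum_distrib_right by (intro sum.cong refl) (simp add: power_add power_divide)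
    ultimately have "Osc \<eta> / 2 - real N ^ CARD('d) * T \<le> Osc \<eta> - (\<Sum>j\<in>J. 2 * (1 / 2 ^ (j + 7)) * (real N ^ CARD('d) + 2 * I))"
      by linarith
    then show ?thesis
      unfolding sum_subtractf I_def[symmetric] by (simp only: Osc_def)
  qed
  have upper: "(\<Sum>j\<in>J. mean_osc N (?n j) v) \<le> 2 * (real CARD('d) * real N)\<^sup>2 * torus_energy N v"
    for v :: "('d \<Rightarrow> nat) \<Rightarrow> real"
  proof -
    have "mean_osc N (?n j) v \<le> (1 / 4) ^ j * ((real CARD('d) * real N)\<^sup>2 * torus_energy N v)" if j: "j \<in> J" for j
    proof -
      have "real (?n j) \<le> real N / 2 ^ j"
        using of_nat_div_le_of_nat[of N "2 ^ j", where 'a = real] by simp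
      then have "(real CARD('d) * real (?n j))\<^sup>2 \<le> (real CARD('d) * (real N / 2 ^ j))\<^sup>2"
        by (intro power_mono mult_left_mono) auto
      also have "\<dots> = (1 / 4) ^ j * (real CARD('d) * real N)\<^sup>2"
      proof -
        have "(2 ^ j)\<^sup>2 = (4 :: real) ^ j" using power_commutes by (metis power2_eq_square power_mult_distrib num_double numeral_times_numeral)
        then show ?thesis by (simp add: power_mult_distrib power_divide)
      qed
      finally have "(real CARD('d) * real (?n j))\<^sup>2 * torus_energy N v
          \<le> (1 / 4) ^ j * (real CARD('d) * real N)\<^sup>2 * torus_energy N v"
        by (intro mult_right_mono torus_energy_nonneg)
      with mean_osc_le_energy[OF n[OF j], of v] show ?thesis by (simp add: mult.assoc)
    qed
    then have "(\<Sum>j\<in>J. mean_osc N (?n j) v) \<le> (\<Sum>j\<in>J. (1 / 4) ^ j) * ((real CARD('d) * real N)\<^sup>2 * torus_energy N v)"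
      unfolding sum_distrib_right by (rule sum_mono)
    also have "\<dots> \<le> 2 * ((real CARD('d) * real N)\<^sup>2 * torus_energy N v)"
      using sum_power_le_geometric[of "1 / 4" J] J torus_energy_nonneg[of N v] by (intro mult_right_mono) auto
    finally show ?thesis by (simp add: mult.assoc)
  qed
  have "(\<Sum>\<eta>\<in>?A. ?w \<eta> * (u \<eta>)\<^sup>2 * (Osc \<eta> / 2 - real N ^ CARD('d) * T))
      \<le> (\<Sum>\<eta>\<in>?A. ?w \<eta> * (u \<eta>)\<^sup>2 * (\<Sum>j\<in>J. mean_osc N (?n j) (h \<eta>)
          - 2 * (1 / 2 ^ (j + 7)) * (real N ^ CARD('d) + 2 * (\<Sum>x\<in>torus N. (h \<eta> x)\<^sup>2))))"
    using w by (intro sum_mono mult_left_mono lower) auto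
  also have "\<dots> = (\<Sum>j\<in>J. \<Sum>\<eta>\<in>?A. ?w \<eta> * (u \<eta>)\<^sup>2 * (mean_osc N (?n j) (h \<eta>)
          - 2 * (1 / 2 ^ (j + 7)) * (real N ^ CARD('d) + 2 * (\<Sum>x\<in>torus N. (h \<eta> x)\<^sup>2))))"
    by (subst sum.swap) (simp only: sum_distrib_left)
  also have "\<dots> \<le> (\<Sum>j\<in>J. a powr \<alpha> * (\<Sum>\<xi>\<in>?A'. ?w \<xi> * mean_osc N (?n j) (\<lambda>x. u (\<xi>(x := \<xi> x + c)))))"
    unfolding h_def by (intro sum_mono mean_osc_lower_bound c a n inc) auto
  also have "\<dots> = a powr \<alpha> * (\<Sum>\<xi>\<in>?A'. ?w \<xi> * (\<Sum>j\<in>J. mean_osc N (?n j) (\<lambda>x. u (\<xi>(x := \<xi> x + c)))))"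
    unfolding sum_distrib_left by (rule sum.swap)
  also have "\<dots> \<le> a powr \<alpha> * (\<Sum>\<xi>\<in>?A'. ?w \<xi> * (2 * (real CARD('d) * real N)\<^sup>2 * torus_energy N (\<lambda>x. u (\<xi>(x := \<xi> x + c)))))"
    using w by (intro mult_left_mono sum_mono upper) auto
  also have "\<dots> = 2 * (real CARD('d) * real N)\<^sup>2 * a powr \<alpha> * (\<Sum>\<xi>\<in>?A'. ?w \<xi> * torus_energy N (\<lambda>x. u (\<xi>(x := \<xi> x + c))))"
    by (simp add: sum_distrib_left mult_ac)
  finally show ?thesis unfolding Osc_def h_def .
qed

section \<open>Orlicz norm of a configuration\<close>

text \<open>The norm is tested at one value \<open>t\<close> with two parts. The summand
  \<open>b powr \<alpha>\<close> pulls \<open>b\<close> out of the thresholds: where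
  \<open>g x powr \<alpha>\<close> exceeds \<open>t * \<theta> j\<close>, it exceeds the level
  \<open>j\<close> threshold for mass bound \<open>b\<close>, and for \<open>j\<close> outside
  \<open>J\<close> this never happens, as \<open>g x\<close> is at most the total mass. The
  oscillation part makes the sum of all tails at most \<open>N ^ d * t\<close>.\<close>

lemma orlicz_norm_le_mean_osc:
  fixes g :: "('d::finite \<Rightarrow> nat) \<Rightarrow> real"
  assumes N: "0 < N" and b: "0 < b" and \<alpha>: "0 < \<alpha>" and J: "finite J"
    and JN: "\<And>j. j \<in> J \<Longrightarrow> 2 ^ j \<le> N"
    and g: "\<And>x. x \<in> torus N \<Longrightarrow> 0 \<le> g x" and mass: "(\<Sum>x\<in>torus N. g x) \<le> b * real N ^ CARD('d)"
    and \<theta>: "\<And>j. 4 * (2 * (2 ^ (j + 1)) ^ CARD('d)) powr \<alpha> \<le> \<theta> j"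
    and \<theta>N: "\<And>j. j \<notin> J \<Longrightarrow> (real N ^ CARD('d)) powr \<alpha> \<le> \<theta> j"
  shows "orlicz_norm N (hinge_young \<theta>) (\<lambda>x. g x powr \<alpha>)
     \<le> b powr \<alpha> + 8 / real N ^ CARD('d) * (\<Sum>j\<in>J. mean_osc N (N div 2 ^ j) (\<lambda>x. g x powr (\<alpha> / 2)))"
proof -
  define S where "S = (\<Sum>j\<in>J. mean_osc N (N div 2 ^ j) (\<lambda>x. g x powr (\<alpha> / 2)))"
  define t where "t = b powr \<alpha> + 8 / real N ^ CARD('d) * S"
  define tail where "tail = (\<lambda>j x. if 4 * (2 * b * (2 ^ (j + 1)) ^ CARD('d)) powr \<alpha> < g x powr \<alpha> then g x powr \<alpha> else 0)"
  have S: "0 \<le> S" by (simp add: S_def sum_nonneg mean_osc_nonneg)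
  have ba: "0 < b powr \<alpha>" using b by simp
  have t: "0 < t" "b powr \<alpha> \<le> t" using S ba by (auto simp: t_def intro!: add_pos_nonneg)
  have Nd: "0 < real N ^ CARD('d)" using N by simp
  have young: "hinge_young \<theta> (g x powr \<alpha> / t) \<le> ennreal ((\<Sum>j\<in>J. tail j x) / t)" if x: "x \<in> torus N" for x
  proof -
    have "g x \<le> (\<Sum>x\<in>torus N. g x)" using x g by (intro member_le_sum) auto
    with mass have "g x \<le> b * real N ^ CARD('d)" by linarith
    then have "g x powr \<alpha> \<le> (b * real N ^ CARD('d)) powr \<alpha>" using g[OF x] \<alpha> by (intro powr_mono2) auto
    also have "\<dots> = b powr \<alpha> * (real N ^ CARD('d)) powr \<alpha>" using b by (simp add: powr_mult)
    also have "\<dots> \<le> t * (real N ^ CARD('d)) powr \<alpha>" using t by (intro mult_right_mono) auto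
    finally have "g x powr \<alpha> / t \<le> (real N ^ CARD('d)) powr \<alpha>" using t by (simp add: pos_divide_le_eq mult.commute)
    then have outside: "g x powr \<alpha> / t \<le> \<theta> j" if "j \<notin> J" for j using \<theta>N[OF that] by linarith
    have "hinge_young \<theta> (g x powr \<alpha> / t) = (\<Sum>j\<in>J. ennreal (max 0 (\<bar>g x powr \<alpha> / t\<bar> - \<theta> j)))"
      unfolding hinge_young_def
    proof (rule suminf_finite[OF J])
      fix j assume "j \<notin> J"
      then have "max 0 (\<bar>g x powr \<alpha> / t\<bar> - \<theta> j) = 0" using outside[of j] t by simp
      then show "ennreal (max 0 (\<bar>g x powr \<alpha> / t\<bar> - \<theta> j)) = 0" by simp
    qed
    also have "\<dots> \<le> (\<Sum>j\<in>J. ennreal (tail j x / t))"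
    proof (intro sum_mono ennreal_leI)
      fix j assume "j \<in> J"
      have "0 \<le> 4 * (2 * (2 ^ (j + 1)) ^ CARD('d)) powr \<alpha>" by simp
      then have \<theta>0: "0 \<le> \<theta> j" using \<theta>[of j] by linarith
      show "max 0 (\<bar>g x powr \<alpha> / t\<bar> - \<theta> j) \<le> tail j x / t"
      proof (cases "\<theta> j < g x powr \<alpha> / t")
        case True
        have "4 * (2 * b * (2 ^ (j + 1)) ^ CARD('d)) powr \<alpha> = b powr \<alpha> * (4 * (2 * (2 ^ (j + 1)) ^ CARD('d)) powr \<alpha>)"
          using b by (simp add: powr_mult mult_ac)
        also have "\<dots> \<le> t * \<theta> j" using t \<theta>[of j] by (intro mult_mono) auto
        also have "\<dots> < g x powr \<alpha>" using True t by (simp add: pos_less_divide_eq mult.commute)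
        finally have "tail j x = g x powr \<alpha>" by (simp only: tail_def if_True)
        then show ?thesis using \<theta>0 t by simp
      next
        case False
        then show ?thesis using t by (simp add: tail_def)
      qed
    qed
    also have "\<dots> = ennreal ((\<Sum>j\<in>J. tail j x) / t)"
      unfolding sum_divide_distrib using t by (intro sum_ennreal) (auto simp: tail_def)
    finally show ?thesis .
  qed
  have "(\<Sum>x\<in>torus N. \<Sum>j\<in>J. tail j x) = (\<Sum>j\<in>J. \<Sum>x\<in>torus N. tail j x)" by (rule sum.swap)
  also have "\<dots> \<le> (\<Sum>j\<in>J. 8 * mean_osc N (N div 2 ^ j) (\<lambda>x. g x powr (\<alpha> / 2)))"
    unfolding tail_def by (intro sum_mono block_tail_le_mean_osc JN \<alpha> b g mass)
  also have "\<dots> = 8 * S" by (simp add: S_def sum_distrib_left)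
  also have "\<dots> \<le> real N ^ CARD('d) * t" using Nd ba by (simp add: t_def field_simps)
  finally have total: "(\<Sum>x\<in>torus N. \<Sum>j\<in>J. tail j x) \<le> real N ^ CARD('d) * t" .
  have "(\<Sum>x\<in>torus N. hinge_young \<theta> (g x powr \<alpha> / t)) \<le> (\<Sum>x\<in>torus N. ennreal ((\<Sum>j\<in>J. tail j x) / t))"
    by (rule sum_mono) (rule young)
  also have "\<dots> = ennreal (\<Sum>x\<in>torus N. (\<Sum>j\<in>J. tail j x) / t)"
    using t by (intro sum_ennreal) (auto simp: tail_def sum_nonneg)
  also have "\<dots> \<le> ennreal (real N ^ CARD('d))"
    unfolding sum_divide_distrib[symmetric] using total t by (intro ennreal_leI) (simp add: pos_divide_le_eq)
  finally have "ennreal (1 / real N ^ CARD('d)) * (\<Sum>x\<in>torus N. hinge_young \<theta> (g x powr \<alpha> / t))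
      \<le> ennreal (1 / real N ^ CARD('d)) * ennreal (real N ^ CARD('d))"
    by (rule mult_left_mono) simp
  also have "\<dots> = 1" using Nd by (simp flip: ennreal_mult)
  finally have "t \<in> {t. t > 0 \<and> ennreal (1 / real N ^ CARD('d)) * (\<Sum>x\<in>torus N. hinge_young \<theta> (g x powr \<alpha> / t)) \<le> 1}"
    using t by simp
  then have "orlicz_norm N (hinge_young \<theta>) (\<lambda>x. g x powr \<alpha>) \<le> t"
    unfolding orlicz_norm_def by (intro cInf_lower bdd_belowI[of _ 0]) auto
  then show ?thesis by (simp add: t_def S_def)
qed

section \<open>The exponential estimate\<close>

lemma ln_ennreal_le:
  assumes "x \<le> ennreal r" "0 < r"
  shows "ln_ennreal x \<le> ereal (ln r)"
proof (cases x)
  case (real s)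
  then have "s \<le> r" using assms by simp
  then show ?thesis using real assms(2) by (auto simp: ln_ennreal_def)
next
  case top
  then show ?thesis using assms by (simp add: top_unique)
qed

text \<open>Each coordinate is right-continuous with values in a lattice of spacing
  \<open>c\<close>, so once it is closer than \<open>c\<close> to its value at \<open>s\<close> it
  equals that value. The torus has finitely many sites, and configurations vanish elsewhere.\<close>

lemma zero_range_right_locally_constant:
  fixes \<eta> :: "real \<Rightarrow> 'w \<Rightarrow> (('d::finite \<Rightarrow> nat) \<Rightarrow> real)"
  assumes c: "0 < c" and zr: "zero_range_process \<alpha> c N M \<eta>" and \<omega>: "\<omega> \<in> space M" and s: "0 \<le> s"
  shows "eventually (\<lambda>r. \<eta> r \<omega> = \<eta> s \<omega>) (at_right s)"
proof -
  have cadlag: "cadlag (\<lambda>t. \<eta> t \<omega>)"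
    and meas: "\<And>r. 0 \<le> r \<Longrightarrow> \<eta> r \<in> measurable M (count_space (configs c N))"
    using zr \<omega> by (auto simp: zero_range_process_def markov_process_def)
  have conf: "\<eta> r \<omega> \<in> configs c N" if "0 \<le> r" for r
    using measurable_space[OF meas[OF that] \<omega>] by simp
  have lim: "((\<lambda>r. \<eta> r \<omega>) \<longlongrightarrow> \<eta> s \<omega>) (at_right s)"
    using cadlag s by (simp add: cadlag_def continuous_within)
  have "eventually (\<lambda>r. \<forall>x\<in>torus N. \<eta> r \<omega> x = \<eta> s \<omega> x) (at_right s)"
  proof (intro eventually_ball_finite finite_torus ballI)
    fix x :: "'d \<Rightarrow> nat" assume x: "x \<in> torus N"
    have "continuous_on UNIV (\<lambda>\<zeta> :: ('d \<Rightarrow> nat) \<Rightarrow> real. \<zeta> x)"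
      by (rule continuous_on_product_coordinates)
    then have "isCont (\<lambda>\<zeta>. \<zeta> x) (\<eta> s \<omega>)"
      by (metis continuous_on_eq_continuous_at open_UNIV UNIV_I)
    from isCont_tendsto_compose[OF this lim] have "((\<lambda>r. \<eta> r \<omega> x) \<longlongrightarrow> \<eta> s \<omega> x) (at_right s)" .
    then have "eventually (\<lambda>r. dist (\<eta> r \<omega> x) (\<eta> s \<omega> x) < c) (at_right s)"
      using c by (rule tendstoD)
    then show "eventually (\<lambda>r. \<eta> r \<omega> x = \<eta> s \<omega> x) (at_right s)"
      using eventually_at_right_less[of s]
    proof eventually_elim
      fix r assume r: "dist (\<eta> r \<omega> x) (\<eta> s \<omega> x) < c" "s < r"
      obtain k l :: nat where kl: "\<eta> r \<omega> x = c * real k" "\<eta> s \<omega> x = c * real l"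
        using conf[of r] conf[of s] r(2) s x by (fastforce simp: configs_def)
      have "c * \<bar>real k - real l\<bar> < c * 1"
        using r(1) c unfolding kl dist_real_def by (simp flip: right_diff_distrib add: abs_mult)
      then have "\<bar>real k - real l\<bar> < 1" using c by (simp only: mult_less_cancel_left_pos)
      then have "k = l" by linarith
      then show "\<eta> r \<omega> x = \<eta> s \<omega> x" by (simp add: kl)
    qed
  qed
  then show ?thesis
    using eventually_at_right_less[of s]
  proof eventually_elim
    fix r assume r: "\<forall>x\<in>torus N. \<eta> r \<omega> x = \<eta> s \<omega> x" "s < r"
    show "\<eta> r \<omega> = \<eta> s \<omega>"
    proof
      fix x show "\<eta> r \<omega> x = \<eta> s \<omega> x"
        using r conf[of r] conf[of s] s by (cases "x \<in> torus N") (auto simp: configs_def)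
    qed
  qed
qed

text \<open>The constants come from matching coefficients. The generator yields
  \<open>N ^ 2 / (2 * c)\<close> times the energy and \<open>spectral_lower_bound\<close> costs
  \<open>2 * (d * N) ^ 2\<close>, so the oscillation enters with
  \<open>- 1 / (8 * d ^ 2 * c)\<close>. The potential adds at most \<open>8 * \<beta> / c\<close>
  times the oscillation, which cancels it exactly; \<open>\<Lambda>\<close> is what remains after
  \<open>N ^ d / c\<close> is factored out.\<close>

lemma zero_range_exponential_bound:
  fixes \<eta> :: "real \<Rightarrow> 'w \<Rightarrow> (('d::finite \<Rightarrow> nat) \<Rightarrow> real)"
  assumes c: "0 < c" and N: "0 < N" and zr: "zero_range_process \<alpha> c N M \<eta>"
    and init: "distr M (count_space (configs c N)) (\<eta> 0) = zr_equilibrium \<alpha> c N a"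
    and a: "0 < a" and b: "0 < b" and t: "0 < t" and \<alpha>: "0 < \<alpha>"
    and J: "finite J" "0 \<in> J" "\<And>j. j \<in> J \<Longrightarrow> 2 ^ j \<le> N"
    and inc: "\<And>j s. j \<in> J \<Longrightarrow> 0 \<le> s \<Longrightarrow> (s + c) powr (\<alpha> / 2) \<le> s powr (\<alpha> / 2) + 1 / 2 ^ (j + 7) * (1 + s powr (\<alpha> / 2))"
    and \<theta>: "\<And>j. 4 * (2 * (2 ^ (j + 1)) ^ CARD('d)) powr \<alpha> \<le> \<theta> j"
    and \<theta>N: "\<And>j. j \<notin> J \<Longrightarrow> (real N ^ CARD('d)) powr \<alpha> \<le> \<theta> j"
  defines "\<beta> \<equiv> 1 / (64 * (real CARD('d))\<^sup>2)"
    and "\<Lambda> \<equiv> (1 + 8 * (2 * b * 2 ^ CARD('d)) powr \<alpha>) / (128 * (real CARD('d))\<^sup>2) + b powr \<alpha> / (64 * (real CARD('d))\<^sup>2)"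
  shows "(\<integral>\<^sup>+ \<omega>. ennreal (exp (\<beta> * real N ^ CARD('d) / c * (LINT s:{0..t}|lborel.
            orlicz_norm N (hinge_young \<theta>) (\<lambda>x. \<eta> s \<omega> x powr \<alpha>) *
            indicator (configs_mass_le c N b) (\<eta> s \<omega>)))) \<partial>M)
         \<le> ennreal (1 + exp ((real N ^ CARD('d) / c * \<Lambda> + 1) * t))"
proof -
  let ?S = "configs c N :: (('d \<Rightarrow> nat) \<Rightarrow> real) set" and ?w = "zr_weight \<alpha> c N a"
  let ?d = "real CARD('d)" and ?Nd = "real N ^ CARD('d)"
  define m where "m = b * ?Nd"
  define A where "A = (configs_total_le c N m :: (('d \<Rightarrow> nat) \<Rightarrow> real) set)"
  define G where "G = (\<lambda>F (\<zeta> :: ('d \<Rightarrow> nat) \<Rightarrow> real). (real N)\<^sup>2 * zr_generator \<alpha> c N F \<zeta>)"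
  define W where "W = (\<lambda>\<zeta> :: ('d \<Rightarrow> nat) \<Rightarrow> real. orlicz_norm N (hinge_young \<theta>) (\<lambda>x. \<zeta> x powr \<alpha>))"
  define V where "V = (\<lambda>\<zeta>. \<beta> * ?Nd / c * (W \<zeta> * indicator A \<zeta>))"
  have A_eq: "configs_mass_le c N b = A" by (simp add: A_def m_def configs_mass_le_eq N)
  have d: "0 < ?d" by simp
  have Nd: "0 < ?Nd" using N by simp
  have moves_total: "move c \<zeta> x y \<in> configs_total_le c N m'"
    if "\<zeta> \<in> configs_total_le c N m'" "x \<in> torus N" "y \<in> torus N" "\<zeta> x \<noteq> 0" for \<zeta> :: "('d \<Rightarrow> nat) \<Rightarrow> real" and x y m'
    using that by (simp add: configs_total_le_def move_in_configs sum_move)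
  have X: "markov_process M ?S G \<eta>"
    using zr by (simp add: zero_range_process_def G_def)
  interpret prob_space M using X by (simp add: markov_process_def)
  define Z where "Z = (1 / zr_partition \<alpha> (a / c)) ^ card (torus N :: ('d \<Rightarrow> nat) set)"
  \<comment> \<open>\<open>ennreal\<close> cuts negative reals off at 0, so \<open>max 0 Z\<close>
    gives the mass for either sign of \<open>Z\<close> and meets the requirement
    \<open>0 \<le> C\<close>.\<close>
  have law: "measure M {\<omega> \<in> space M. \<eta> 0 \<omega> = \<zeta>} = max 0 Z * ?w \<zeta>" if \<zeta>: "\<zeta> \<in> A" for \<zeta>
  proof -
    have \<zeta>S: "\<zeta> \<in> ?S" using \<zeta> by (simp add: A_def configs_total_le_def)
    have meas: "\<eta> 0 \<in> measurable M (count_space ?S)" using X by (simp add: markov_process_def)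
    have w: "0 < ?w \<zeta>" by (rule zr_weight_pos[OF a c])
    have "{\<omega> \<in> space M. \<eta> 0 \<omega> = \<zeta>} = \<eta> 0 -` {\<zeta>} \<inter> space M" by auto
    then have "measure M {\<omega> \<in> space M. \<eta> 0 \<omega> = \<zeta>} = measure (distr M (count_space ?S) (\<eta> 0)) {\<zeta>}"
      using \<zeta>S by (simp add: measure_distr[OF meas])
    also have "\<dots> = measure (zr_equilibrium \<alpha> c N a) {\<zeta>}" by (simp add: init)
    also have "\<dots> = enn2real (ennreal (\<Prod>x\<in>torus N. (a / c) powr (\<alpha> * \<zeta> x / c)
        / ((fact (nat \<lfloor>\<zeta> x / c\<rfloor>)) powr \<alpha> * zr_partition \<alpha> (a / c))))"
      unfolding zr_equilibrium_def measure_def using \<zeta>S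
      by (subst emeasure_density) (auto simp: nn_integral_indicator_singleton one_ennreal_def[symmetric])
    also have "(\<Prod>x\<in>torus N. (a / c) powr (\<alpha> * \<zeta> x / c)
        / ((fact (nat \<lfloor>\<zeta> x / c\<rfloor>)) powr \<alpha> * zr_partition \<alpha> (a / c))) = ?w \<zeta> * Z"
      unfolding zr_weight_def Z_def prod_constant[symmetric] prod.distrib[symmetric]
      by (intro prod.cong refl) simp
    also have "enn2real (ennreal (?w \<zeta> * Z)) = max 0 Z * ?w \<zeta>"
      using w by (cases "0 \<le> Z") (auto simp: ennreal_neg mult_nonneg_nonpos)
    finally show ?thesis .
  qed
  have W_le: "W \<zeta> \<le> b powr \<alpha> + 8 / ?Nd * (\<Sum>j\<in>J. mean_osc N (N div 2 ^ j) (\<lambda>x. \<zeta> x powr (\<alpha> / 2)))" if "\<zeta> \<in> A" for \<zeta>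
    unfolding W_def using that configs_nonneg[OF c]
    by (intro orlicz_norm_le_mean_osc[OF N b \<alpha> J(1,3) _ _ \<theta> \<theta>N]) (auto simp: A_def configs_total_le_def m_def)
  have form: "(\<Sum>\<zeta>\<in>A. ?w \<zeta> * u \<zeta> * (\<Sum>\<zeta>'\<in>A. G (indicator {\<zeta>'}) \<zeta> * u \<zeta>')) + (\<Sum>\<zeta>\<in>A. ?w \<zeta> * V \<zeta> * (u \<zeta>)\<^sup>2)
      \<le> ?Nd / c * \<Lambda> * (\<Sum>\<zeta>\<in>A. ?w \<zeta> * (u \<zeta>)\<^sup>2)" for u
  proof -
    define Osc where "Osc = (\<lambda>\<zeta> :: ('d \<Rightarrow> nat) \<Rightarrow> real. \<Sum>j\<in>J. mean_osc N (N div 2 ^ j) (\<lambda>x. \<zeta> x powr (\<alpha> / 2)))"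
    define E where "E = a powr \<alpha> * (\<Sum>\<xi>\<in>configs_total_le c N (m - c). ?w \<xi> * torus_energy N (\<lambda>x. u (\<xi>(x := \<xi> x + c))))"
    define T where "T = (1 + 8 * (2 * b * 2 ^ CARD('d)) powr \<alpha>) / 32"
    have spectral: "(\<Sum>\<zeta>\<in>A. ?w \<zeta> * (u \<zeta>)\<^sup>2 * (Osc \<zeta> / 2 - ?Nd * T)) \<le> 2 * (?d * real N)\<^sup>2 * E"
      using spectral_lower_bound[OF c a b \<alpha> J(1,2,3) inc, of u]
      unfolding A_def m_def Osc_def E_def T_def by (simp only: mult.assoc)
    have "(\<Sum>\<zeta>\<in>A. ?w \<zeta> * u \<zeta> * (\<Sum>\<zeta>'\<in>A. G (indicator {\<zeta>'}) \<zeta> * u \<zeta>'))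
        = (\<Sum>\<zeta>\<in>A. (real N)\<^sup>2 * (?w \<zeta> * u \<zeta> * zr_generator \<alpha> c N u \<zeta>))"
    proof (intro sum.cong refl)
      fix \<zeta> assume "\<zeta> \<in> A"
      then have "(\<Sum>\<zeta>'\<in>A. zr_generator \<alpha> c N (indicator {\<zeta>'}) \<zeta> * u \<zeta>') = zr_generator \<alpha> c N u \<zeta>"
        unfolding A_def by (intro zr_generator_expand finite_configs_total_le c moves_total)
      then have "(\<Sum>\<zeta>'\<in>A. G (indicator {\<zeta>'}) \<zeta> * u \<zeta>') = (real N)\<^sup>2 * zr_generator \<alpha> c N u \<zeta>"
        unfolding G_def mult.assoc sum_distrib_left[symmetric] by simp
      then show "?w \<zeta> * u \<zeta> * (\<Sum>\<zeta>'\<in>A. G (indicator {\<zeta>'}) \<zeta> * u \<zeta>') = (real N)\<^sup>2 * (?w \<zeta> * u \<zeta> * zr_generator \<alpha> c N u \<zeta>)"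
        by (simp add: mult_ac)
    qed
    also have "\<dots> = - ((real N)\<^sup>2 * E / (2 * c))"
      unfolding sum_distrib_left[symmetric] A_def zr_dirichlet_form[OF c a N] E_def by simp
    also have "\<dots> \<le> - ((\<Sum>\<zeta>\<in>A. ?w \<zeta> * (u \<zeta>)\<^sup>2 * (Osc \<zeta> / 2 - ?Nd * T)) / (4 * ?d\<^sup>2 * c))"
      using spectral c d by (simp add: field_simps power_mult_distrib)
    also have "\<dots> = (\<Sum>\<zeta>\<in>A. ?w \<zeta> * (u \<zeta>)\<^sup>2 * ((?Nd * T - Osc \<zeta> / 2) / (4 * ?d\<^sup>2 * c)))"
      unfolding sum_divide_distrib sum_negf[symmetric]
      by (intro sum.cong refl) (simp add: right_diff_distrib diff_divide_distrib)
    finally have gen: "(\<Sum>\<zeta>\<in>A. ?w \<zeta> * u \<zeta> * (\<Sum>\<zeta>'\<in>A. G (indicator {\<zeta>'}) \<zeta> * u \<zeta>'))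
        \<le> (\<Sum>\<zeta>\<in>A. ?w \<zeta> * (u \<zeta>)\<^sup>2 * ((?Nd * T - Osc \<zeta> / 2) / (4 * ?d\<^sup>2 * c)))" .
    have "V \<zeta> \<le> (?Nd * b powr \<alpha> + 8 * Osc \<zeta>) / (64 * ?d\<^sup>2 * c)" if "\<zeta> \<in> A" for \<zeta>
    proof -
      have "V \<zeta> = \<beta> * ?Nd / c * W \<zeta>" using that by (simp add: V_def)
      also have "\<dots> \<le> \<beta> * ?Nd / c * (b powr \<alpha> + 8 / ?Nd * Osc \<zeta>)"
        unfolding Osc_def using W_le[OF that] c by (intro mult_left_mono) (auto simp: \<beta>_def)
      also have "\<dots> = (?Nd * b powr \<alpha> + 8 * Osc \<zeta>) / (64 * ?d\<^sup>2 * c)"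
        using Nd d c by (simp add: \<beta>_def field_simps)
      finally show ?thesis .
    qed
    then have "(\<Sum>\<zeta>\<in>A. ?w \<zeta> * V \<zeta> * (u \<zeta>)\<^sup>2)
        \<le> (\<Sum>\<zeta>\<in>A. ?w \<zeta> * (u \<zeta>)\<^sup>2 * ((?Nd * b powr \<alpha> + 8 * Osc \<zeta>) / (64 * ?d\<^sup>2 * c)))"
      unfolding mult.assoc mult.commute[of "V _"]
      by (intro sum_mono mult_left_mono) (auto intro: less_imp_le[OF zr_weight_pos[OF a c]])
    with gen have "(\<Sum>\<zeta>\<in>A. ?w \<zeta> * u \<zeta> * (\<Sum>\<zeta>'\<in>A. G (indicator {\<zeta>'}) \<zeta> * u \<zeta>')) + (\<Sum>\<zeta>\<in>A. ?w \<zeta> * V \<zeta> * (u \<zeta>)\<^sup>2)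
        \<le> (\<Sum>\<zeta>\<in>A. ?w \<zeta> * (u \<zeta>)\<^sup>2 * ((?Nd * T - Osc \<zeta> / 2) / (4 * ?d\<^sup>2 * c) + (?Nd * b powr \<alpha> + 8 * Osc \<zeta>) / (64 * ?d\<^sup>2 * c)))"
      unfolding distrib_left sum.distrib by (rule add_mono)
    also have "\<dots> = ?Nd / c * \<Lambda> * (\<Sum>\<zeta>\<in>A. ?w \<zeta> * (u \<zeta>)\<^sup>2)"
    proof -
      have "(?Nd * T - r / 2) / (4 * ?d\<^sup>2 * c) + (?Nd * b powr \<alpha> + 8 * r) / (64 * ?d\<^sup>2 * c) = ?Nd / c * \<Lambda>" for r
      proof -
        have \<Lambda>: "\<Lambda> = T / (4 * ?d\<^sup>2) + b powr \<alpha> / (64 * ?d\<^sup>2)" by (simp add: \<Lambda>_def T_def)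
        show ?thesis unfolding \<Lambda> using d c by (simp add: field_simps)
      qed
      then show ?thesis by (simp add: sum_distrib_left mult_ac)
    qed
    finally show ?thesis .
  qed
  have "(\<integral>\<^sup>+ \<omega>. ennreal (exp (LINT s:{0..t}|lborel. V (\<eta> s \<omega>))) \<partial>M) \<le> ennreal (1 + exp ((?Nd / c * \<Lambda> + 1) * t))"
  proof (rule feynman_kac_bound[OF X _ _ _ _ _ _ _ _ law form t])
    show "eventually (\<lambda>r. \<eta> r \<omega> = \<eta> s \<omega>) (at_right s)" if "\<omega> \<in> space M" "0 \<le> s" for \<omega> s
      by (rule zero_range_right_locally_constant[OF c zr that])
    show "finite A" unfolding A_def by (rule finite_configs_total_le[OF c])
    show "A \<subseteq> ?S" by (auto simp: A_def configs_total_le_def)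
    show "G (indicator A) \<zeta> = 0" if "\<zeta> \<in> A" for \<zeta>
      unfolding G_def using that moves_total
      by (subst zr_generator_indicator_eq_0) (auto simp: A_def)
    show "\<exists>B. finite B \<and> B \<subseteq> ?S - A \<and> \<zeta> \<in> B \<and> (\<forall>\<zeta>'\<in>B. G (indicator B) \<zeta>' = 0)" if \<zeta>: "\<zeta> \<in> ?S - A" for \<zeta>
    proof (intro exI conjI ballI)
      \<comment> \<open>Jumps conserve the total mass, so the configurations with the mass of
        \<zeta> form a finite invariant set outside \<open>A\<close>.\<close>
      let ?B = "{\<zeta>' \<in> ?S. (\<Sum>x\<in>torus N. \<zeta>' x) = (\<Sum>x\<in>torus N. \<zeta> x)}"
      show "finite ?B"
        by (rule finite_subset[OF _ finite_configs_total_le[OF c, of N "\<Sum>x\<in>torus N. \<zeta> x"]]) (auto simp: configs_total_le_def)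
      show "?B \<subseteq> ?S - A" "\<zeta> \<in> ?B" using \<zeta> by (auto simp: A_def configs_total_le_def)
      show "G (indicator ?B) \<zeta>' = 0" if "\<zeta>' \<in> ?B" for \<zeta>'
        unfolding G_def using that
        by (subst zr_generator_indicator_eq_0) (auto simp: move_in_configs sum_move)
    qed
    show "V \<zeta> = 0" if "\<zeta> \<notin> A" for \<zeta> using that by (simp add: V_def)
    show "0 < ?w \<zeta>" for \<zeta> by (rule zr_weight_pos[OF a c])
  qed simp
  then show ?thesis by (simp add: V_def W_def A_eq)
qed

text \<open>The kinks of the Young function are pushed so far out that on the torus of side \<open>N\<close> only those levels \<open>j\<close> matter
  for which \<open>chi N\<close> is already small enough, \<open>k j \<le> N\<close>.\<close>

theorem theorem3:
  fixes \<alpha> :: real and chi :: "nat \<Rightarrow> real"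
  assumes "\<alpha> \<ge> 1"
    and "\<forall>N\<ge>1. chi N > 0"
    and "chi \<longlonglongrightarrow> 0"
  shows "\<exists>\<beta>>0. \<exists>\<Phi>. strict_young_function \<Phi> \<and>
    (\<forall>t_fin>0. \<forall>a>0. \<forall>b>0.
      \<forall>(M :: nat \<Rightarrow> 'w measure) (\<eta> :: nat \<Rightarrow> real \<Rightarrow> 'w \<Rightarrow> (('d::finite \<Rightarrow> nat) \<Rightarrow> real)).
        (\<forall>N\<ge>1. zero_range_process \<alpha> (chi N) N (M N) (\<eta> N) \<and>
           distr (M N) (count_space (configs (chi N) N)) (\<eta> N 0) = zr_equilibrium \<alpha> (chi N) N a) \<longrightarrow>
        limsup (\<lambda>N. ereal (chi N / real N ^ CARD('d)) *
          ln_ennreal (\<integral>\<^sup>+ \<omega>. ennreal (exp (\<beta> * real N ^ CARD('d) / chi N *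
            (LINT s:{0..t_fin}|lborel.
               orlicz_norm N \<Phi> (\<lambda>x. \<eta> N s \<omega> x powr \<alpha>) *
               indicator (configs_mass_le (chi N) N b) (\<eta> N s \<omega>)))) \<partial>M N)) < \<infinity>)"
proof -
  \<comment> \<open>From side \<open>k j\<close> on, level \<open>j\<close> is admissible: the box
    of side \<open>N div 2 ^ j\<close> is nonempty, and one particle of size \<open>chi N\<close>
    changes the power by no more than the error allotted to this level.\<close>
  have "\<exists>k. \<forall>N\<ge>k. 1 \<le> N \<and> 2 ^ j \<le> N \<and> (\<forall>s\<ge>0. (s + chi N) powr (\<alpha> / 2)
      \<le> s powr (\<alpha> / 2) + 1 / 2 ^ (j + 7) * (1 + s powr (\<alpha> / 2)))" for j :: nat
  proof -
    obtain c0 where c0: "0 < c0" "\<And>c s. 0 < c \<Longrightarrow> c \<le> c0 \<Longrightarrow> 0 \<le> s \<Longrightarrow>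
        (s + c) powr (\<alpha> / 2) \<le> s powr (\<alpha> / 2) + 1 / 2 ^ (j + 7) * (1 + s powr (\<alpha> / 2))"
      using powr_increment_small[of "\<alpha> / 2" "1 / 2 ^ (j + 7)"] assms(1) by auto
    have "eventually (\<lambda>N. chi N < c0) sequentially" by (rule order_tendstoD(2)[OF assms(3) c0(1)])
    then have "eventually (\<lambda>N. 1 \<le> N \<and> 2 ^ j \<le> N \<and> (\<forall>s\<ge>0. (s + chi N) powr (\<alpha> / 2)
      \<le> s powr (\<alpha> / 2) + 1 / 2 ^ (j + 7) * (1 + s powr (\<alpha> / 2)))) sequentially"
      using eventually_ge_at_top[of "1::nat"] eventually_ge_at_top[of "2 ^ j :: nat"]
      by eventually_elim (use c0(2) assms(2) in \<open>auto simp: less_imp_le\<close>)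
    then show ?thesis by (simp add: eventually_sequentially)
  qed
  then obtain k where k: "\<And>j N. k j \<le> N \<Longrightarrow> 1 \<le> N" "\<And>j N. k j \<le> N \<Longrightarrow> 2 ^ j \<le> N"
    "\<And>j N s. k j \<le> N \<Longrightarrow> 0 \<le> s \<Longrightarrow> (s + chi N) powr (\<alpha> / 2)
      \<le> s powr (\<alpha> / 2) + 1 / 2 ^ (j + 7) * (1 + s powr (\<alpha> / 2))"
    by metis
  \<comment> \<open>The first entry is the tail threshold of level \<open>j\<close> for mass bound
    1; other mass bounds are handled by the scale inside the norm. The second is at least
    \<open>(N ^ d) powr \<alpha>\<close> whenever \<open>N < k j\<close>, which puts the kinks of
    inadmissible levels out of reach.\<close>
  define \<theta> where "\<theta> = (\<lambda>j. max (4 * (2 * (2 ^ (j + 1)) ^ CARD('d)) powr \<alpha>) ((real (k j) ^ CARD('d)) powr \<alpha>))"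
  have \<theta>_ge: "real j \<le> \<theta> j" for j
  proof -
    have "real j \<le> 2 ^ (j + 1)"
      by (meson le_add1 less_exp less_imp_le of_nat_le_iff order_trans of_nat_less_two_power power_increasing one_le_numeral)
    also have "\<dots> \<le> (2 ^ (j + 1)) ^ CARD('d)" by (rule self_le_power[OF one_le_power]) auto
    also have "\<dots> \<le> 2 * (2 ^ (j + 1)) ^ CARD('d)" by simp
    also have "\<dots> \<le> (2 * (2 ^ (j + 1)) ^ CARD('d)) powr \<alpha>"
    proof -
      have "1 \<le> (2 :: real) * (2 ^ (j + 1)) ^ CARD('d)"
      proof -
        have "1 \<le> (2 ^ (j + 1) :: real) ^ CARD('d)" by (intro one_le_power one_le_numeral)
        then show ?thesis by linarith
      qed
      from powr_mono[OF assms(1) this] show ?thesis by simp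
    qed
    also have "\<dots> \<le> 4 * (2 * (2 ^ (j + 1)) ^ CARD('d)) powr \<alpha>" by simp
    also have "\<dots> \<le> \<theta> j" by (simp only: \<theta>_def max.cobounded1)
    finally show ?thesis .
  qed
  define \<beta> where "\<beta> = 1 / (64 * (real CARD('d))\<^sup>2)"
  have \<beta>: "0 < \<beta>" by (simp add: \<beta>_def)
  have strict: "strict_young_function (hinge_young \<theta>)"
  proof (rule strict_young_function_hinge_young)
    show "0 \<le> \<theta> j" for j using \<theta>_ge[of j] by simp
    show "filterlim \<theta> at_top sequentially"
      by (rule filterlim_at_top_mono[OF filterlim_real_sequentially]) (intro always_eventually allI \<theta>_ge)
  qed
  have bound: "limsup (\<lambda>N. ereal (chi N / real N ^ CARD('d)) *
          ln_ennreal (\<integral>\<^sup>+ \<omega>. ennreal (exp (\<beta> * real N ^ CARD('d) / chi N *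
            (LINT s:{0..t}|lborel.
               orlicz_norm N (hinge_young \<theta>) (\<lambda>x. \<eta> N s \<omega> x powr \<alpha>) *
               indicator (configs_mass_le (chi N) N b) (\<eta> N s \<omega>)))) \<partial>M N)) < \<infinity>"
    if t: "0 < t" and a: "0 < a" and b: "0 < b"
      and proc: "\<forall>N\<ge>1. zero_range_process \<alpha> (chi N) N (M N) (\<eta> N) \<and>
           distr (M N) (count_space (configs (chi N) N)) (\<eta> N 0) = zr_equilibrium \<alpha> (chi N) N a"
    for t a b and M :: "nat \<Rightarrow> 'w measure" and \<eta> :: "nat \<Rightarrow> real \<Rightarrow> 'w \<Rightarrow> (('d \<Rightarrow> nat) \<Rightarrow> real)"
  proof -
    define \<Lambda> where "\<Lambda> = (1 + 8 * (2 * b * 2 ^ CARD('d)) powr \<alpha>) / (128 * (real CARD('d))\<^sup>2)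
        + b powr \<alpha> / (64 * (real CARD('d))\<^sup>2)"
    have \<Lambda>: "0 \<le> \<Lambda>" by (simp add: \<Lambda>_def)
    have "eventually (\<lambda>N. chi N < 1) sequentially" by (rule order_tendstoD(2)[OF assms(3)]) simp
    then have "eventually (\<lambda>N. ereal (chi N / real N ^ CARD('d)) *
          ln_ennreal (\<integral>\<^sup>+ \<omega>. ennreal (exp (\<beta> * real N ^ CARD('d) / chi N *
            (LINT s:{0..t}|lborel.
               orlicz_norm N (hinge_young \<theta>) (\<lambda>x. \<eta> N s \<omega> x powr \<alpha>) *
               indicator (configs_mass_le (chi N) N b) (\<eta> N s \<omega>)))) \<partial>M N) \<le> ereal (ln 2 + t + \<Lambda> * t)) sequentially"
      using eventually_ge_at_top[of "k 0"]
    proof eventually_elim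
      fix N assume chi1: "chi N < 1" and N: "k 0 \<le> N"
      let ?Nd = "real N ^ CARD('d)"
      have N1: "1 \<le> N" by (rule k(1)[OF N])
      have N0: "0 < N" using N1 by simp
      have c: "0 < chi N" using assms(2) N1 by simp
      have Nd: "1 \<le> ?Nd" using N1 by simp
      \<comment> \<open>Level 0 belongs to \<open>J\<close> because \<open>k 0 \<le> N\<close>, and
        \<open>2 ^ j \<le> N\<close> keeps \<open>J\<close> finite.\<close>
      define J where "J = {j. k j \<le> N}"
      have "J \<subseteq> {..N}"
      proof
        fix j assume "j \<in> J"
        then have "2 ^ j \<le> N" using k(2) by (simp add: J_def)
        then show "j \<in> {..N}" unfolding atMost_iff using less_exp[of j] by linarith
      qed
      then have J: "finite J" by (rule finite_subset) simp
      define L where "L = ?Nd / chi N * \<Lambda> + 1"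
      have L: "0 \<le> L" using c \<Lambda> by (simp add: L_def)
      define R where "R = (\<integral>\<^sup>+ \<omega>. ennreal (exp (\<beta> * ?Nd / chi N * (LINT s:{0..t}|lborel.
               orlicz_norm N (hinge_young \<theta>) (\<lambda>x. \<eta> N s \<omega> x powr \<alpha>) *
               indicator (configs_mass_le (chi N) N b) (\<eta> N s \<omega>)))) \<partial>M N)"
      have "R \<le> ennreal (1 + exp (L * t))"
        unfolding R_def \<beta>_def L_def \<Lambda>_def
      proof (rule zero_range_exponential_bound[where J = J, OF c N0])
        show "4 * (2 * (2 ^ (j + 1)) ^ CARD('d)) powr \<alpha> \<le> \<theta> j" for j by (simp only: \<theta>_def max.cobounded1)
        show "?Nd powr \<alpha> \<le> \<theta> j" if "j \<notin> J" for j
        proof -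
          have "?Nd powr \<alpha> \<le> (real (k j) ^ CARD('d)) powr \<alpha>"
            using that assms(1) by (intro powr_mono2 power_mono) (auto simp: J_def)
          also have "\<dots> \<le> \<theta> j" by (simp only: \<theta>_def max.cobounded2)
          finally show ?thesis .
        qed
      qed (use N N1 proc a b t assms(1) J k in \<open>auto simp: J_def\<close>)
      also have "\<dots> \<le> ennreal (2 * exp (L * t))"
        using L t by (intro ennreal_leI) simp
      finally have "ln_ennreal R \<le> ereal (ln (2 * exp (L * t)))"
        by (rule ln_ennreal_le) simp
      also have "ln (2 * exp (L * t)) = ln 2 + L * t" by (simp add: ln_mult)
      finally have "ereal (chi N / ?Nd) * ln_ennreal R \<le> ereal (chi N / ?Nd) * ereal (ln 2 + L * t)"
        using c by (intro ereal_mult_left_mono) auto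
      also have "\<dots> \<le> ereal (ln 2 + t + \<Lambda> * t)"
      proof -
        \<comment> \<open>With the prefactor at most 1, \<open>ln 2\<close> and the surplus 1 in
          \<open>L\<close> contribute at most \<open>ln 2 + t\<close>; in the
          \<open>\<Lambda>\<close> term the prefactor cancels \<open>?Nd / chi N\<close>
          exactly.\<close>
        have r: "chi N / ?Nd \<le> 1" using chi1 c Nd by (simp add: divide_le_eq)
        have "chi N / ?Nd * (ln 2 + L * t) = chi N / ?Nd * (ln 2 + t) + \<Lambda> * t"
          using c N0 by (simp add: L_def field_simps)
        also have "\<dots> \<le> 1 * (ln 2 + t) + \<Lambda> * t"
          using r t by (intro add_right_mono mult_right_mono) auto
        finally show ?thesis by simp
      qed
      finally show "ereal (chi N / ?Nd) * ln_ennreal (\<integral>\<^sup>+ \<omega>. ennreal (exp (\<beta> * ?Nd / chi N *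
            (LINT s:{0..t}|lborel.
               orlicz_norm N (hinge_young \<theta>) (\<lambda>x. \<eta> N s \<omega> x powr \<alpha>) *
               indicator (configs_mass_le (chi N) N b) (\<eta> N s \<omega>)))) \<partial>M N) \<le> ereal (ln 2 + t + \<Lambda> * t)"
        by (simp only: R_def)
    qed
    then have "limsup (\<lambda>N. ereal (chi N / real N ^ CARD('d)) *
          ln_ennreal (\<integral>\<^sup>+ \<omega>. ennreal (exp (\<beta> * real N ^ CARD('d) / chi N *
            (LINT s:{0..t}|lborel.
               orlicz_norm N (hinge_young \<theta>) (\<lambda>x. \<eta> N s \<omega> x powr \<alpha>) *
               indicator (configs_mass_le (chi N) N b) (\<eta> N s \<omega>)))) \<partial>M N)) \<le> ereal (ln 2 + t + \<Lambda> * t)"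
      by (rule Limsup_bounded)
    also have "\<dots> < \<infinity>" by simp
    finally show ?thesis .
  qed
  show ?thesis
    using \<beta> strict bound by blast
qed

end
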